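(* Let $n,k,l$ be integers with $1\le l<k\le n$ and $k-l\in\{1,2\}$, let $0<\delta<1/2$, and let $F(\lambda)=\sigma_k(\lambda)/\sigma_l(\lambda)$. There exist constants $A=A(n,k,l,\delta)\ge 2$ and $K=K(n,k,l,\delta)\ge 1$ such that the following holds. Whenever $\lambda\in\mathbb{R}^n$ satisfies $$\lambda_1=\lambda_2=\cdots=\lambda_m=:\lambda_{\max}>\lambda_{m+1}\ge\cdots\ge\lambda_n\ge 0,\qquad \sigma_k(\lambda)>0$$ for some integer $1\le m\le n$, and $$\lambda_{\max}\ge A\,F(\lambda)^{1/(k-l)},$$ we have $$-\sum_{i,j=1}^n F_{ij}\xi_i\xi_j+\frac{K}{F}\Big(\sum_{i=1}^n F_i\xi_i\Big)^2+\sum_{i>m}\frac{2F_i\xi_i^2}{\lambda_{\max}-\lambda_i}\ \ge\ (1+\delta)\frac{F_1\xi_1^2}{\lambda_{\max}}$$ for every $\xi\in\mathbb{R}^n$ satisfying $\xi_1=\xi_2=\cdots=\xi_m$, where $F$, $F_i$, $F_{ij}$ are evaluated at $\lambda$. When $m=n$, the terms involving $\lambda_{m+1}$ and the sums over $i>m$ are understood to be omitted.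
   Context: For $\lambda=(\lambda_1,\dots,\lambda_n)\in\mathbb{R}^n$, $\sigma_j(\lambda)$ denotes the $j$-th elementary symmetric function of $\lambda_1,\dots,\lambda_n$, with $\sigma_0=1$. $F_i=\partial F/\partial\lambda_i$ and $F_{ij}=\partial^2F/\partial\lambda_i\partial\lambda_j$ denote derivatives with respect to the eigenvalue variables. (If $\lambda$ has nonnegative entries and $\sigma_k(\lambda)>0$, then $\sigma_l(\lambda)>0$, so $F$ is smooth near $\lambda$.) *)

theory Defs
  imports "HOL-Analysis.Analysis"
begin

text \<open>A point of \<open>\<real>\<^sup>n\<close> is a function \<open>nat \<Rightarrow> real\<close> of which only the coordinates in \<open>{1..n}\<close> matter:
  \<open>esym n j\<close> does not depend on the others. This keeps the order of the coordinates available.\<close>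

definition esym :: "nat \<Rightarrow> nat \<Rightarrow> (nat \<Rightarrow> real) \<Rightarrow> real" where
  "esym n j x = (\<Sum>S | S \<subseteq> {1..n} \<and> card S = j. \<Prod>i\<in>S. x i)"

definition sigma_quot :: "nat \<Rightarrow> nat \<Rightarrow> nat \<Rightarrow> (nat \<Rightarrow> real) \<Rightarrow> real" where
  "sigma_quot n k l x = esym n k x / esym n l x"

definition pderiv1 :: "nat \<Rightarrow> ((nat \<Rightarrow> real) \<Rightarrow> real) \<Rightarrow> (nat \<Rightarrow> real) \<Rightarrow> real" where
  "pderiv1 i f x = deriv (\<lambda>t. f (x(i := t))) (x i)"

definition pderiv2 :: "nat \<Rightarrow> nat \<Rightarrow> ((nat \<Rightarrow> real) \<Rightarrow> real) \<Rightarrow> (nat \<Rightarrow> real) \<Rightarrow> real" where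
  "pderiv2 i j f = pderiv1 i (pderiv1 j f)"

end

theory Submission
  imports Defs "HOL-Computational_Algebra.Formal_Power_Series"
begin

text \<open>
  Along a line, \<open>F\<close> is treated as a formal power series \<open>F\<^sub>0 + F\<^sub>1 t + F\<^sub>2 t\<^sup>2 + \<dots>\<close>, so that
  \<open>\<Sum> F\<^sub>i \<xi>\<^sub>i = F\<^sub>1\<close> and \<open>\<Sum> F\<^sub>i\<^sub>j \<xi>\<^sub>i \<xi>\<^sub>j = 2 F\<^sub>2\<close>; the inequality is proved with \<open>K = 16\<close>.

  If \<open>\<lambda>\<^sub>k \<ge> c \<lambda>\<^sub>1\<close>, then \<open>F \<ge> const \<cdot> \<lambda>\<^sub>1\<^sup>k\<^sup>-\<^sup>l\<close>, which a large \<open>A\<close> excludes. Hence for some \<open>s < k\<close> the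
  variables \<open>\<lambda>\<^sub>1, \<dots>, \<lambda>\<^sub>s\<close> are much larger than \<open>\<lambda>\<^sub>s\<^sub>+\<^sub>1\<close> while \<open>\<lambda>\<^sub>s\<^sub>+\<^sub>1, \<dots>, \<lambda>\<^sub>k\<close> are comparable, the gap being
  as wide as one likes in terms of the comparability constant. By homogeneity \<open>\<lambda>\<^sub>s\<^sub>+\<^sub>1 = 1\<close>.

  In the variables \<open>X\<^sub>i = 1 / \<lambda>\<^sub>i\<close> (\<open>i \<le> s\<close>) the function \<open>F\<close> extends smoothly to \<open>X = 0\<close> (for \<open>s \<le> l\<close>), and the
  second derivative of \<open>1 / (\<lambda>\<^sub>i + t \<xi>\<^sub>i)\<close> contributes exactly \<open>2 F\<^sub>i \<xi>\<^sub>i\<^sup>2 / \<lambda>\<^sub>i\<close> to \<open>- \<Sum> F\<^sub>i\<^sub>j \<xi>\<^sub>i \<xi>\<^sub>j\<close>. It remains to absorb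
  the other terms. If \<open>k - s \<ge> 2\<close>, the limit \<open>\<sigma>\<^sub>k\<^sub>-\<^sub>s / \<sigma>\<^sub>l\<^sub>-\<^sub>s\<close> of \<open>F\<close> is uniformly strictly concave up to the \<open>K\<close>-term,
  which controls the small directions. If \<open>k - s = 1\<close> this limit is linear or singular, and one expands one
  order further; for \<open>k - l = 1\<close> this is the only place where the terms \<open>2 F\<^sub>i \<xi>\<^sub>i\<^sup>2 / (\<lambda>\<^sub>m\<^sub>a\<^sub>x - \<lambda>\<^sub>i)\<close> are needed.
\<close>

text \<open>As 1 + \<delta> < 3/2, the estimate is proved with 3/2 in place of 1 + \<delta>, so A
  does not depend on \<delta>; the difference to the factor 2 gained from the reciprocals is the
  budget for all errors. Write \<tau> = sum 1/x_i, \<omega> = sum |u_i|/x_i^2, \<chi> = sum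
  u_i^2/x_i^3 over the large variables and \<mu> for the length of the small part of the direction
  u. The dangerous errors mix large and small directions and have order \<omega> \<mu>;
  Cauchy-Schwarz, \<omega>^2 <= \<tau> \<chi>, splits them into \<chi> and \<tau> \<mu>^2. A limit
  with curvature of order \<mu>^2 absorbs the latter. For k - s = 1 the curvature in the small
  variables is itself only of order \<tau> \<mu>^2, so exact constants decide when l = s. When l = s
  - 1, F has order 1/\<tau>; after division by F the gain is \<chi>/\<tau>, far above errors of
  order \<chi>. The value 16 is the 4 of the concavity estimate for the limit, doubled when the
  derivative of the limit is replaced by that of F and doubled again when the value of the limit is
  replaced by F.\<close>

unbundle no vec_syntax
unbundle fps_syntax

subsection \<open>Elementary symmetric functions\<close>

definition es :: "nat set \<Rightarrow> nat \<Rightarrow> (nat \<Rightarrow> 'a::comm_ring_1) \<Rightarrow> 'a" where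
  "es I j x = (\<Sum>S | S \<subseteq> I \<and> card S = j. \<Prod>i\<in>S. x i)"

lemma esym_eq_es: "esym n j x = es {1..n} j x"
  by (simp add: esym_def es_def)

lemma es_cong: "(\<And>i. i \<in> I \<Longrightarrow> x i = y i) \<Longrightarrow> es I j x = es I j y"
  unfolding es_def by (intro sum.cong prod.cong) auto

lemma es_0 [simp]: "finite I \<Longrightarrow> es I 0 x = 1"
proof -
  assume "finite I"
  then have "{S. S \<subseteq> I \<and> card S = 0} = {{}}"
    by (auto simp: card_eq_0_iff dest: finite_subset)
  then show ?thesis by (simp add: es_def)
qed

lemma es_eq_0:
  assumes "finite I" "card I < j" shows "es I j x = 0"
proof -
  have "{S. S \<subseteq> I \<and> card S = j} = {}"
    using assms by (auto dest: card_mono)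
  then show ?thesis by (simp only: es_def sum.empty)
qed

lemma es_insert:
  assumes "finite I" "a \<notin> I"
  shows "es (insert a I) (Suc j) x = x a * es I j x + es I (Suc j) x"
proof -
  let ?A = "{S. S \<subseteq> I \<and> card S = Suc j}" and ?B = "{S. S \<subseteq> I \<and> card S = j}"
  have split: "{S. S \<subseteq> insert a I \<and> card S = Suc j} = ?A \<union> insert a ` ?B"
  proof (intro equalityI subsetI)
    fix S assume S: "S \<in> {S. S \<subseteq> insert a I \<and> card S = Suc j}"
    then have fin: "finite S" by (simp add: card_ge_0_finite)
    show "S \<in> ?A \<union> insert a ` ?B"
    proof (cases "a \<in> S")
      case True
      then have "S = insert a (S - {a})" "S - {a} \<in> ?B" using S fin by auto
      then show ?thesis by blast
    qed (use S in auto)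
  next
    fix S assume "S \<in> ?A \<union> insert a ` ?B"
    then show "S \<in> {S. S \<subseteq> insert a I \<and> card S = Suc j}"
      using assms by (auto simp: finite_subset[OF _ assms(1)] card_insert_if)
  qed
  have fin: "finite ?A" "finite ?B" using assms(1) by auto
  have inj: "inj_on (insert a) ?B"
    using assms(2) by (intro inj_onI) (metis Diff_insert_absorb mem_Collect_eq subsetD)
  have "es (insert a I) (Suc j) x = (\<Sum>S\<in>?A. \<Prod>i\<in>S. x i) + (\<Sum>S\<in>insert a ` ?B. \<Prod>i\<in>S. x i)"
    unfolding es_def split using fin assms(2) by (intro sum.union_disjoint) auto
  also have "(\<Sum>S\<in>insert a ` ?B. \<Prod>i\<in>S. x i) = (\<Sum>S\<in>?B. \<Prod>i\<in>insert a S. x i)"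
    by (simp add: sum.reindex[OF inj])
  also have "\<dots> = (\<Sum>S\<in>?B. x a * (\<Prod>i\<in>S. x i))"
    using assms by (intro sum.cong refl prod.insert) (auto dest: finite_subset)
  finally show ?thesis by (simp add: es_def sum_distrib_left)
qed

lemma es_remove:
  assumes "finite I" "a \<in> I"
  shows "es I (Suc j) x = x a * es (I - {a}) j x + es (I - {a}) (Suc j) x"
  using es_insert[of "I - {a}" a j x] assms by (simp add: insert_absorb)

lemma es_1: "finite I \<Longrightarrow> es I (Suc 0) x = (\<Sum>i\<in>I. x i)"
proof (induction I rule: finite_induct)
  case empty
  then show ?case by (simp add: es_eq_0)
next
  case (insert a I)
  then show ?case by (simp add: es_insert)
qed

lemma es_scale: "es I j (\<lambda>i. c * x i) = c ^ j * es I j x"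
proof -
  have "es I j (\<lambda>i. c * x i) = (\<Sum>S | S \<subseteq> I \<and> card S = j. c ^ j * (\<Prod>i\<in>S. x i))"
    unfolding es_def by (intro sum.cong) (auto simp: prod.distrib)
  then show ?thesis by (simp add: es_def sum_distrib_left)
qed

lemma es_2_eq:
  assumes "finite I"
  shows "(\<Sum>i\<in>I. x i)\<^sup>2 = (\<Sum>i\<in>I. (x i)\<^sup>2) + 2 * es I 2 x"
  using assms
proof (induction I rule: finite_induct)
  case empty
  then show ?case by (simp add: es_eq_0)
next
  case (insert a I)
  have "es (insert a I) 2 x = x a * (\<Sum>i\<in>I. x i) + es I 2 x"
    using es_insert[OF insert(1,2), of "Suc 0" x] es_1[OF insert(1), of x] by (simp add: numeral_2_eq_2)
  then show ?case
    using insert by (simp add: power2_sum algebra_simps)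
qed

text \<open>Each set of j + 1 indices is counted once for every element that can play the role of
  i.\<close>

lemma es_euler:
  assumes "finite I"
  shows "(\<Sum>i\<in>I. x i * es (I - {i}) j x) = of_nat (Suc j) * es I (Suc j) x"
  using assms
proof (induction I arbitrary: j rule: finite_induct)
  case empty
  then show ?case by (simp add: es_eq_0)
next
  case (insert a I)
  have diff: "insert a I - {i} = insert a (I - {i})" if "i \<in> I" for i
    using that insert by auto
  show ?case
  proof (cases j)
    case 0
    then show ?thesis using insert by (simp add: es_insert es_1)
  next
    case (Suc k)
    have "(\<Sum>i\<in>I. x i * es (insert a I - {i}) j x)
        = (\<Sum>i\<in>I. x a * (x i * es (I - {i}) k x) + x i * es (I - {i}) j x)"
      using insert Suc by (intro sum.cong) (auto simp: diff es_insert algebra_simps)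
    also have "\<dots> = x a * (of_nat (Suc k) * es I (Suc k) x) + of_nat (Suc j) * es I (Suc j) x"
      using insert by (simp add: sum.distrib flip: sum_distrib_left)
    finally show ?thesis
      using insert Suc by (simp add: es_insert algebra_simps)
  qed
qed

section \<open>Splitting the variables into two groups and inverting the large ones\<close>

lemma es_union:
  assumes "finite L" "finite R" "L \<inter> R = {}"
  shows "es (L \<union> R) k x = (\<Sum>i\<le>k. es L i x * es R (k - i) x)"
  using assms
proof (induction L arbitrary: k rule: finite_induct)
  case empty
  have "(\<Sum>i\<le>k. es {} i x * es R (k - i) x) = (\<Sum>i\<in>{0}. es {} i x * es R (k - i) x)"
    by (rule sum.mono_neutral_right) (auto simp: es_eq_0)
  then show ?case by simp
next
  case (insert a L)
  show ?case
  proof (cases k)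
    case 0
    then show ?thesis using insert by simp
  next
    case (Suc j)
    have "es (insert a L \<union> R) k x = x a * es (L \<union> R) j x + es (L \<union> R) k x"
      using insert Suc by (simp add: es_insert)
    also have "\<dots> = x a * (\<Sum>i\<le>j. es L i x * es R (j - i) x) + (\<Sum>i\<le>Suc j. es L i x * es R (Suc j - i) x)"
      using insert Suc by simp
    also have "\<dots> = (\<Sum>i\<le>j. es (insert a L) (Suc i) x * es R (j - i) x) + es R (Suc j) x"
      using insert unfolding sum.atMost_Suc_shift
      by (simp add: es_insert sum_distrib_left sum.distrib algebra_simps)
    also have "\<dots> = (\<Sum>i\<le>Suc j. es (insert a L) i x * es R (Suc j - i) x)"
      using insert unfolding sum.atMost_Suc_shift by simp
    finally show ?thesis using Suc by simp
  qed
qed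

text \<open>A product over L - S is the product over L times the reciprocals over S, so passing to
  complements of index sets exchanges a variable with its reciprocal.\<close>

lemma es_complement:
  assumes "finite L" and inv: "\<And>i. i \<in> L \<Longrightarrow> y i * z i = 1" and "j \<le> card L"
  shows "es L (card L - j) y = (\<Prod>i\<in>L. y i) * es L j z"
proof -
  have "(\<Prod>i\<in>L. y i) * es L j z = (\<Sum>S | S \<subseteq> L \<and> card S = j. (\<Prod>i\<in>L. y i) * (\<Prod>i\<in>S. z i))"
    by (simp add: es_def sum_distrib_left)
  also have "\<dots> = (\<Sum>S | S \<subseteq> L \<and> card S = j. \<Prod>i\<in>L - S. y i)"
  proof (intro sum.cong refl)
    fix S assume "S \<in> {S. S \<subseteq> L \<and> card S = j}"
    then have S: "S \<subseteq> L" by simp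
    have "(\<Prod>i\<in>L. y i) * (\<Prod>i\<in>S. z i) = (\<Prod>i\<in>L - S. y i) * ((\<Prod>i\<in>S. y i) * (\<Prod>i\<in>S. z i))"
      using prod.subset_diff[OF S assms(1), of y] by (simp add: mult.assoc)
    also have "(\<Prod>i\<in>S. y i) * (\<Prod>i\<in>S. z i) = 1"
      unfolding prod.distrib[symmetric] using S inv by (intro prod.neutral) auto
    finally show "(\<Prod>i\<in>L. y i) * (\<Prod>i\<in>S. z i) = (\<Prod>i\<in>L - S. y i)" by simp
  qed
  also have "\<dots> = es L (card L - j) y"
    unfolding es_def using assms(1,3)
    by (intro sum.reindex_bij_witness[of _ "\<lambda>S. L - S" "\<lambda>S. L - S"])
       (auto simp: card_Diff_subset finite_subset double_diff)
  finally show ?thesis by simp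
qed

text \<open>When the degree is at least the number of large variables, their product factors out and
  the rest is polynomial in their reciprocals. Numerator and denominator share this factor, so the
  quotient extends to reciprocals equal to 0.\<close>

lemma es_split_large:
  assumes fin: "finite L" "finite R" "L \<inter> R = {}" and inv: "\<And>i. i \<in> L \<Longrightarrow> x i * z i = 1"
  shows "es (L \<union> R) (card L + a) x = (\<Prod>i\<in>L. x i) * (\<Sum>j\<le>card L. es L j z * es R (a + j) x)"
proof -
  have "es (L \<union> R) (card L + a) x = (\<Sum>i\<le>card L + a. es L i x * es R (card L + a - i) x)"
    by (rule es_union[OF fin])
  also have "\<dots> = (\<Sum>i\<le>card L. es L i x * es R (card L + a - i) x)"
    using fin(1) by (intro sum.mono_neutral_right) (auto simp: es_eq_0)
  also have "\<dots> = (\<Sum>j\<le>card L. es L (card L - j) x * es R (a + j) x)"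
    by (intro sum.reindex_bij_witness[of _ "\<lambda>j. card L - j" "\<lambda>j. card L - j"]) (auto simp: algebra_simps)
  also have "\<dots> = (\<Sum>j\<le>card L. (\<Prod>i\<in>L. x i) * (es L j z * es R (a + j) x))"
    using es_complement[OF fin(1) inv] by (intro sum.cong) (auto simp: mult.assoc)
  finally show ?thesis by (simp add: sum_distrib_left)
qed

text \<open>This is the case a = -1 of \<open>es_split_large\<close>: the term j = 0 would have
  degree -1 in R, so the sum starts at 1 and vanishes with the reciprocals. As a denominator it
  makes the quotient singular there.\<close>

lemma es_split_large_pred:
  assumes fin: "finite L" "finite R" "L \<inter> R = {}" and inv: "\<And>i. i \<in> L \<Longrightarrow> x i * z i = 1"
    and l: "card L = Suc l"
  shows "es (L \<union> R) l x = (\<Prod>i\<in>L. x i) * (\<Sum>j=1..card L. es L j z * es R (j - 1) x)"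
proof -
  have "es (L \<union> R) l x = (\<Sum>i\<le>l. es L i x * es R (l - i) x)"
    by (rule es_union[OF fin])
  also have "\<dots> = (\<Sum>j=1..card L. es L (card L - j) x * es R (j - 1) x)"
    using l by (intro sum.reindex_bij_witness[of _ "\<lambda>j. card L - j" "\<lambda>j. card L - j"]) auto
  also have "\<dots> = (\<Sum>j=1..card L. (\<Prod>i\<in>L. x i) * (es L j z * es R (j - 1) x))"
    using es_complement[OF fin(1) inv] by (intro sum.cong) (auto simp: mult.assoc)
  finally show ?thesis by (simp add: sum_distrib_left)
qed

section \<open>Size bounds and Newton inequalities for nonnegative variables\<close>

lemma es_nonneg: "(\<And>i. i \<in> I \<Longrightarrow> 0 \<le> x i) \<Longrightarrow> 0 \<le> es I j (x :: nat \<Rightarrow> real)"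
  unfolding es_def by (intro sum_nonneg prod_nonneg) auto

lemma prod_le_es:
  fixes x :: "nat \<Rightarrow> real"
  assumes "finite I" "J \<subseteq> I" "\<And>i. i \<in> I \<Longrightarrow> 0 \<le> x i"
  shows "(\<Prod>i\<in>J. x i) \<le> es I (card J) x"
proof -
  have "sum (\<lambda>S. \<Prod>i\<in>S. x i) {J} \<le> es I (card J) x"
    unfolding es_def using assms by (intro sum_mono2) (auto intro!: prod_nonneg)
  then show ?thesis by simp
qed

lemma es_ge_power:
  fixes x :: "nat \<Rightarrow> real"
  assumes "finite I" "J \<subseteq> I" "j \<le> card J" "\<And>i. i \<in> I \<Longrightarrow> 0 \<le> x i" "\<And>i. i \<in> J \<Longrightarrow> c \<le> x i" "0 \<le> c"
  shows "c ^ j \<le> es I j x"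
proof -
  obtain J' where J': "J' \<subseteq> J" "card J' = j"
    using assms(3) by (meson obtain_subset_with_card_n)
  have "c ^ j = (\<Prod>i\<in>J'. c)" using J' by simp
  also have "\<dots> \<le> (\<Prod>i\<in>J'. x i)" using J' assms by (intro prod_mono) auto
  also have "\<dots> \<le> es I (card J') x" using J' assms by (intro prod_le_es) auto
  finally show ?thesis using J' by simp
qed

lemma es_le_power:
  fixes x :: "nat \<Rightarrow> real"
  assumes "finite I" "\<And>i. i \<in> I \<Longrightarrow> 0 \<le> x i" "\<And>i. i \<in> I \<Longrightarrow> x i \<le> c" and c: "0 \<le> c"
  shows "es I j x \<le> 2 ^ card I * c ^ j"
proof -
  have "es I j x \<le> (\<Sum>S | S \<subseteq> I \<and> card S = j. c ^ j)"
    unfolding es_def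
  proof (rule sum_mono)
    fix S assume S: "S \<in> {S. S \<subseteq> I \<and> card S = j}"
    have "(\<Prod>i\<in>S. x i) \<le> (\<Prod>i\<in>S. c)" using S assms by (intro prod_mono) auto
    then show "(\<Prod>i\<in>S. x i) \<le> c ^ j" using S by simp
  qed
  also have "\<dots> = real (card {S. S \<subseteq> I \<and> card S = j}) * c ^ j" by simp
  also have "card {S. S \<subseteq> I \<and> card S = j} \<le> card (Pow I)"
    using assms(1) by (intro card_mono) auto
  then have "real (card {S. S \<subseteq> I \<and> card S = j}) \<le> 2 ^ card I"
    using assms(1) by (simp add: card_Pow flip: of_nat_le_iff)
  then have "real (card {S. S \<subseteq> I \<and> card S = j}) * c ^ j \<le> 2 ^ card I * c ^ j"
    using c by (intro mult_right_mono) auto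
  finally show ?thesis .
qed

text \<open>The case distinction implements \<open>s\<^sub>-\<^sub>1 = 0\<close>.\<close>
definition newton_gap :: "nat set \<Rightarrow> (nat \<Rightarrow> real) \<Rightarrow> nat \<Rightarrow> nat \<Rightarrow> real" where
  "newton_gap I x i j = es I i x * es I j x - (if i = 0 then 0 else es I (i - 1) x * es I (Suc j) x)"

text \<open>Expansion in powers of the new variable; only the coefficient of its first power is not
  itself a gap.\<close>

lemma newton_gap_insert:
  assumes "finite I" "a \<notin> I"
  shows "newton_gap (insert a I) x (Suc i) (Suc j) =
    (x a)\<^sup>2 * newton_gap I x i j + newton_gap I x (Suc i) (Suc j)
    + x a * (es I (Suc i) x * es I j x - (if i = 0 then 0 else es I (i - 1) x * es I (Suc (Suc j)) x))"
  using assms by (cases i) (auto simp: newton_gap_def es_insert power2_eq_square algebra_simps)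

text \<open>With i = h + 1, the linear coefficient is nonnegative by the chain sigma_h sigma_(j+2)
  <= sigma_(h+1) sigma_(j+1) <= sigma_(h+2) sigma_j. Nonnegativity of the gaps on the smaller set is
  a hypothesis so that the lemma can serve inside the induction that proves it.\<close>

lemma newton_gap_insert_ge_aux:
  assumes fin: "finite I" "a \<notin> I" and nn: "\<And>i. i \<in> insert a I \<Longrightarrow> 0 \<le> x i" and "i \<le> j"
    and gap: "\<And>p q. p \<le> q \<Longrightarrow> 0 \<le> newton_gap I x p q"
  shows "(x a)\<^sup>2 * newton_gap I x i j \<le> newton_gap (insert a I) x (Suc i) (Suc j)"
proof -
  have es: "0 \<le> es I m x" for m using nn by (intro es_nonneg) auto
  have "0 \<le> es I (Suc i) x * es I j x - (if i = 0 then 0 else es I (i - 1) x * es I (Suc (Suc j)) x)"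
  proof (cases i)
    case 0
    then show ?thesis using es by simp
  next
    case (Suc h)
    have "es I h x * es I (Suc (Suc j)) x \<le> es I (Suc h) x * es I (Suc j) x"
      using gap[of "Suc h" "Suc j"] assms(4) Suc by (simp add: newton_gap_def)
    also have "\<dots> \<le> es I (Suc (Suc h)) x * es I j x"
    \<comment> \<open>In the equality case the two products coincide; otherwise i <= j gives Suc
      (Suc h) <= j, as the gap hypothesis requires.\<close>
    proof (cases "Suc h = j")
      case True
      then show ?thesis by (simp add: mult.commute)
    next
      case False
      then show ?thesis using gap[of "Suc (Suc h)" j] assms(4) Suc by (simp add: newton_gap_def)
    qed
    finally show ?thesis using Suc by simp
  qed
  then have "0 \<le> x a * (es I (Suc i) x * es I j x - (if i = 0 then 0 else es I (i - 1) x * es I (Suc (Suc j)) x))"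
    using nn by (intro mult_nonneg_nonneg) auto
  moreover have "0 \<le> newton_gap I x (Suc i) (Suc j)" using assms(4) by (intro gap) simp
  ultimately show ?thesis
    unfolding newton_gap_insert[OF fin] by linarith
qed

lemma newton_gap_nonneg:
  assumes "finite I" "\<And>i. i \<in> I \<Longrightarrow> 0 \<le> x i" "i \<le> j"
  shows "0 \<le> newton_gap I x i j"
  using assms
proof (induction I arbitrary: i j rule: finite_induct)
  case empty
  then show ?case by (cases i) (auto simp: newton_gap_def es_eq_0 intro: es_nonneg)
next
  case (insert a I)
  show ?case
  proof (cases i)
    case 0
    then show ?thesis using insert.hyps insert.prems es_nonneg[of "insert a I" x j] by (simp add: newton_gap_def)
  next
    case (Suc i')
    then obtain j' where j: "j = Suc j'" using insert.prems by (cases j) auto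
    have gap: "0 \<le> newton_gap I x p q" if "p \<le> q" for p q using insert.IH insert.prems(1) that by blast
    have "0 \<le> (x a)\<^sup>2 * newton_gap I x i' j'" using gap[of i' j'] insert.prems(2) Suc j by simp
    also have "\<dots> \<le> newton_gap (insert a I) x (Suc i') (Suc j')"
      using insert.prems Suc j by (intro newton_gap_insert_ge_aux insert.hyps gap) auto
    finally show ?thesis using Suc j by simp
  qed
qed

lemma newton_gap_insert_ge:
  assumes "finite I" "a \<notin> I" "\<And>i. i \<in> insert a I \<Longrightarrow> 0 \<le> x i" "i \<le> j"
  shows "(x a)\<^sup>2 * newton_gap I x i j \<le> newton_gap (insert a I) x (Suc i) (Suc j)"
  by (rule newton_gap_insert_ge_aux[OF assms newton_gap_nonneg[OF assms(1)]]) (use assms(3) in simp_all)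

text \<open>Removing one index of J lowers i and j by one and costs a factor of at least c^2; at i =
  0 the gap is sigma_j >= c^j. Through \<open>corrq_nth_0\<close> this keeps the first-order
  coefficient of the expansion away from 0.\<close>

lemma newton_gap_ge:
  fixes x :: "nat \<Rightarrow> real"
  assumes fin: "finite I" and "J \<subseteq> I" "j \<le> card J" "i \<le> j" "\<forall>i\<in>I. 0 \<le> x i" "\<forall>i\<in>J. c \<le> x i" "0 \<le> c"
  shows "c ^ (i + j) \<le> newton_gap I x i j"
  using assms
proof (induction i arbitrary: I J j)
  case 0
  have "c ^ j \<le> es I j x" using 0 by (intro es_ge_power[of I J]) auto
  then show ?case using 0(1) by (simp add: newton_gap_def)
next
  case (Suc i)
  note prems = Suc.prems
  obtain j' where j: "j = Suc j'" using prems(4) by (cases j) auto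
  obtain a where a: "a \<in> J" using prems(3) j by fastforce
  have fJ: "finite J" using prems(1,2) finite_subset by blast
  have ih: "c ^ (i + j') \<le> newton_gap (I - {a}) x i j'"
    by (rule Suc.IH[of _ "J - {a}"]) (use prems j a fJ in auto)
  have "c ^ (Suc i + j) = c\<^sup>2 * c ^ (i + j')" using j by (simp add: power2_eq_square)
  also have "\<dots> \<le> (x a)\<^sup>2 * newton_gap (I - {a}) x i j'"
    using prems(6,7) a ih by (intro mult_mono power_mono) auto
  also have "\<dots> \<le> newton_gap (insert a (I - {a})) x (Suc i) (Suc j')"
    using prems j a by (intro newton_gap_insert_ge) auto
  also have "insert a (I - {a}) = I" using a prems by auto
  finally show ?case using j by simp
qed

subsection \<open>Second-order jets along lines\<close>

definition line :: "(nat \<Rightarrow> real) \<Rightarrow> (nat \<Rightarrow> real) \<Rightarrow> nat \<Rightarrow> real fps" where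
  "line x u i = fps_const (x i) + fps_const (u i) * fps_X"

lemma line_nth [simp]: "line x u i $ 0 = x i" "line x u i $ Suc 0 = u i" "line x u i $ 2 = 0"
  by (simp_all add: line_def numeral_2_eq_2)

lemma fps_deriv_line [simp]: "fps_deriv (line x u i) = fps_const (u i)"
  by (simp add: line_def)

lemma fps_mult_nth_Suc_0: "(f * g) $ Suc 0 = f $ 0 * g $ Suc 0 + f $ Suc 0 * (g $ 0 :: real)"
  by (simp add: fps_mult_nth)

lemma fps_mult_nth_2: "(f * g) $ 2 = f $ 0 * g $ 2 + f $ Suc 0 * g $ Suc 0 + f $ 2 * (g $ 0 :: real)"
  by (simp add: fps_mult_nth numeral_2_eq_2)

lemma fps_mult_inverse_cancel: "g $ 0 \<noteq> 0 \<Longrightarrow> f * inverse g * g = (f :: real fps)"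
  by (simp add: mult.assoc inverse_mult_eq_1)

text \<open>The product equation is a triangular system. Quotients are handled through it
  throughout, so that coefficients of an inverse need not be written out.\<close>

lemma fps_quotient_nth:
  fixes f g q :: "real fps"
  assumes q: "q * g = f" and g: "g $ 0 \<noteq> 0"
  shows "q $ 0 = f $ 0 / g $ 0"
    and "q $ Suc 0 = (f $ Suc 0 - q $ 0 * g $ Suc 0) / g $ 0"
    and "q $ 2 = (f $ 2 - q $ Suc 0 * g $ Suc 0 - q $ 0 * g $ 2) / g $ 0"
proof -
  have "q $ 0 * g $ 0 = f $ 0" "q $ 0 * g $ Suc 0 + q $ Suc 0 * g $ 0 = f $ Suc 0"
    "q $ 0 * g $ 2 + q $ Suc 0 * g $ Suc 0 + q $ 2 * g $ 0 = f $ 2"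
    by (simp_all add: q[symmetric] fps_mult_nth_Suc_0 fps_mult_nth_2)
  then show "q $ 0 = f $ 0 / g $ 0" "q $ Suc 0 = (f $ Suc 0 - q $ 0 * g $ Suc 0) / g $ 0"
    "q $ 2 = (f $ 2 - q $ Suc 0 * g $ Suc 0 - q $ 0 * g $ 2) / g $ 0"
    using g by (auto simp: nonzero_eq_divide_eq algebra_simps)
qed

lemma fps_prod_nth_0: "(\<Prod>i\<in>S. f i :: real fps) $ 0 = (\<Prod>i\<in>S. f i $ 0)"
  by (induction S rule: infinite_finite_induct) auto

lemma es_nth_0: "es I j f $ 0 = es I j (\<lambda>i. f i $ 0 :: real)"
  by (simp add: es_def fps_sum_nth fps_prod_nth_0)

lemma fps_deriv_es:
  fixes x :: "nat \<Rightarrow> real fps"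
  assumes "finite I"
  shows "fps_deriv (es I (Suc j) x) = (\<Sum>i\<in>I. fps_deriv (x i) * es (I - {i}) j x)"
  using assms
proof (induction I arbitrary: j rule: finite_induct)
  case empty
  then show ?case by (simp add: es_eq_0)
next
  case (insert a I)
  have diff: "insert a I - {i} = insert a (I - {i})" if "i \<in> I" for i
    using that insert by auto
  show ?case
  proof (cases j)
    case 0
    then show ?thesis using insert by (simp add: es_insert es_1 fps_deriv_sum)
  next
    case (Suc k)
    have "(\<Sum>i\<in>I. fps_deriv (x i) * es (insert a I - {i}) j x)
        = (\<Sum>i\<in>I. x a * (fps_deriv (x i) * es (I - {i}) k x) + fps_deriv (x i) * es (I - {i}) j x)"
      using insert Suc by (intro sum.cong) (auto simp: diff es_insert algebra_simps)
    also have "\<dots> = x a * fps_deriv (es I (Suc k) x) + fps_deriv (es I (Suc j) x)"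
      using insert by (simp add: sum.distrib flip: sum_distrib_left)
    finally show ?thesis
      using insert Suc by (simp add: es_insert algebra_simps)
  qed
qed

text \<open>The case \<open>j = 0\<close> is separated since the truncated \<open>j - 1\<close> would give \<open>\<sigma>\<^sub>0 = 1\<close> instead of \<open>0\<close>.\<close>
definition esd1 :: "nat set \<Rightarrow> nat \<Rightarrow> nat \<Rightarrow> (nat \<Rightarrow> 'a::comm_ring_1) \<Rightarrow> 'a" where
  "esd1 I j i x = (if j = 0 then 0 else es (I - {i}) (j - 1) x)"

text \<open>The value for i = k is 0 because each variable occurs at most to the first
  power.\<close>

definition esd2 :: "nat set \<Rightarrow> nat \<Rightarrow> nat \<Rightarrow> nat \<Rightarrow> (nat \<Rightarrow> 'a::comm_ring_1) \<Rightarrow> 'a" where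
  "esd2 I j i k x = (if i = k \<or> j = 0 then 0 else esd1 (I - {k}) (j - 1) i x)"

lemma esd1_Suc [simp]: "esd1 I (Suc j) i x = es (I - {i}) j x"
  by (simp add: esd1_def)

lemma fps_deriv_es':
  assumes "finite I"
  shows "fps_deriv (es I j (line x u)) = (\<Sum>i\<in>I. fps_const (u i) * esd1 I j i (line x u))"
  using assms by (cases j) (simp_all add: fps_deriv_es esd1_def)

lemma fps_deriv_esd1:
  assumes "finite I" "k \<in> I"
  shows "fps_deriv (esd1 I j k (line x u)) = (\<Sum>i\<in>I. fps_const (u i) * esd2 I j i k (line x u))"
proof (cases j)
  case 0
  then show ?thesis by (simp add: esd1_def esd2_def)
next
  case (Suc j')
  have "(\<Sum>i\<in>I. fps_const (u i) * esd2 I j i k (line x u))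
     = (\<Sum>i\<in>I - {k}. fps_const (u i) * esd2 I j i k (line x u))"
    using assms by (simp add: sum.remove[of I k] esd2_def)
  also have "\<dots> = (\<Sum>i\<in>I - {k}. fps_const (u i) * esd1 (I - {k}) j' i (line x u))"
    using Suc by (intro sum.cong) (auto simp: esd2_def)
  finally show ?thesis using assms Suc by (simp add: fps_deriv_es' esd1_def)
qed

lemma esd1_nth_0: "esd1 I j i (line x u) $ 0 = esd1 I j i x"
  by (simp add: esd1_def es_nth_0)

lemma esd2_nth_0: "esd2 I j i k (line x u) $ 0 = esd2 I j i k x"
  by (simp add: esd2_def esd1_nth_0)

lemma es_line_nth_0 [simp]: "es I j (line x u) $ 0 = es I j x"
  by (simp add: es_nth_0)

lemma es_line_nth_1:
  assumes "finite I"
  shows "es I j (line x u) $ Suc 0 = (\<Sum>i\<in>I. u i * esd1 I j i x)"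
proof -
  have "es I j (line x u) $ Suc 0 = fps_deriv (es I j (line x u)) $ 0" by simp
  then show ?thesis
    unfolding fps_deriv_es'[OF assms] by (simp add: fps_sum_nth esd1_nth_0 del: fps_deriv_nth)
qed

lemma es_line_nth_2:
  assumes "finite I"
  shows "2 * es I j (line x u) $ 2 = (\<Sum>k\<in>I. \<Sum>i\<in>I. esd2 I j i k x * u i * u k)"
proof -
  have "2 * es I j (line x u) $ 2 = fps_deriv (fps_deriv (es I j (line x u))) $ 0"
    by (simp add: numeral_2_eq_2)
  also have "fps_deriv (fps_deriv (es I j (line x u)))
    = (\<Sum>k\<in>I. fps_const (u k) * fps_deriv (esd1 I j k (line x u)))"
    by (simp add: fps_deriv_es'[OF assms] fps_deriv_sum)
  also have "\<dots> = (\<Sum>k\<in>I. \<Sum>i\<in>I. fps_const (u k) * (fps_const (u i) * esd2 I j i k (line x u)))"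
    using assms by (intro sum.cong) (auto simp: fps_deriv_esd1 sum_distrib_left)
  also have "\<dots> $ 0 = (\<Sum>k\<in>I. \<Sum>i\<in>I. esd2 I j i k x * u i * u k)"
    by (simp add: fps_sum_nth esd2_nth_0 mult_ac)
  finally show ?thesis .
qed

section \<open>Partial derivatives of the quotient as coefficients of its jet\<close>

lemma es_update_indep: "i \<notin> I \<Longrightarrow> es I j (x(i := t)) = es I j x"
  by (rule es_cong) auto

text \<open>Elementary symmetric functions are affine in each variable, so every partial derivative
  below is that of a quotient of affine or bilinear expressions in one real variable.\<close>

lemma es_update:
  assumes "finite I" "i \<in> I"
  shows "es I j (x(i := t)) = es I j x + (t - x i) * esd1 I j i x"
proof (cases j)
  case 0
  then show ?thesis using assms by (simp add: esd1_def)
next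
  case (Suc j')
  then show ?thesis
    using es_remove[OF assms, of j' x] es_remove[OF assms, of j' "x(i := t)"]
    by (simp add: es_update_indep algebra_simps)
qed

lemma esd1_update:
  assumes "finite I" "i \<in> I"
  shows "esd1 I j k (x(i := t)) = esd1 I j k x + (t - x i) * esd2 I j i k x"
  using assms es_update[of "I - {k}" i "j - 1" x t]
  by (cases "i = k") (auto simp: esd1_def esd2_def es_update_indep)

definition qjet :: "nat \<Rightarrow> nat \<Rightarrow> nat \<Rightarrow> (nat \<Rightarrow> real) \<Rightarrow> (nat \<Rightarrow> real) \<Rightarrow> real fps" where
  "qjet n k l x u = es {1..n} k (line x u) * inverse (es {1..n} l (line x u))"

lemma pderiv1_sigma_quot:
  assumes "esym n l x \<noteq> 0" "i \<in> {1..n}"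
  shows "pderiv1 i (sigma_quot n k l) x =
    (esd1 {1..n} k i x * es {1..n} l x - es {1..n} k x * esd1 {1..n} l i x) / (es {1..n} l x)\<^sup>2"
proof -
  let ?I = "{1..n}"
  have "(\<lambda>t. sigma_quot n k l (x(i := t))) =
    (\<lambda>t. (es ?I k x + (t - x i) * esd1 ?I k i x) / (es ?I l x + (t - x i) * esd1 ?I l i x))"
    using assms by (simp add: sigma_quot_def esym_eq_es es_update)
  moreover have "((\<lambda>t. (es ?I k x + (t - x i) * esd1 ?I k i x) / (es ?I l x + (t - x i) * esd1 ?I l i x))
    has_real_derivative (esd1 ?I k i x * es ?I l x - es ?I k x * esd1 ?I l i x) / (es ?I l x)\<^sup>2) (at (x i))"
    using assms by (auto intro!: derivative_eq_intros simp: esym_eq_es power2_eq_square)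
  ultimately show ?thesis
    unfolding pderiv1_def by (simp add: DERIV_imp_deriv)
qed

lemma pderiv2_sigma_quot:
  fixes n k l x
  defines "S \<equiv> es {1..n} k x" and "T \<equiv> es {1..n} l x"
    and "S1 \<equiv> \<lambda>i. esd1 {1..n} k i x" and "T1 \<equiv> \<lambda>i. esd1 {1..n} l i x"
    and "S2 \<equiv> \<lambda>i j. esd2 {1..n} k i j x" and "T2 \<equiv> \<lambda>i j. esd2 {1..n} l i j x"
  assumes T: "esym n l x \<noteq> 0" and ij: "i \<in> {1..n}" "j \<in> {1..n}"
  shows "pderiv2 i j (sigma_quot n k l) x =
    S2 i j / T - (S1 j * T1 i + S1 i * T1 j) / T\<^sup>2 - S * T2 i j / T\<^sup>2 + 2 * S * T1 i * T1 j / T ^ 3"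
proof -
  have T0: "T \<noteq> 0" using T by (simp add: T_def esym_eq_es)
  let ?h = "\<lambda>t. ((S1 j + (t - x i) * S2 i j) * (T + (t - x i) * T1 i)
      - (S + (t - x i) * S1 i) * (T1 j + (t - x i) * T2 i j)) / (T + (t - x i) * T1 i)\<^sup>2"
  \<comment> \<open>The formula for the inner derivative holds only where the denominator does not
    vanish, so this is secured on a neighbourhood of x i before differentiating again.\<close>
  have ev: "\<forall>\<^sub>F t in nhds (x i). pderiv1 j (sigma_quot n k l) (x(i := t)) = ?h t"
  proof -
    have "isCont (\<lambda>t. T + (t - x i) * T1 i) (x i)" by (intro continuous_intros)
    then have "\<forall>\<^sub>F t in nhds (x i). T + (t - x i) * T1 i \<noteq> 0"
      using T0 tendsto_imp_eventually_ne[of "\<lambda>t. T + (t - x i) * T1 i" T "at (x i)" 0]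
      by (simp add: isCont_def eventually_nhds_conv_at)
    then show ?thesis
    proof eventually_elim
      case (elim t)
      have "esym n l (x(i := t)) \<noteq> 0"
        using elim ij by (simp add: esym_eq_es es_update T_def T1_def)
      then show ?case
        using ij by (simp add: pderiv1_sigma_quot es_update esd1_update S_def T_def S1_def T1_def S2_def T2_def)
    qed
  qed
  have "(?h has_real_derivative (S2 i j / T - (S1 j * T1 i + S1 i * T1 j) / T\<^sup>2 - S * T2 i j / T\<^sup>2
      + 2 * S * T1 i * T1 j / T ^ 3)) (at (x i))"
    using T0 by (auto intro!: derivative_eq_intros simp: field_simps power2_eq_square power3_eq_cube eval_nat_numeral)
  then have "deriv (\<lambda>t. pderiv1 j (sigma_quot n k l) (x(i := t))) (x i)
    = S2 i j / T - (S1 j * T1 i + S1 i * T1 j) / T\<^sup>2 - S * T2 i j / T\<^sup>2 + 2 * S * T1 i * T1 j / T ^ 3"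
    using deriv_cong_ev[OF ev refl] by (simp add: DERIV_imp_deriv)
  then show ?thesis by (simp add: pderiv2_def pderiv1_def)
qed

context
  fixes n k l :: nat and x :: "nat \<Rightarrow> real"
  assumes T: "esym n l x \<noteq> 0"
begin

lemma qjet_mult: "qjet n k l x u * es {1..n} l (line x u) = es {1..n} k (line x u)"
  using T by (simp add: qjet_def fps_mult_inverse_cancel esym_eq_es)

lemma qjet_nth_0: "qjet n k l x u $ 0 = sigma_quot n k l x"
  using T fps_quotient_nth(1)[OF qjet_mult] by (simp add: sigma_quot_def esym_eq_es)

lemma sum_pderiv1_sigma_quot:
  "(\<Sum>i=1..n. pderiv1 i (sigma_quot n k l) x * u i) = qjet n k l x u $ Suc 0"
proof -
  let ?I = "{1..n}"
  have T0: "es ?I l x \<noteq> 0" using T by (simp add: esym_eq_es)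
  have "(\<Sum>i=1..n. pderiv1 i (sigma_quot n k l) x * u i) =
    (\<Sum>i=1..n. u i * esd1 ?I k i x * (1 / es ?I l x) - u i * esd1 ?I l i x * (es ?I k x / (es ?I l x)\<^sup>2))"
    using T T0 by (intro sum.cong) (auto simp: pderiv1_sigma_quot field_simps power2_eq_square)
  also have "\<dots> = es ?I k (line x u) $ Suc 0 / es ?I l x
      - es ?I l (line x u) $ Suc 0 * (es ?I k x / (es ?I l x)\<^sup>2)"
    by (simp add: sum_subtractf es_line_nth_1 flip: sum_distrib_right sum_divide_distrib)
  also have "\<dots> = qjet n k l x u $ Suc 0"
    using T0 unfolding fps_quotient_nth(2)[OF qjet_mult[of u], unfolded es_line_nth_0, OF T0]
      fps_quotient_nth(1)[OF qjet_mult[of u], unfolded es_line_nth_0, OF T0]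
    by (simp add: field_simps power2_eq_square)
  finally show ?thesis .
qed

lemma pderiv1_eq_qjet:
  assumes "i \<in> {1..n}"
  shows "pderiv1 i (sigma_quot n k l) x = qjet n k l x (\<lambda>j. if j = i then 1 else 0) $ Suc 0"
proof -
  have "(\<Sum>j=1..n. pderiv1 j (sigma_quot n k l) x * (if j = i then 1 else 0)) = pderiv1 i (sigma_quot n k l) x"
    using assms by (simp add: mult.commute[of _ "if _ then _ else _"] if_distrib[of "\<lambda>c. c * _"] cong: if_cong)
  then show ?thesis using sum_pderiv1_sigma_quot[of "\<lambda>j. if j = i then 1 else 0"] by simp
qed

lemma sum_pderiv2_sigma_quot:
  "(\<Sum>i=1..n. \<Sum>j=1..n. pderiv2 i j (sigma_quot n k l) x * u i * u j) = 2 * qjet n k l x u $ 2"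
proof -
  let ?I = "{1..n}"
  define S T S1 T1 S2 T2 where defs: "S = es ?I k x" "T = es ?I l x"
    "S1 = (\<lambda>i. esd1 ?I k i x)" "T1 = (\<lambda>i. esd1 ?I l i x)"
    "S2 = (\<lambda>i j. esd2 ?I k i j x)" "T2 = (\<lambda>i j. esd2 ?I l i j x)"
  have T0: "T \<noteq> 0" using T by (simp add: esym_eq_es defs)
  define s t where st: "s = es ?I k (line x u)" "t = es ?I l (line x u)"
  have 1: "s $ Suc 0 = (\<Sum>i\<in>?I. u i * S1 i)" "t $ Suc 0 = (\<Sum>i\<in>?I. u i * T1 i)"
    by (simp_all add: st defs es_line_nth_1)
  have 2: "2 * s $ 2 = (\<Sum>i\<in>?I. \<Sum>j\<in>?I. S2 i j * u i * u j)" "2 * t $ 2 = (\<Sum>i\<in>?I. \<Sum>j\<in>?I. T2 i j * u i * u j)"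
    using sum.swap[of "\<lambda>i j. S2 i j * u i * u j" ?I ?I] sum.swap[of "\<lambda>i j. T2 i j * u i * u j" ?I ?I]
    by (simp_all add: st defs es_line_nth_2)
  have 0: "s $ 0 = S" "t $ 0 = T" by (simp_all add: st defs)
  have "(\<Sum>i\<in>?I. \<Sum>j\<in>?I. pderiv2 i j (sigma_quot n k l) x * u i * u j) =
    (\<Sum>i\<in>?I. \<Sum>j\<in>?I. S2 i j * u i * u j * (1 / T) - (u j * S1 j) * (u i * T1 i) * (1 / T\<^sup>2)
      - (u i * S1 i) * (u j * T1 j) * (1 / T\<^sup>2)
      - T2 i j * u i * u j * (S / T\<^sup>2) + (u i * T1 i) * (u j * T1 j) * (2 * S / T ^ 3))"
  proof (intro sum.cong refl)
    fix i j assume ij: "i \<in> ?I" "j \<in> ?I"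
    have p: "pderiv2 i j (sigma_quot n k l) x = S2 i j / T - (S1 j * T1 i + S1 i * T1 j) / T\<^sup>2
        - S * T2 i j / T\<^sup>2 + 2 * S * T1 i * T1 j / T ^ 3"
      using pderiv2_sigma_quot[OF T ij, of k] by (simp add: defs)
    show "pderiv2 i j (sigma_quot n k l) x * u i * u j =
      S2 i j * u i * u j * (1 / T) - (u j * S1 j) * (u i * T1 i) * (1 / T\<^sup>2)
      - (u i * S1 i) * (u j * T1 j) * (1 / T\<^sup>2)
      - T2 i j * u i * u j * (S / T\<^sup>2) + (u i * T1 i) * (u j * T1 j) * (2 * S / T ^ 3)"
      unfolding p by (simp add: algebra_simps add_divide_distrib)
  qed
  also have "\<dots> = 2 * s $ 2 * (1 / T) - s $ Suc 0 * t $ Suc 0 * (1 / T\<^sup>2) - s $ Suc 0 * t $ Suc 0 * (1 / T\<^sup>2)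
      - 2 * t $ 2 * (S / T\<^sup>2) + t $ Suc 0 * t $ Suc 0 * (2 * S / T ^ 3)"
  proof -
    have "(\<Sum>i\<in>?I. \<Sum>j\<in>?I. (u j * S1 j) * (u i * T1 i)) = s $ Suc 0 * t $ Suc 0"
      unfolding 1 sum_product by (subst sum.swap) simp
    moreover have "(\<Sum>i\<in>?I. \<Sum>j\<in>?I. (u i * S1 i) * (u j * T1 j)) = s $ Suc 0 * t $ Suc 0"
      "(\<Sum>i\<in>?I. \<Sum>j\<in>?I. (u i * T1 i) * (u j * T1 j)) = t $ Suc 0 * t $ Suc 0"
      unfolding 1 sum_product by simp_all
    ultimately show ?thesis
      unfolding sum.distrib sum_subtractf sum_distrib_right[symmetric] 2 by simp
  qed
  also have "\<dots> = 2 * qjet n k l x u $ 2"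
  proof -
    note nth = fps_quotient_nth[OF qjet_mult[of u], folded st, unfolded 0, OF T0]
    show ?thesis
      unfolding nth(3) nth(2) nth(1) using T0 by (simp add: field_simps power2_eq_square power3_eq_cube)
  qed
  finally show ?thesis .
qed

end

subsection \<open>Strict concavity of consecutive quotients\<close>

definition qq :: "nat set \<Rightarrow> nat \<Rightarrow> (nat \<Rightarrow> real) \<Rightarrow> (nat \<Rightarrow> real) \<Rightarrow> real fps" where
  "qq I a x u = es I a (line x u) * inverse (es I (a - 1) (line x u))"

lemma qq_mult:
  assumes "es I (a - 1) x \<noteq> 0"
  shows "qq I a x u * es I (a - 1) (line x u) = es I a (line x u)"
  using assms by (simp add: qq_def fps_mult_inverse_cancel)

text \<open>The function x Q / (x + Q) is homogeneous of degree one, so its Hessian in the two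
  variables has the radial direction in its kernel and is a negative multiple of the square of a
  determinant. The curvature of Q enters through the chain rule.\<close>

lemma harmonic_nth_2:
  fixes h x Q :: "real fps"
  assumes "h * (x + Q) = x * Q" "x $ 2 = 0" "x $ 0 + Q $ 0 \<noteq> 0"
  shows "h $ 2 = Q $ 2 * (x $ 0)\<^sup>2 / (x $ 0 + Q $ 0)\<^sup>2
    - (Q $ 0 * x $ Suc 0 - x $ 0 * Q $ Suc 0)\<^sup>2 / (x $ 0 + Q $ 0) ^ 3"
proof -
  define y where "y = x $ 0 + Q $ 0"
  have y: "y \<noteq> 0" "Q $ 0 = y - x $ 0" using assms(3) by (simp_all add: y_def)
  have n: "(x + Q) $ 0 \<noteq> 0" using assms(3) by simp
  note nth = fps_quotient_nth[OF assms(1) n, unfolded fps_add_nth fps_mult_nth_Suc_0 fps_mult_nth_2 fps_mult_nth_0 y_def[symmetric] assms(2)]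
  show ?thesis
    unfolding nth(3) nth(2) nth(1) y_def[symmetric] unfolding y(2) using y(1)
    by (simp add: field_simps power2_eq_square power3_eq_cube)
qed

text \<open>The quotient \<open>q = \<sigma>\<^sub>a / \<sigma>\<^sub>a\<^sub>-\<^sub>1\<close> satisfies \<open>a q = \<Sum> x\<^sub>i Q\<^sub>i / (x\<^sub>i + Q\<^sub>i)\<close>, where \<open>Q\<^sub>i = \<sigma>\<^sub>a\<^sub>-\<^sub>1 / \<sigma>\<^sub>a\<^sub>-\<^sub>2\<close> in the other
  variables (Marcus and Lopes), so concavity is inherited from that of the harmonic mean.\<close>
lemma qq_recursion_nth_2:
  assumes fin: "finite I" and Q0: "\<And>i. i \<in> I \<Longrightarrow> 0 < es (I - {i}) b x"
    and pos: "0 < es I (Suc b) x"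
  shows "- real (Suc (Suc b)) * qq I (Suc (Suc b)) x u $ 2 = (\<Sum>i\<in>I.
     (qq (I - {i}) (Suc b) x u $ 0 * u i - x i * qq (I - {i}) (Suc b) x u $ Suc 0)\<^sup>2 / (x i + qq (I - {i}) (Suc b) x u $ 0) ^ 3
     - qq (I - {i}) (Suc b) x u $ 2 * (x i)\<^sup>2 / (x i + qq (I - {i}) (Suc b) x u $ 0)\<^sup>2)"
proof -
  define E where "E = es I (Suc b) (line x u)"
  have E0: "E $ 0 \<noteq> 0" using pos by (simp add: E_def)
  define h where "h i = line x u i * es (I - {i}) (Suc b) (line x u) * inverse E" for i
  have "of_nat (Suc (Suc b)) * qq I (Suc (Suc b)) x u = (\<Sum>i\<in>I. h i)"
    using es_euler[OF fin, of "line x u" "Suc b"]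
    by (simp add: qq_def h_def E_def mult.assoc[symmetric] flip: sum_distrib_right)
  then have "(of_nat (Suc (Suc b)) * qq I (Suc (Suc b)) x u) $ 2 = (\<Sum>i\<in>I. h i $ 2)"
    by (simp add: fps_sum_nth)
  moreover have "of_nat (Suc (Suc b)) = fps_const (real (Suc (Suc b)))" by (rule fps_of_nat[symmetric])
  ultimately have sum: "real (Suc (Suc b)) * qq I (Suc (Suc b)) x u $ 2 = (\<Sum>i\<in>I. h i $ 2)"
    by (metis fps_mult_left_const_nth)
  have h: "h i $ 2 = qq (I - {i}) (Suc b) x u $ 2 * (x i)\<^sup>2 / (x i + qq (I - {i}) (Suc b) x u $ 0)\<^sup>2
    - (qq (I - {i}) (Suc b) x u $ 0 * u i - x i * qq (I - {i}) (Suc b) x u $ Suc 0)\<^sup>2 / (x i + qq (I - {i}) (Suc b) x u $ 0) ^ 3"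
    if i: "i \<in> I" for i
  proof -
    define Q where "Q = qq (I - {i}) (Suc b) x u"
    define e where "e = es (I - {i}) b (line x u)"
    have e0: "e $ 0 \<noteq> 0" using Q0[OF i] by (simp add: e_def)
    then have "e \<noteq> 0" by auto
    have Qe: "Q * e = es (I - {i}) (Suc b) (line x u)"
      using qq_mult[of "I - {i}" "Suc b" x u] Q0[OF i] by (simp add: Q_def e_def)
    \<comment> \<open>With e factored out the denominator is (x_i + Q_i) e, which turns the summand
      of Euler's identity into x_i Q_i / (x_i + Q_i).\<close>
    have xQ: "(line x u i + Q) * e = E"
      using es_remove[OF fin i, of b "line x u"] Qe by (simp add: E_def e_def algebra_simps)
    have "h i * (line x u i + Q) * e = line x u i * es (I - {i}) (Suc b) (line x u) * (inverse E * E)"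
      unfolding h_def mult.assoc xQ by simp
    also have "\<dots> = line x u i * Q * e"
      using E0 Qe by (simp add: inverse_mult_eq_1 mult.assoc)
    finally have hQ: "h i * (line x u i + Q) = line x u i * Q" using \<open>e \<noteq> 0\<close> by simp
    have "(line x u i + Q) $ 0 * e $ 0 = E $ 0" by (simp flip: xQ)
    then have "line x u i $ 0 + Q $ 0 \<noteq> 0" using E0 by auto
    from harmonic_nth_2[OF hQ _ this] show ?thesis by (simp add: Q_def)
  qed
  have "- real (Suc (Suc b)) * qq I (Suc (Suc b)) x u $ 2 = (\<Sum>i\<in>I. - (h i $ 2))"
    unfolding sum_negf sum[symmetric] by (simp only: mult_minus_left)
  also have "\<dots> = (\<Sum>i\<in>I.
     (qq (I - {i}) (Suc b) x u $ 0 * u i - x i * qq (I - {i}) (Suc b) x u $ Suc 0)\<^sup>2 / (x i + qq (I - {i}) (Suc b) x u $ 0) ^ 3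
     - qq (I - {i}) (Suc b) x u $ 2 * (x i)\<^sup>2 / (x i + qq (I - {i}) (Suc b) x u $ 0)\<^sup>2)"
    by (intro sum.cong refl) (simp add: h)
  finally show ?thesis .
qed

text \<open>The number of variables is bounded but the index set is free: the induction on a removes
  indices, and its constants must be uniform over all sets that arise this way.\<close>

definition admissible :: "nat \<Rightarrow> real \<Rightarrow> nat \<Rightarrow> nat set \<Rightarrow> (nat \<Rightarrow> real) \<Rightarrow> bool" where
  "admissible N c a I x \<longleftrightarrow> finite I \<and> card I \<le> N \<and> (\<forall>i\<in>I. 0 \<le> x i \<and> x i \<le> 1) \<and>
    (\<exists>J\<subseteq>I. a \<le> card J \<and> (\<forall>i\<in>J. c \<le> x i))"

lemma admissible_mono: "admissible N c a I x \<Longrightarrow> a' \<le> a \<Longrightarrow> admissible N c a' I x"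
  unfolding admissible_def using order_trans by blast

lemma admissible_remove:
  assumes "admissible N c (Suc a) I x"
  shows "admissible N c a (I - {i}) x"
proof -
  obtain J where J: "J \<subseteq> I" "Suc a \<le> card J" "\<forall>i\<in>J. c \<le> x i"
    using assms by (auto simp: admissible_def)
  have fin: "finite I" "finite J" using assms J finite_subset by (auto simp: admissible_def)
  have "a \<le> card (J - {i})" using J fin by (cases "i \<in> J") auto
  moreover have "J - {i} \<subseteq> I - {i}" "\<forall>i\<in>J - {i}. c \<le> x i" using J by auto
  moreover have "card (I - {i}) \<le> N"
    using assms card_mono[of I "I - {i}"] fin by (auto simp: admissible_def)
  ultimately show ?thesis using assms unfolding admissible_def by (intro conjI) auto
qed

lemma admissible_es_ge:
  assumes "admissible N c a I x" "0 \<le> c" "j \<le> a"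
  shows "c ^ j \<le> es I j x"
proof -
  obtain J where "J \<subseteq> I" "a \<le> card J" "\<forall>i\<in>J. c \<le> x i" using assms by (auto simp: admissible_def)
  then show ?thesis
    using assms unfolding admissible_def by (intro es_ge_power[of I J]) auto
qed

lemma admissible_es_pos: "admissible N c a I x \<Longrightarrow> 0 < c \<Longrightarrow> j \<le> a \<Longrightarrow> 0 < es I j x"
  using admissible_es_ge[of N c a I x j] by (meson less_imp_le less_le_trans zero_less_power)

lemma admissible_es_le:
  assumes "admissible N c a I x"
  shows "es I j x \<le> 2 ^ N"
proof -
  have "es I j x \<le> 2 ^ card I * 1 ^ j"
    using assms by (intro es_le_power) (auto simp: admissible_def)
  also have "\<dots> \<le> 2 ^ N" using assms by (auto simp: admissible_def)
  finally show ?thesis by simp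
qed

lemma qq_nth_0:
  "es I (a - 1) x \<noteq> 0 \<Longrightarrow> qq I a x u $ 0 = es I a x / es I (a - 1) x"
  using fps_quotient_nth(1)[OF qq_mult] by simp

text \<open>In Euler's identity for sigma_a each of the at most N summands is bounded by
  sigma_(a-1), since all variables lie in [0, 1].\<close>

lemma admissible_qq_0_le:
  assumes "admissible N c a I x" "0 < c" "1 \<le> a"
  shows "qq I a x u $ 0 \<le> real N"
proof -
  obtain b where b: "a = Suc b" using assms by (cases a) auto
  have fin: "finite I" and x: "\<And>i. i \<in> I \<Longrightarrow> 0 \<le> x i \<and> x i \<le> 1" "card I \<le> N"
    using assms by (auto simp: admissible_def)
  have le: "x i * es (I - {i}) b x \<le> es I b x" if "i \<in> I" for i
  proof -
    have nn: "0 \<le> es (I - {i}) j x" for j using x by (intro es_nonneg) auto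
    have "x i * es (I - {i}) b x \<le> es (I - {i}) b x" using nn x that by (intro mult_left_le_one_le) auto
    also have "\<dots> \<le> es I b x"
      using fin that x nn es_remove[OF fin that, of "b - 1" x] by (cases b) auto
    finally show ?thesis .
  qed
  have "es I a x \<le> real a * es I a x"
    using b x es_nonneg[of I x a] by (auto simp: algebra_simps)
  also have "\<dots> = (\<Sum>i\<in>I. x i * es (I - {i}) b x)" using es_euler[OF fin, of x b] b by simp
  also have "\<dots> \<le> (\<Sum>i\<in>I. es I b x)" by (intro sum_mono le)
  also have "\<dots> \<le> real N * es I b x" using x es_nonneg[of I x b] by (auto intro!: mult_right_mono)
  finally show ?thesis
    using admissible_es_pos[OF assms(1,2), of b] b by (simp add: qq_nth_0 divide_le_eq)
qed

lemma qq_1: "finite I \<Longrightarrow> qq I (Suc 0) x u = (\<Sum>i\<in>I. line x u i)"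
  by (simp add: qq_def es_1)

text \<open>For a = 2 the inner quotients Q_i are linear, so only the squares of the recursion
  survive, all over the same denominator \<sigma>^3. The witness r is the ratio of the sum of the
  u_i to the sum of the x_i.\<close>

lemma qq_2_strictly_concave:
  assumes adm: "admissible N c 2 I x" and c: "0 < c"
  shows "\<exists>r. 1 / (2 * (real N + 1)) * (\<Sum>i\<in>I. (u i - r * x i)\<^sup>2) \<le> - (qq I 2 x u $ 2)"
proof -
  have fin: "finite I" and x: "\<And>i. i \<in> I \<Longrightarrow> 0 \<le> x i \<and> x i \<le> 1" "card I \<le> N"
    using adm by (auto simp: admissible_def)
  define \<sigma> U where "\<sigma> = (\<Sum>i\<in>I. x i)" and "U = (\<Sum>i\<in>I. u i)"
  have \<sigma>: "0 < \<sigma>" using admissible_es_pos[OF adm c, of "Suc 0"] fin by (simp add: \<sigma>_def es_1)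
  have "\<sigma> \<le> (\<Sum>i\<in>I. 1)" unfolding \<sigma>_def using x by (intro sum_mono) auto
  then have \<sigma>N: "\<sigma> \<le> real N + 1" using x(2) by simp
  have "- real (Suc (Suc 0)) * qq I (Suc (Suc 0)) x u $ 2 =
    (\<Sum>i\<in>I. ((\<sigma> - x i) * u i - x i * (U - u i))\<^sup>2 / (x i + (\<sigma> - x i)) ^ 3)"
    using \<sigma> fin unfolding \<sigma>_def U_def
    by (subst qq_recursion_nth_2) (auto simp: es_1 qq_1 fps_sum_nth sum_diff1 intro!: sum.cong)
  also have "\<dots> = (\<Sum>i\<in>I. (1 / \<sigma>) * (u i - U / \<sigma> * x i)\<^sup>2)"
    using \<sigma> by (intro sum.cong refl) (simp add: field_simps power2_eq_square power3_eq_cube)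
  also have "\<dots> \<ge> (\<Sum>i\<in>I. (1 / (real N + 1)) * (u i - U / \<sigma> * x i)\<^sup>2)"
    using \<sigma> \<sigma>N by (intro sum_mono mult_right_mono divide_left_mono) auto
  finally have "1 / (2 * (real N + 1)) * (\<Sum>i\<in>I. (u i - U / \<sigma> * x i)\<^sup>2) \<le> - (qq I 2 x u $ 2)"
    unfolding sum_distrib_left[symmetric] numeral_2_eq_2[symmetric] by (simp add: field_simps)
  then show ?thesis by blast
qed

lemma square_diff_le: "(p - q)\<^sup>2 \<le> 2 * p\<^sup>2 + 2 * (q::real)\<^sup>2"
  using zero_le_power2[of "p + q"] by (simp add: power2_eq_square algebra_simps)

lemma square_sum_le: "(p + q)\<^sup>2 \<le> 2 * p\<^sup>2 + 2 * (q::real)\<^sup>2"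
  using zero_le_power2[of "p - q"] by (simp add: power2_eq_square algebra_simps)

text \<open>A quotient that is homogeneous of degree one can be strictly concave only modulo
  multiples of x. In the induction step each i in J controls u outside i modulo some r_i x. Two such
  indices together cover I, and a third element of J, where x is at least c, forces their factors to
  be close.\<close>

lemma qq_strictly_concave_mod_radial:
  assumes "2 \<le> a" "0 < c"
  shows "\<exists>c'>0. \<forall>I x u. admissible N c a I x \<longrightarrow>
    (\<exists>r. c' * (\<Sum>i\<in>I. (u i - r * x i)\<^sup>2) \<le> - (qq I a x u $ 2))"
  using assms(1)
proof (induction a rule: nat_induct_at_least)
  case base
  show ?case
    using qq_2_strictly_concave[OF _ assms(2), of N]
    by (intro exI[of _ "1 / (2 * (real N + 1))"]) auto
next
  case (Suc a)
  then obtain c1 where c1: "0 < c1" and ih: "\<And>I x u. admissible N c a I x \<Longrightarrow>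
    \<exists>r. c1 * (\<Sum>i\<in>I. (u i - r * x i)\<^sup>2) \<le> - (qq I a x u $ 2)" by blast
  obtain b where b: "a = Suc b" using Suc by (cases a) auto
  \<comment> \<open>The recursion weights the curvature of Q_i by x_i^2 / (x_i + Q_i)^2 >= c^2 / (1
    + N)^2, and c1 comes from the induction hypothesis.\<close>
  define M where "M = real (Suc a) * (1 + real N)\<^sup>2 / (c\<^sup>2 * c1)"
  have M: "0 < M" using c1 assms(2) by (simp add: M_def)
  have key: "\<exists>r. (\<Sum>i\<in>I. (u i - r * x i)\<^sup>2) \<le> M * (3 + 8 / c\<^sup>2) * - (qq I (Suc a) x u $ 2)"
    if adm: "admissible N c (Suc a) I x" for I x u
  proof -
    obtain J where J: "J \<subseteq> I" "Suc a \<le> card J" "\<forall>i\<in>J. c \<le> x i" using adm by (auto simp: admissible_def)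
    have fin: "finite I" "finite J" and x: "\<And>i. i \<in> I \<Longrightarrow> 0 \<le> x i \<and> x i \<le> 1"
      using adm J finite_subset by (auto simp: admissible_def)
    define Q where "Q i = qq (I - {i}) a x u" for i
    define \<eta> where "\<eta> = - (qq I (Suc a) x u $ 2)"
    have adm': "admissible N c a (I - {i}) x" for i using admissible_remove[OF adm] .
    have Q2: "0 \<le> - (Q i $ 2)" for i
    proof -
      obtain r where "c1 * (\<Sum>j\<in>I - {i}. (u j - r * x j)\<^sup>2) \<le> - (Q i $ 2)"
        using ih[OF adm'] by (auto simp: Q_def)
      moreover have "0 \<le> c1 * (\<Sum>j\<in>I - {i}. (u j - r * x j)\<^sup>2)"
        using c1 by (intro mult_nonneg_nonneg sum_nonneg) auto
      ultimately show ?thesis by linarith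
    qed
    have Q0: "0 \<le> Q i $ 0" "Q i $ 0 \<le> real N" if "i \<in> I" for i
    proof -
      have p: "0 < es (I - {i}) b x" "0 < es (I - {i}) a x"
        using admissible_es_pos[OF adm' assms(2)] b by auto
      then show "0 \<le> Q i $ 0" by (simp add: Q_def qq_nth_0 b)
      show "Q i $ 0 \<le> real N" unfolding Q_def using admissible_qq_0_le[OF adm' assms(2)] b by simp
    qed
    have rec: "real (Suc a) * \<eta> = (\<Sum>i\<in>I. (Q i $ 0 * u i - x i * Q i $ Suc 0)\<^sup>2 / (x i + Q i $ 0) ^ 3
       + - (Q i $ 2) * (x i)\<^sup>2 / (x i + Q i $ 0)\<^sup>2)"
    proof -
      have pos: "\<And>i. i \<in> I \<Longrightarrow> 0 < es (I - {i}) b x" "0 < es I (Suc b) x"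
        using admissible_es_pos[OF adm' assms(2)] admissible_es_pos[OF adm assms(2)] b by auto
      show ?thesis
        using qq_recursion_nth_2[OF fin(1) pos, of u] unfolding \<eta>_def Q_def b
        by (simp only: mult_minus_left mult_minus_right diff_conv_add_uminus minus_divide_left)
    qed
    \<comment> \<open>The inner quotients are concave by the induction hypothesis, so all summands
      are nonnegative and each single one is bounded by the sum.\<close>
    have summand: "0 \<le> (Q i $ 0 * u i - x i * Q i $ Suc 0)\<^sup>2 / (x i + Q i $ 0) ^ 3
       + - (Q i $ 2) * (x i)\<^sup>2 / (x i + Q i $ 0)\<^sup>2" if "i \<in> I" for i
      using Q2[of i] Q0[OF that] x[OF that] by (intro add_nonneg_nonneg divide_nonneg_nonneg mult_nonneg_nonneg) auto
    then have \<eta>: "0 \<le> \<eta>" using rec sum_nonneg[of I] by (smt (verit) mult_less_0_iff of_nat_0_less_iff zero_less_Suc)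
    have "\<exists>r. (\<Sum>j\<in>I - {i}. (u j - r * x j)\<^sup>2) \<le> M * \<eta>" if i: "i \<in> J" for i
    proof -
      have iI: "i \<in> I" using i J by auto
      obtain r where r: "c1 * (\<Sum>j\<in>I - {i}. (u j - r * x j)\<^sup>2) \<le> - (Q i $ 2)"
        using ih[OF adm'] by (auto simp: Q_def)
      have xi: "c \<le> x i" "0 < x i" using J i assms(2) by force+
      have "c\<^sup>2 / (1 + real N)\<^sup>2 * - (Q i $ 2) \<le> (x i)\<^sup>2 / (x i + Q i $ 0)\<^sup>2 * - (Q i $ 2)"
        using xi Q0[OF iI] x[OF iI] Q2[of i] assms(2)
        by (intro mult_right_mono frac_le power_mono) (auto intro: add_mono)
      also have "\<dots> \<le> (Q i $ 0 * u i - x i * Q i $ Suc 0)\<^sup>2 / (x i + Q i $ 0) ^ 3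
       + - (Q i $ 2) * (x i)\<^sup>2 / (x i + Q i $ 0)\<^sup>2"
        using Q0[OF iI] xi by (simp add: mult.commute)
      also have "\<dots> \<le> real (Suc a) * \<eta>"
        unfolding rec by (rule member_le_sum[OF iI _ fin(1)]) (use summand in auto)
      finally have "c\<^sup>2 / (1 + real N)\<^sup>2 * - (Q i $ 2) \<le> real (Suc a) * \<eta>" .
      moreover have "c\<^sup>2 / (1 + real N)\<^sup>2 * (c1 * (\<Sum>j\<in>I - {i}. (u j - r * x j)\<^sup>2)) \<le> c\<^sup>2 / (1 + real N)\<^sup>2 * - (Q i $ 2)"
        using r by (intro mult_left_mono) auto
      ultimately have "c\<^sup>2 / (1 + real N)\<^sup>2 * (c1 * (\<Sum>j\<in>I - {i}. (u j - r * x j)\<^sup>2)) \<le> real (Suc a) * \<eta>"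
        by linarith
      then have "(\<Sum>j\<in>I - {i}. (u j - r * x j)\<^sup>2) \<le> M * \<eta>"
        unfolding M_def using c1 assms(2) by (simp add: field_simps)
      then show ?thesis by blast
    qed
    then obtain r where r: "\<And>i. i \<in> J \<Longrightarrow> (\<Sum>j\<in>I - {i}. (u j - r i * x j)\<^sup>2) \<le> M * \<eta>" by metis
    have single: "(u j - r i * x j)\<^sup>2 \<le> M * \<eta>" if "i \<in> J" "j \<in> I" "j \<noteq> i" for i j
    proof -
      have "(u j - r i * x j)\<^sup>2 \<le> (\<Sum>j\<in>I - {i}. (u j - r i * x j)\<^sup>2)"
        by (rule member_le_sum) (use that fin in auto)
      then show ?thesis using r[OF that(1)] by linarith
    qed
    have "3 \<le> card J" using J Suc by simp
    then obtain T where T: "T \<subseteq> J" "card T = 3" by (meson obtain_subset_with_card_n)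
    then obtain i i' j where T': "T = {i, i', j}" "i \<noteq> i'" "i \<noteq> j" "i' \<noteq> j"
      unfolding card_3_iff by blast
    have d: "i \<noteq> i'" "j \<noteq> i" "j \<noteq> i'" "i \<in> J" "i' \<in> J" "j \<in> J" using T T' by auto
    then have dI: "i \<in> I" "i' \<in> I" "j \<in> I" using J by auto
    have "(r i - r i')\<^sup>2 * c\<^sup>2 \<le> (r i - r i')\<^sup>2 * (x j)\<^sup>2"
      using J d assms(2) by (intro mult_left_mono power_mono) auto
    also have "\<dots> = ((u j - r i' * x j) - (u j - r i * x j))\<^sup>2" by (simp add: power2_eq_square algebra_simps)
    also have "\<dots> \<le> 2 * (u j - r i' * x j)\<^sup>2 + 2 * (u j - r i * x j)\<^sup>2" by (rule square_diff_le)
    also have "\<dots> \<le> 4 * (M * \<eta>)" using single[of i j] single[of i' j] d dI by auto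
    finally have rr: "(r i - r i')\<^sup>2 \<le> 4 * (M * \<eta>) / c\<^sup>2"
      using assms(2) by (simp add: field_simps)
    \<comment> \<open>Coordinate i is missing from the estimate that belongs to r i; the estimate
      for r i' supplies it.\<close>
    have "(u i - r i * x i)\<^sup>2 = ((u i - r i' * x i) - (r i - r i') * x i)\<^sup>2" by (simp add: algebra_simps)
    also have "\<dots> \<le> 2 * (u i - r i' * x i)\<^sup>2 + 2 * ((r i - r i') * x i)\<^sup>2" by (rule square_diff_le)
    also have "((r i - r i') * x i)\<^sup>2 \<le> (r i - r i')\<^sup>2"
      using x[OF dI(1)] unfolding power_mult_distrib by (intro mult_left_le) (auto simp: power_le_one)
    finally have "(u i - r i * x i)\<^sup>2 \<le> 2 * (M * \<eta>) + 8 * (M * \<eta>) / c\<^sup>2"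
      using rr single[of i' i] d dI by auto
    moreover have "(\<Sum>j\<in>I. (u j - r i * x j)\<^sup>2) = (u i - r i * x i)\<^sup>2 + (\<Sum>j\<in>I - {i}. (u j - r i * x j)\<^sup>2)"
      using fin dI by (simp add: sum.remove)
    ultimately have "(\<Sum>j\<in>I. (u j - r i * x j)\<^sup>2) \<le> 3 * (M * \<eta>) + 8 * (M * \<eta>) / c\<^sup>2"
      using r[OF d(4)] by linarith
    also have "\<dots> = M * (3 + 8 / c\<^sup>2) * \<eta>" by (simp add: algebra_simps)
    finally show ?thesis unfolding \<eta>_def by blast
  qed
  have pos: "0 < M * (3 + 8 / c\<^sup>2)" using M by (simp add: add_pos_nonneg)
  show ?case
  proof (rule exI[of _ "1 / (M * (3 + 8 / c\<^sup>2))"], intro conjI allI impI)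
    fix I x u assume "admissible N c (Suc a) I x"
    from key[OF this, of u] obtain r where "(\<Sum>i\<in>I. (u i - r * x i)\<^sup>2) \<le> M * (3 + 8 / c\<^sup>2) * - (qq I (Suc a) x u $ 2)" ..
    then show "\<exists>r. 1 / (M * (3 + 8 / c\<^sup>2)) * (\<Sum>i\<in>I. (u i - r * x i)\<^sup>2) \<le> - (qq I (Suc a) x u $ 2)"
      using pos by (intro exI[of _ r]) (simp add: pos_divide_le_eq mult.commute)
  qed (use pos in simp)
qed

lemma qq_concave:
  assumes "1 \<le> a" "0 < c" "admissible N c a I x"
  shows "qq I a x u $ 2 \<le> 0"
proof (cases "a = 1")
  case True
  then show ?thesis using assms by (simp add: qq_1 admissible_def fps_sum_nth)
next
  case False
  then obtain c' r where c': "0 < c'" "c' * (\<Sum>i\<in>I. (u i - r * x i)\<^sup>2) \<le> - (qq I a x u $ 2)"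
    using qq_strictly_concave_mod_radial[of a c N] assms by fastforce
  moreover have "0 \<le> c' * (\<Sum>i\<in>I. (u i - r * x i)\<^sup>2)" using c' by (intro mult_nonneg_nonneg sum_nonneg) auto
  ultimately show ?thesis by linarith
qed

text \<open>For u = r x homogeneity gives the derivative r q exactly; the deviation u - r x enters
  linearly with bounded coefficients.\<close>

lemma qq_nth_1_radial:
  assumes "2 \<le> a" "0 < c" "admissible N c a I x"
  shows "\<bar>qq I a x u $ Suc 0 - r * qq I a x u $ 0\<bar>
    \<le> 2 ^ N * (1 + real N) / c ^ (a - 1) * (\<Sum>i\<in>I. \<bar>u i - r * x i\<bar>)"
proof -
  obtain b where b: "a = Suc (Suc b)" using assms(1) by (metis Suc_le_D numeral_2_eq_2 Suc_le_mono)
  have fin: "finite I" and x: "\<And>i. i \<in> I \<Longrightarrow> 0 \<le> x i \<and> x i \<le> 1"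
    using assms by (auto simp: admissible_def)
  define A B q where AB: "A = es I a (line x u)" "B = es I (a - 1) (line x u)" "q = qq I a x u"
  define w where "w i = u i - r * x i" for i
  have B0: "c ^ (a - 1) \<le> B $ 0" "0 < B $ 0"
    using admissible_es_ge[OF assms(3)] admissible_es_pos[OF assms(3,2)] assms(2) by (auto simp: AB)
  have q0: "0 \<le> q $ 0" "q $ 0 \<le> real N"
    using admissible_qq_0_le[OF assms(3,2)] admissible_es_pos[OF assms(3,2)] assms(1)
    by (auto simp: AB qq_nth_0 less_imp_neq[THEN not_sym] intro: less_imp_le)
  have "q * B = A" using qq_mult[of I a x u] B0 by (simp add: AB)
  then have q1: "q $ Suc 0 * B $ 0 = A $ Suc 0 - q $ 0 * B $ Suc 0" "q $ 0 * B $ 0 = A $ 0"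
    using fps_quotient_nth(1,2)[of q B A] B0 by auto
  have es: "0 \<le> es (I - {i}) j x" "es (I - {i}) j x \<le> 2 ^ N" for i j
  proof -
    show "0 \<le> es (I - {i}) j x" using x by (intro es_nonneg) auto
    have "admissible N c 0 (I - {i}) x"
      using admissible_remove[of N c 0] admissible_mono[OF assms(3)] assms(1) by simp
    then show "es (I - {i}) j x \<le> 2 ^ N" by (rule admissible_es_le)
  qed
  have A1: "A $ Suc 0 = r * (real a * A $ 0) + (\<Sum>i\<in>I. w i * es (I - {i}) (a - 1) x)"
    using es_euler[OF fin, of x "a - 1"] b
    by (simp add: AB es_line_nth_1[OF fin] w_def left_diff_distrib sum_subtractf mult.assoc flip: sum_distrib_left)
  have B1: "B $ Suc 0 = r * (real (a - 1) * B $ 0) + (\<Sum>i\<in>I. w i * es (I - {i}) b x)"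
    using es_euler[OF fin, of x b] b
    by (simp add: AB es_line_nth_1[OF fin] w_def left_diff_distrib sum_subtractf mult.assoc flip: sum_distrib_left)
  have "(q $ Suc 0 - r * q $ 0) * B $ 0 = A $ Suc 0 - q $ 0 * B $ Suc 0 - r * A $ 0"
    using q1 by (simp add: algebra_simps)
  also have "\<dots> = r * (real a * A $ 0) - r * (real (a - 1) * (q $ 0 * B $ 0)) - r * A $ 0
      + (\<Sum>i\<in>I. w i * es (I - {i}) (a - 1) x) - q $ 0 * (\<Sum>i\<in>I. w i * es (I - {i}) b x)"
    unfolding A1 B1 by (simp add: algebra_simps)
  also have "\<dots> = (\<Sum>i\<in>I. w i * (es (I - {i}) (a - 1) x - q $ 0 * es (I - {i}) b x))"
    unfolding q1(2) using b by (simp add: algebra_simps sum_subtractf sum_distrib_left)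
  finally have "\<bar>q $ Suc 0 - r * q $ 0\<bar> * B $ 0 = \<bar>\<Sum>i\<in>I. w i * (es (I - {i}) (a - 1) x - q $ 0 * es (I - {i}) b x)\<bar>"
    using B0 by (metis abs_mult abs_of_pos)
  also have "\<dots> \<le> (\<Sum>i\<in>I. \<bar>w i * (es (I - {i}) (a - 1) x - q $ 0 * es (I - {i}) b x)\<bar>)" by (rule sum_abs)
  also have "\<dots> \<le> (\<Sum>i\<in>I. \<bar>w i\<bar> * (2 ^ N * (1 + real N)))"
  proof (rule sum_mono)
    fix i assume "i \<in> I"
    have "q $ 0 * es (I - {i}) b x \<le> real N * 2 ^ N" "0 \<le> q $ 0 * es (I - {i}) b x"
      using q0 es by (auto intro!: mult_mono)
    then have "\<bar>es (I - {i}) (a - 1) x - q $ 0 * es (I - {i}) b x\<bar> \<le> 2 ^ N * (1 + real N)"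
      using es[of i "a - 1"] by (simp add: abs_le_iff algebra_simps)
    then show "\<bar>w i * (es (I - {i}) (a - 1) x - q $ 0 * es (I - {i}) b x)\<bar> \<le> \<bar>w i\<bar> * (2 ^ N * (1 + real N))"
      unfolding abs_mult by (intro mult_left_mono) auto
  qed
  also have "\<dots> = 2 ^ N * (1 + real N) * (\<Sum>i\<in>I. \<bar>w i\<bar>)" by (simp add: sum_distrib_left mult_ac)
  finally have "\<bar>q $ Suc 0 - r * q $ 0\<bar> * c ^ (a - 1) \<le> 2 ^ N * (1 + real N) * (\<Sum>i\<in>I. \<bar>w i\<bar>)"
    using B0 mult_left_mono[OF B0(1), of "\<bar>q $ Suc 0 - r * q $ 0\<bar>"] by linarith
  then show ?thesis using assms(2) unfolding AB w_def by (simp add: field_simps)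
qed

text \<open>The squared derivative restores the radial direction: it is close to (r q)^2 by
  \<open>qq_nth_1_radial\<close>, and q is bounded below, so r is controlled.\<close>

lemma qq_strictly_concave:
  assumes "2 \<le> a" "0 < c"
  shows "\<exists>c'>0. \<forall>I x u. admissible N c a I x \<longrightarrow>
    c' * (\<Sum>i\<in>I. (u i)\<^sup>2) \<le> (qq I a x u $ Suc 0)\<^sup>2 - qq I a x u $ 2"
proof -
  obtain c1 where c1: "0 < c1" and H: "\<And>I x u. admissible N c a I x \<Longrightarrow>
    \<exists>r. c1 * (\<Sum>i\<in>I. (u i - r * x i)\<^sup>2) \<le> - (qq I a x u $ 2)"
    using qq_strictly_concave_mod_radial[OF assms, of N] by blast
  define D where "D = 2 ^ N * (1 + real N) / c ^ (a - 1)"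
  \<comment> \<open>Lower bound for q = sigma_a / sigma_(a-1): the numerator is at least c^a and the
    denominator at most 2^N.\<close>
  define \<kappa> where "\<kappa> = c ^ a / 2 ^ N"
  have \<kappa>: "0 < \<kappa>" and D: "0 \<le> D" using assms by (simp_all add: \<kappa>_def D_def)
  define P1 P2 where "P1 = 4 * real N / \<kappa>\<^sup>2" and "P2 = (4 * D\<^sup>2 * (real N)\<^sup>2 / \<kappa>\<^sup>2 + 2) / c1"
  have P: "0 \<le> P1" "0 < P2" using \<kappa> c1 by (auto simp: P1_def P2_def add_nonneg_pos)
  have main: "(\<Sum>i\<in>I. (u i)\<^sup>2) \<le> (P1 + P2) * ((qq I a x u $ Suc 0)\<^sup>2 - qq I a x u $ 2)"
    if adm: "admissible N c a I x" for I x u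
  proof -
    define q where "q = qq I a x u"
    have fin: "finite I" and x: "\<And>i. i \<in> I \<Longrightarrow> 0 \<le> x i \<and> x i \<le> 1" "card I \<le> N"
      using adm by (auto simp: admissible_def)
    obtain r where r: "c1 * (\<Sum>i\<in>I. (u i - r * x i)\<^sup>2) \<le> - (q $ 2)" using H[OF adm] by (auto simp: q_def)
    define W where "W = (\<Sum>i\<in>I. (u i - r * x i)\<^sup>2)"
    have W: "0 \<le> W" "W \<le> - (q $ 2) / c1" using r c1 by (auto simp: W_def field_simps intro: sum_nonneg)
    have q0: "\<kappa> \<le> q $ 0"
      using admissible_es_ge[OF adm, of a] admissible_es_pos[OF adm assms(2), of a] admissible_es_le[OF adm, of "a - 1"] admissible_es_pos[OF adm assms(2), of "a - 1"] assms(2)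
      unfolding \<kappa>_def q_def by (simp add: qq_nth_0) (intro frac_le, auto)
    have sq: "(\<Sum>i\<in>I. \<bar>u i - r * x i\<bar>)\<^sup>2 \<le> real N * W"
    proof -
      have "(\<Sum>i\<in>I. \<bar>u i - r * x i\<bar> * 1)\<^sup>2 \<le> (\<Sum>i\<in>I. \<bar>u i - r * x i\<bar>\<^sup>2) * (\<Sum>i\<in>I. 1\<^sup>2)"
        by (rule Cauchy_Schwarz_ineq_sum)
      also have "\<dots> = real (card I) * W" by (simp add: W_def)
      also have "\<dots> \<le> real N * W" using x(2) W by (intro mult_right_mono) auto
      finally show ?thesis by simp
    qed
    have "(r * q $ 0)\<^sup>2 = (q $ Suc 0 - (q $ Suc 0 - r * q $ 0))\<^sup>2" by simp
    also have "\<dots> \<le> 2 * (q $ Suc 0)\<^sup>2 + 2 * (q $ Suc 0 - r * q $ 0)\<^sup>2" by (rule square_diff_le)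
    also have "(q $ Suc 0 - r * q $ 0)\<^sup>2 \<le> (D * (\<Sum>i\<in>I. \<bar>u i - r * x i\<bar>))\<^sup>2"
      using qq_nth_1_radial[OF assms adm, of u r] unfolding D_def q_def by (rule abs_le_square_iff[THEN iffD1, OF order_trans]) (rule abs_ge_self)
    also have "\<dots> \<le> D\<^sup>2 * (real N * W)" unfolding power_mult_distrib using sq by (intro mult_left_mono) auto
    finally have rq: "(r * q $ 0)\<^sup>2 \<le> 2 * (q $ Suc 0)\<^sup>2 + 2 * (D\<^sup>2 * (real N * W))" by simp
    have "r\<^sup>2 * \<kappa>\<^sup>2 \<le> r\<^sup>2 * (q $ 0)\<^sup>2" using q0 \<kappa> by (intro mult_left_mono power_mono) auto
    then have "r\<^sup>2 * \<kappa>\<^sup>2 \<le> 2 * (q $ Suc 0)\<^sup>2 + 2 * (D\<^sup>2 * (real N * W))" using rq by (simp add: power_mult_distrib)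
    then have r2: "r\<^sup>2 \<le> (2 * (q $ Suc 0)\<^sup>2 + 2 * (D\<^sup>2 * (real N * W))) / \<kappa>\<^sup>2" using \<kappa> by (simp add: pos_le_divide_eq)
    have "(\<Sum>i\<in>I. (u i)\<^sup>2) \<le> (\<Sum>i\<in>I. 2 * r\<^sup>2 + 2 * (u i - r * x i)\<^sup>2)"
    proof (rule sum_mono)
      fix i assume i: "i \<in> I"
      have "(u i)\<^sup>2 = (r * x i + (u i - r * x i))\<^sup>2" by simp
      also have "\<dots> \<le> 2 * (r * x i)\<^sup>2 + 2 * (u i - r * x i)\<^sup>2" by (rule square_sum_le)
      also have "(r * x i)\<^sup>2 \<le> r\<^sup>2"
        using x(1)[OF i] unfolding power_mult_distrib by (intro mult_left_le) (auto simp: power_le_one)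
      finally show "(u i)\<^sup>2 \<le> 2 * r\<^sup>2 + 2 * (u i - r * x i)\<^sup>2" by simp
    qed
    also have "\<dots> = 2 * real (card I) * r\<^sup>2 + 2 * W" by (simp add: sum.distrib W_def sum_distrib_left)
    also have "\<dots> \<le> 2 * real N * r\<^sup>2 + 2 * W" using x(2) by (auto intro!: mult_right_mono)
    also have "\<dots> \<le> 2 * real N * ((2 * (q $ Suc 0)\<^sup>2 + 2 * (D\<^sup>2 * (real N * W))) / \<kappa>\<^sup>2) + 2 * W"
      using r2 by (intro add_right_mono mult_left_mono) auto
    also have "\<dots> = P1 * (q $ Suc 0)\<^sup>2 + (4 * D\<^sup>2 * (real N)\<^sup>2 / \<kappa>\<^sup>2 + 2) * W"
      using \<kappa> by (simp add: P1_def field_simps power2_eq_square)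
    also have "\<dots> \<le> P1 * (q $ Suc 0)\<^sup>2 + (4 * D\<^sup>2 * (real N)\<^sup>2 / \<kappa>\<^sup>2 + 2) * (- (q $ 2) / c1)"
      using W by (intro add_left_mono mult_left_mono) auto
    also have "\<dots> = P1 * (q $ Suc 0)\<^sup>2 + P2 * (- (q $ 2))" by (simp add: P2_def)
    also have "\<dots> \<le> (P1 + P2) * ((q $ Suc 0)\<^sup>2 - q $ 2)"
    proof -
      have "0 \<le> P1 * - (q $ 2)" "0 \<le> P2 * (q $ Suc 0)\<^sup>2"
        using P qq_concave[OF _ assms(2) adm, of u] assms(1) by (auto simp: q_def mult_nonneg_nonpos)
      then show ?thesis by (simp add: algebra_simps)
    qed
    finally show ?thesis by (simp add: q_def)
  qed
  have P': "0 < P1 + P2" using P by linarith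
  show ?thesis
  proof (intro exI[of _ "1 / (P1 + P2)"] conjI allI impI)
    fix I x u assume "admissible N c a I x"
    from main[OF this, of u] show "1 / (P1 + P2) * (\<Sum>i\<in>I. (u i)\<^sup>2) \<le> (qq I a x u $ Suc 0)\<^sup>2 - qq I a x u $ 2"
      using P' by (simp add: pos_divide_le_eq mult.commute)
  qed (use P' in simp)
qed

text \<open>For b = a - 2 the quotient is q p with q = sigma_a / sigma_(a-1) and p = sigma_(a-1) /
  sigma_(a-2). Only q has to be strictly concave; the mixed term of the product rule is absorbed by
  the square of the derivative of q p.\<close>

lemma quotient_strictly_concave:
  assumes "2 \<le> a" "0 < c" and b: "b = a - 1 \<or> b = a - 2"
  shows "\<exists>c'>0. \<forall>I x u G. admissible N c a I x \<longrightarrow> G = es I a (line x u) * inverse (es I b (line x u)) \<longrightarrow>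
    c' * (\<Sum>i\<in>I. (u i)\<^sup>2) \<le> 4 * (G $ Suc 0)\<^sup>2 / G $ 0 - 2 * G $ 2"
proof -
  obtain c1 where c1: "0 < c1" and H: "\<And>I x u. admissible N c a I x \<Longrightarrow>
    c1 * (\<Sum>i\<in>I. (u i)\<^sup>2) \<le> (qq I a x u $ Suc 0)\<^sup>2 - qq I a x u $ 2"
    using qq_strictly_concave[OF assms(1,2), of N] by blast
  define \<kappa> where "\<kappa> = c ^ (a - 1) / 2 ^ N"
  have \<kappa>: "0 < \<kappa>" using assms by (simp add: \<kappa>_def)
  \<comment> \<open>The first two entries serve b = a - 2: one for the curvature of q with weight 2
    p >= 2 \<kappa>, one for its squared derivative with weight p / q. The last entry serves b = a -
    1.\<close>
  define c' where "c' = c1 * min (min (2 * \<kappa>) (\<kappa> / (real N + 1))) (2 / (real N + 1))"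
  have "0 < c'" using c1 \<kappa> by (simp add: c'_def)
  moreover have "c' * (\<Sum>i\<in>I. (u i)\<^sup>2) \<le> 4 * (G $ Suc 0)\<^sup>2 / G $ 0 - 2 * G $ 2"
    if adm: "admissible N c a I x" and G: "G = es I a (line x u) * inverse (es I b (line x u))" for I x u G
  proof -
    define q where "q = qq I a x u"
    define m where "m = min (min (2 * \<kappa>) (\<kappa> / (real N + 1))) (2 / (real N + 1))"
    have m: "0 \<le> m" "m \<le> 2 * \<kappa>" "m \<le> \<kappa> / (real N + 1)" "m \<le> 2 / (real N + 1)"
      using \<kappa> by (auto simp: m_def)
    have q2: "q $ 2 \<le> 0" using qq_concave[OF _ assms(2) adm] assms(1) by (simp add: q_def)
    have q0: "0 < q $ 0" "q $ 0 \<le> real N + 1"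
      using admissible_qq_0_le[OF adm assms(2), of u] admissible_es_pos[OF adm assms(2)] assms(1)
      by (auto simp: q_def qq_nth_0 less_imp_neq[THEN not_sym])
    have "c' * (\<Sum>i\<in>I. (u i)\<^sup>2) = m * (c1 * (\<Sum>i\<in>I. (u i)\<^sup>2))" by (simp add: c'_def m_def)
    also have "\<dots> \<le> m * ((q $ Suc 0)\<^sup>2 - q $ 2)" using H[OF adm] m(1) by (intro mult_left_mono) (auto simp: q_def)
    finally have lower: "c' * (\<Sum>i\<in>I. (u i)\<^sup>2) \<le> m * (q $ Suc 0)\<^sup>2 + m * (- (q $ 2))"
      by (simp add: algebra_simps)
    show ?thesis
    proof (cases "b = a - 1")
      case True
      then have Gq: "G = q" by (simp add: G q_def qq_def)
      have "m \<le> 2" using m(4) by (rule order_trans) (simp add: divide_le_eq)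
      then have "m * (- (q $ 2)) \<le> 2 * (- (q $ 2))" using q2 by (intro mult_right_mono) auto
      moreover have "m \<le> 4 / q $ 0"
      proof -
        have "2 / (real N + 1) \<le> 4 / q $ 0" using q0 by (intro frac_le) auto
        then show ?thesis using m(4) by linarith
      qed
      then have "m * (q $ Suc 0)\<^sup>2 \<le> 4 / q $ 0 * (q $ Suc 0)\<^sup>2" by (rule mult_right_mono) simp
      ultimately show ?thesis using lower by (simp add: Gq)
    next
      case False
      then have b: "b = a - 2" using b by simp
      define p where "p = qq I (a - 1) x u"
      have adm': "admissible N c (a - 1) I x" using admissible_mono[OF adm] by simp
      have p2: "p $ 2 \<le> 0" using qq_concave[OF _ assms(2) adm'] assms(1) by (simp add: p_def)
      have pos: "0 < es I (a - 1) x" "0 < es I (a - 2) x" using admissible_es_pos[OF adm assms(2)] by auto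
      have p0: "\<kappa> \<le> p $ 0" "0 < p $ 0"
      proof -
        have a2: "a - 1 - 1 = a - 2" by simp
        have "c ^ (a - 1) / 2 ^ N \<le> es I (a - 1) x / es I (a - 2) x"
          using admissible_es_ge[OF adm, of "a - 1"] admissible_es_le[OF adm, of "a - 2"] pos assms(2)
          by (intro frac_le) auto
        then show "\<kappa> \<le> p $ 0" using pos unfolding \<kappa>_def p_def by (subst qq_nth_0) (auto simp: numeral_2_eq_2)
        then show "0 < p $ 0" using \<kappa> by linarith
      qed
      have a2: "a - 1 - 1 = a - 2" by simp
      have "q * p = es I a (line x u) * (inverse (es I (a - 1) (line x u)) * es I (a - 1) (line x u)) * inverse (es I b (line x u))"
        unfolding q_def p_def qq_def b a2 by (simp add: mult_ac)
      then have Gqp: "G = q * p" using pos(1) by (simp add: G inverse_mult_eq_1)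
      define s t where "s = q $ Suc 0 * p $ 0" and "t = q $ 0 * p $ Suc 0"
      have G0: "G $ 0 = q $ 0 * p $ 0" and G1: "G $ Suc 0 = s + t"
        and G2: "G $ 2 = q $ 0 * p $ 2 + q $ Suc 0 * p $ Suc 0 + q $ 2 * p $ 0"
        by (simp_all add: Gqp s_def t_def fps_mult_nth_Suc_0 fps_mult_nth_2)
      have st: "q $ Suc 0 * p $ Suc 0 = s * t / (q $ 0 * p $ 0)" using q0 p0 by (simp add: s_def t_def)
      \<comment> \<open>The difference of the two sides is 3 (s + t)^2 + t^2.\<close>
      have "s\<^sup>2 \<le> 4 * (s + t)\<^sup>2 - 2 * (s * t)"
        using sum_power2_ge_zero[of "s + t" "t"] zero_le_power2[of s] zero_le_power2[of "s+t"]
        by (simp add: power2_eq_square algebra_simps)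
      then have "s\<^sup>2 / (q $ 0 * p $ 0) \<le> (4 * (s + t)\<^sup>2 - 2 * (s * t)) / (q $ 0 * p $ 0)"
        using q0 p0 by (intro divide_right_mono) auto
      then have "s\<^sup>2 / (q $ 0 * p $ 0) \<le> 4 * (G $ Suc 0)\<^sup>2 / G $ 0 - 2 * (q $ Suc 0 * p $ Suc 0)"
        unfolding st G0 G1 by (simp add: diff_divide_distrib)
      moreover have "s\<^sup>2 / (q $ 0 * p $ 0) = p $ 0 / q $ 0 * (q $ Suc 0)\<^sup>2"
        using q0 p0 by (simp add: s_def power2_eq_square)
      moreover have "m * (q $ Suc 0)\<^sup>2 \<le> p $ 0 / q $ 0 * (q $ Suc 0)\<^sup>2"
      proof -
        have "\<kappa> / (real N + 1) \<le> p $ 0 / q $ 0" using q0 p0 by (intro frac_le) auto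
        then show ?thesis using m(3) by (intro mult_right_mono) auto
      qed
      moreover have "m * (- (q $ 2)) \<le> 2 * p $ 0 * (- (q $ 2))"
        using m(2) p0 q2 by (intro mult_right_mono) auto
      moreover have "q $ 0 * p $ 2 \<le> 0" using q0 p2 by (simp add: mult_nonneg_nonpos)
      ultimately show ?thesis using lower unfolding G2 by (simp add: algebra_simps)
    qed
  qed
  ultimately show ?thesis by blast
qed

subsection \<open>Uniform bounds for jets\<close>

text \<open>A big-O notation for families of second-order jets: the weights vary with the point p,
  while one constant serves all of \<Omega>.\<close>

definition jetB :: "'p set \<Rightarrow> ('p \<Rightarrow> real) \<Rightarrow> ('p \<Rightarrow> real) \<Rightarrow> ('p \<Rightarrow> real) \<Rightarrow> ('p \<Rightarrow> real fps) \<Rightarrow> bool" where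
  "jetB \<Omega> a b c f \<longleftrightarrow> (\<exists>C\<ge>0. \<forall>p\<in>\<Omega>. \<bar>f p $ 0\<bar> \<le> C * a p \<and> \<bar>f p $ Suc 0\<bar> \<le> C * b p \<and> \<bar>f p $ 2\<bar> \<le> C * c p)"

lemma jetBI:
  assumes "0 \<le> C" "\<And>p. p \<in> \<Omega> \<Longrightarrow> \<bar>f p $ 0\<bar> \<le> C * a p" "\<And>p. p \<in> \<Omega> \<Longrightarrow> \<bar>f p $ Suc 0\<bar> \<le> C * b p"
    "\<And>p. p \<in> \<Omega> \<Longrightarrow> \<bar>f p $ 2\<bar> \<le> C * c p"
  shows "jetB \<Omega> a b c f"
  using assms unfolding jetB_def by blast

lemma jetBE:
  assumes "jetB \<Omega> a b c f"
  obtains C where "0 \<le> C" "\<And>p. p \<in> \<Omega> \<Longrightarrow> \<bar>f p $ 0\<bar> \<le> C * a p" "\<And>p. p \<in> \<Omega> \<Longrightarrow> \<bar>f p $ Suc 0\<bar> \<le> C * b p"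
    "\<And>p. p \<in> \<Omega> \<Longrightarrow> \<bar>f p $ 2\<bar> \<le> C * c p"
  using assms unfolding jetB_def by blast

lemma jetB_cong: "(\<And>p. p \<in> \<Omega> \<Longrightarrow> f p = g p) \<Longrightarrow> jetB \<Omega> a b c f \<longleftrightarrow> jetB \<Omega> a b c g"
  unfolding jetB_def by (metis (no_types, lifting))

lemma jetB_mono:
  assumes "jetB \<Omega> a b c f" "0 \<le> D"
    "\<And>p. p \<in> \<Omega> \<Longrightarrow> a p \<le> D * a' p" "\<And>p. p \<in> \<Omega> \<Longrightarrow> b p \<le> D * b' p" "\<And>p. p \<in> \<Omega> \<Longrightarrow> c p \<le> D * c' p"
  shows "jetB \<Omega> a' b' c' f"
proof -
  obtain C where C: "0 \<le> C" "\<And>p. p \<in> \<Omega> \<Longrightarrow> \<bar>f p $ 0\<bar> \<le> C * a p" "\<And>p. p \<in> \<Omega> \<Longrightarrow> \<bar>f p $ Suc 0\<bar> \<le> C * b p"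
    "\<And>p. p \<in> \<Omega> \<Longrightarrow> \<bar>f p $ 2\<bar> \<le> C * c p" using jetBE[OF assms(1)] by blast
  have *: "C * v \<le> C * D * v'" if "v \<le> D * v'" for v v'
    using mult_left_mono[OF that C(1)] by (simp add: mult.assoc)
  show ?thesis
  proof (rule jetBI[of "C * D"])
    fix p assume p: "p \<in> \<Omega>"
    show "\<bar>f p $ 0\<bar> \<le> C * D * a' p" by (rule order_trans[OF C(2)[OF p] *[OF assms(3)[OF p]]])
    show "\<bar>f p $ Suc 0\<bar> \<le> C * D * b' p" by (rule order_trans[OF C(3)[OF p] *[OF assms(4)[OF p]]])
    show "\<bar>f p $ 2\<bar> \<le> C * D * c' p" by (rule order_trans[OF C(4)[OF p] *[OF assms(5)[OF p]]])
  qed (use C assms in auto)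
qed

lemma jetB_add:
  assumes "jetB \<Omega> a b c f" "jetB \<Omega> a b c g"
  shows "jetB \<Omega> a b c (\<lambda>p. f p + g p)"
proof -
  obtain C where C: "0 \<le> C" "\<And>p. p \<in> \<Omega> \<Longrightarrow> \<bar>f p $ 0\<bar> \<le> C * a p" "\<And>p. p \<in> \<Omega> \<Longrightarrow> \<bar>f p $ Suc 0\<bar> \<le> C * b p"
    "\<And>p. p \<in> \<Omega> \<Longrightarrow> \<bar>f p $ 2\<bar> \<le> C * c p" using jetBE[OF assms(1)] by blast
  obtain D where D: "0 \<le> D" "\<And>p. p \<in> \<Omega> \<Longrightarrow> \<bar>g p $ 0\<bar> \<le> D * a p" "\<And>p. p \<in> \<Omega> \<Longrightarrow> \<bar>g p $ Suc 0\<bar> \<le> D * b p"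
    "\<And>p. p \<in> \<Omega> \<Longrightarrow> \<bar>g p $ 2\<bar> \<le> D * c p" using jetBE[OF assms(2)] by blast
  show ?thesis
    by (rule jetBI[of "C + D"]) (use C D in \<open>auto simp: distrib_right intro: order_trans[OF abs_triangle_ineq add_mono]\<close>)
qed

lemma jetB_minus: "jetB \<Omega> a b c f \<Longrightarrow> jetB \<Omega> a b c (\<lambda>p. - f p)"
  unfolding jetB_def by simp

lemma jetB_diff: "jetB \<Omega> a b c f \<Longrightarrow> jetB \<Omega> a b c g \<Longrightarrow> jetB \<Omega> a b c (\<lambda>p. f p - g p)"
  using jetB_add[OF _ jetB_minus, of \<Omega> a b c f g] by simp

lemma jetB_0: "jetB \<Omega> a b c (\<lambda>_. 0)"
  by (rule jetBI[of 0]) auto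

lemma jetB_sum:
  assumes "finite S" "\<And>i. i \<in> S \<Longrightarrow> jetB \<Omega> a b c (f i)"
  shows "jetB \<Omega> a b c (\<lambda>p. \<Sum>i\<in>S. f i p)"
  using assms by (induction S rule: finite_induct) (auto intro: jetB_0 jetB_add)

lemma jetB_mult:
  assumes "jetB \<Omega> a b c f" "jetB \<Omega> a' b' c' g" "0 \<le> D"
    and w: "\<And>p. p \<in> \<Omega> \<Longrightarrow> a p * a' p \<le> D * A p" "\<And>p. p \<in> \<Omega> \<Longrightarrow> a p * b' p + b p * a' p \<le> D * B p"
      "\<And>p. p \<in> \<Omega> \<Longrightarrow> a p * c' p + b p * b' p + c p * a' p \<le> D * C p"
  shows "jetB \<Omega> A B C (\<lambda>p. f p * g p)"
proof -
  obtain K where K: "0 \<le> K" "\<And>p. p \<in> \<Omega> \<Longrightarrow> \<bar>f p $ 0\<bar> \<le> K * a p" "\<And>p. p \<in> \<Omega> \<Longrightarrow> \<bar>f p $ Suc 0\<bar> \<le> K * b p"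
    "\<And>p. p \<in> \<Omega> \<Longrightarrow> \<bar>f p $ 2\<bar> \<le> K * c p" using jetBE[OF assms(1)] by blast
  obtain M where M: "0 \<le> M" "\<And>p. p \<in> \<Omega> \<Longrightarrow> \<bar>g p $ 0\<bar> \<le> M * a' p" "\<And>p. p \<in> \<Omega> \<Longrightarrow> \<bar>g p $ Suc 0\<bar> \<le> M * b' p"
    "\<And>p. p \<in> \<Omega> \<Longrightarrow> \<bar>g p $ 2\<bar> \<le> M * c' p" using jetBE[OF assms(2)] by blast
  have prod: "\<bar>y * z\<bar> \<le> K * M * (v * v')" if "\<bar>y\<bar> \<le> K * v" "\<bar>z\<bar> \<le> M * v'" for y z v v'
  proof -
    have "\<bar>y\<bar> * \<bar>z\<bar> \<le> (K * v) * (M * v')" using that by (intro mult_mono) auto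
    then show ?thesis by (simp add: abs_mult mult_ac)
  qed
  have fin: "K * M * v \<le> K * M * D * v'" if "v \<le> D * v'" for v v'
    using mult_left_mono[OF that, of "K * M"] K(1) M(1) by (simp add: mult.assoc)
  show ?thesis
  proof (rule jetBI[of "K * M * D"])
    fix p assume p: "p \<in> \<Omega>"
    show "\<bar>(f p * g p) $ 0\<bar> \<le> K * M * D * A p"
      unfolding fps_mult_nth_0 using prod[OF K(2)[OF p] M(2)[OF p]] fin[OF w(1)[OF p]] by (rule order_trans)
    have "\<bar>(f p * g p) $ Suc 0\<bar> \<le> \<bar>f p $ 0 * g p $ Suc 0\<bar> + \<bar>f p $ Suc 0 * g p $ 0\<bar>"
      unfolding fps_mult_nth_Suc_0 by (rule abs_triangle_ineq)
    also have "\<dots> \<le> K * M * (a p * b' p + b p * a' p)"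
      using prod[OF K(2)[OF p] M(3)[OF p]] prod[OF K(3)[OF p] M(2)[OF p]]
      unfolding distrib_left by (rule add_mono)
    finally show "\<bar>(f p * g p) $ Suc 0\<bar> \<le> K * M * D * B p" using fin[OF w(2)[OF p]] by linarith
    have "\<bar>(f p * g p) $ 2\<bar> \<le> \<bar>f p $ 0 * g p $ 2\<bar> + \<bar>f p $ Suc 0 * g p $ Suc 0\<bar> + \<bar>f p $ 2 * g p $ 0\<bar>"
      unfolding fps_mult_nth_2 by linarith
    also have "\<dots> \<le> K * M * (a p * c' p + b p * b' p + c p * a' p)"
      using prod[OF K(2)[OF p] M(4)[OF p]] prod[OF K(3)[OF p] M(3)[OF p]] prod[OF K(4)[OF p] M(2)[OF p]]
      unfolding distrib_left by (intro add_mono)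
    finally show "\<bar>(f p * g p) $ 2\<bar> \<le> K * M * D * C p" using fin[OF w(3)[OF p]] by linarith
  qed (use K M assms in auto)
qed

text \<open>The second coefficient of an inverse contains the square of the first one, so c has to
  dominate b^2.\<close>

lemma jetB_inverse:
  assumes "jetB \<Omega> (\<lambda>_. 1) b c f" and nn: "\<And>p. p \<in> \<Omega> \<Longrightarrow> 0 \<le> b p" "\<And>p. p \<in> \<Omega> \<Longrightarrow> 0 \<le> c p"
    and D: "0 \<le> D" "\<And>p. p \<in> \<Omega> \<Longrightarrow> (b p)\<^sup>2 \<le> D * c p"
    and c0: "0 < c0" "\<And>p. p \<in> \<Omega> \<Longrightarrow> c0 \<le> f p $ 0"
  shows "jetB \<Omega> (\<lambda>_. 1) b c (\<lambda>p. inverse (f p))"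
proof -
  obtain K where K': "0 \<le> K" "\<And>p. p \<in> \<Omega> \<Longrightarrow> \<bar>f p $ 0\<bar> \<le> K * 1" "\<And>p. p \<in> \<Omega> \<Longrightarrow> \<bar>f p $ Suc 0\<bar> \<le> K * b p"
    "\<And>p. p \<in> \<Omega> \<Longrightarrow> \<bar>f p $ 2\<bar> \<le> K * c p" using jetBE[OF assms(1)] by blast
  note K = K'(1,3,4)
  define e where "e = 1 / c0"
  have e: "0 \<le> e" using c0 by (simp add: e_def)
  define C1 C2 where "C1 = e * (e * K)" and "C2 = e * (C1 * K * D + e * K)"
  have C: "0 \<le> C1" "0 \<le> C2" using e K D by (auto simp: C1_def C2_def)
  show ?thesis
  proof (rule jetBI[of "e + C1 + C2"])
    fix p assume p: "p \<in> \<Omega>"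
    define g where "g = inverse (f p)"
    have f0: "c0 \<le> f p $ 0" "f p $ 0 \<noteq> 0" using c0(1) c0(2)[OF p] by linarith+
    have "g * f p = 1" using f0 by (simp add: g_def inverse_mult_eq_1)
    note nth = fps_quotient_nth[OF this f0(2)]
    have inv: "\<bar>v / f p $ 0\<bar> \<le> e * V" if "\<bar>v\<bar> \<le> V" for v V
    proof -
      have "\<bar>v\<bar> / f p $ 0 \<le> V / c0" using that f0(1) c0(1) by (intro frac_le) linarith+
      then show ?thesis using f0(1) c0(1) by (simp add: e_def)
    qed
    have g0: "\<bar>g $ 0\<bar> \<le> e" using inv[of 1 1] nth(1) by simp
    have "\<bar>g $ 0 * f p $ Suc 0\<bar> \<le> e * (K * b p)"
      unfolding abs_mult using g0 K(2)[OF p] e by (intro mult_mono) auto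
    then have g1: "\<bar>g $ Suc 0\<bar> \<le> C1 * b p"
      using inv[of "1 $ Suc 0 - g $ 0 * f p $ Suc 0" "e * (K * b p)"]
      unfolding nth(2)[symmetric] C1_def by (simp add: mult.assoc)
    have "\<bar>g $ Suc 0 * f p $ Suc 0\<bar> \<le> (C1 * b p) * (K * b p)"
      unfolding abs_mult using g1 K(2)[OF p] C nn[OF p] by (intro mult_mono) auto
    also have "\<dots> = C1 * K * (b p)\<^sup>2" by (simp add: power2_eq_square)
    also have "\<dots> \<le> C1 * K * (D * c p)" using C K D(2)[OF p] by (intro mult_left_mono) auto
    finally have s1: "\<bar>g $ Suc 0 * f p $ Suc 0\<bar> \<le> C1 * K * (D * c p)" .
    have s2: "\<bar>g $ 0 * f p $ 2\<bar> \<le> e * (K * c p)"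
      unfolding abs_mult using g0 K(3)[OF p] e by (intro mult_mono) auto
    have "\<bar>g $ 2\<bar> \<le> e * (C1 * K * (D * c p) + e * (K * c p))"
      unfolding nth(3)
    proof (rule inv)
      show "\<bar>1 $ 2 - g $ Suc 0 * f p $ Suc 0 - g $ 0 * f p $ 2\<bar> \<le> C1 * K * (D * c p) + e * (K * c p)"
        using s1 s2 by simp
    qed
    then have g2: "\<bar>g $ 2\<bar> \<le> C2 * c p" by (simp add: C2_def algebra_simps)
    show "\<bar>inverse (f p) $ 0\<bar> \<le> (e + C1 + C2) * 1" using g0 C unfolding g_def mult_1_right by linarith
    have "C1 * b p \<le> (e + C1 + C2) * b p" using e C nn[OF p] by (intro mult_right_mono) auto
    then show "\<bar>inverse (f p) $ Suc 0\<bar> \<le> (e + C1 + C2) * b p" using g1 unfolding g_def by linarith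
    have "C2 * c p \<le> (e + C1 + C2) * c p" using e C nn[OF p] by (intro mult_right_mono) auto
    then show "\<bar>inverse (f p) $ 2\<bar> \<le> (e + C1 + C2) * c p" using g2 unfolding g_def by linarith
  qed (use e C in auto)
qed

text \<open>Two first-order coefficients have weight \<omega>^2 <= \<tau> \<chi>, the same as one
  second-order coefficient times one value. Hence every way of distributing two derivatives over the
  factors obeys the same bound.\<close>

lemma prod_jet_bound:
  fixes f :: "nat \<Rightarrow> real fps"
  assumes "finite T" "\<forall>i\<in>T. \<bar>f i $ 0\<bar> \<le> \<tau> \<and> \<bar>f i $ Suc 0\<bar> \<le> \<omega> \<and> \<bar>f i $ 2\<bar> \<le> \<chi>"
    and nn: "0 \<le> \<tau>" "0 \<le> \<omega>" "0 \<le> \<chi>" and \<omega>: "\<omega>\<^sup>2 \<le> \<tau> * \<chi>"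
  shows "\<bar>(\<Prod>i\<in>T. f i) $ 0\<bar> \<le> \<tau> ^ card T \<and> \<bar>(\<Prod>i\<in>T. f i) $ Suc 0\<bar> \<le> real (card T) * \<tau> ^ (card T - 1) * \<omega>
    \<and> \<bar>(\<Prod>i\<in>T. f i) $ 2\<bar> \<le> (real (card T))\<^sup>2 * \<tau> ^ (card T - 1) * \<chi>"
  using assms(1,2)
proof (induction T rule: finite_induct)
  case empty
  then show ?case by simp
next
  case (insert a T)
  define P k where "P = (\<Prod>i\<in>T. f i)" and "k = card T"
  have f: "\<bar>f a $ 0\<bar> \<le> \<tau>" "\<bar>f a $ Suc 0\<bar> \<le> \<omega>" "\<bar>f a $ 2\<bar> \<le> \<chi>" using insert.prems by auto
  have P: "\<bar>P $ 0\<bar> \<le> \<tau> ^ k" "\<bar>P $ Suc 0\<bar> \<le> real k * \<tau> ^ (k - 1) * \<omega>" "\<bar>P $ 2\<bar> \<le> (real k)\<^sup>2 * \<tau> ^ (k - 1) * \<chi>"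
    using insert unfolding P_def k_def by auto
  have pr: "(\<Prod>i\<in>insert a T. f i) = f a * P" and ca: "card (insert a T) = Suc k"
    using insert by (simp_all add: P_def k_def)
  \<comment> \<open>For k = 0 the exponent k - 1 is truncated, but then v = 0.\<close>
  have \<tau>k: "\<tau> * (v * \<tau> ^ (k - 1)) = v * \<tau> ^ k" if "v = real k \<or> v = (real k)\<^sup>2" for v
    using that by (cases k) auto
  have m: "\<bar>y * z\<bar> \<le> v * w" if "\<bar>y\<bar> \<le> v" "\<bar>z\<bar> \<le> w" for y z v w :: real
    unfolding abs_mult using that by (intro mult_mono) auto
  have "\<bar>f a $ 0 * P $ Suc 0\<bar> \<le> real k * \<tau> ^ k * \<omega>"
    using m[OF f(1) P(2)] unfolding mult.assoc[of \<tau> "_ * _", symmetric] \<tau>k[OF disjI1[OF refl]] .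
  moreover have "\<bar>f a $ Suc 0 * P $ 0\<bar> \<le> \<tau> ^ k * \<omega>" using m[OF f(2) P(1)] by (simp only: mult.commute)
  ultimately have 1: "\<bar>(f a * P) $ Suc 0\<bar> \<le> real (Suc k) * \<tau> ^ k * \<omega>"
    unfolding fps_mult_nth_Suc_0 using abs_triangle_ineq[of "f a $ 0 * P $ Suc 0" "f a $ Suc 0 * P $ 0"]
    unfolding of_nat_Suc distrib_right mult_1_left by linarith
  have "\<bar>f a $ 0 * P $ 2\<bar> \<le> (real k)\<^sup>2 * \<tau> ^ k * \<chi>"
    using m[OF f(1) P(3)] unfolding mult.assoc[of \<tau> "_ * _", symmetric] \<tau>k[OF disjI2[OF refl]] .
  moreover have "\<bar>f a $ Suc 0 * P $ Suc 0\<bar> \<le> real k * \<tau> ^ k * \<chi>"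
  proof -
    have "\<bar>f a $ Suc 0 * P $ Suc 0\<bar> \<le> real k * \<tau> ^ (k - 1) * \<omega>\<^sup>2"
      using m[OF f(2) P(2)] by (simp only: power2_eq_square mult_ac)
    also have "\<dots> \<le> real k * \<tau> ^ (k - 1) * (\<tau> * \<chi>)" using \<omega> nn by (intro mult_left_mono) auto
    also have "\<dots> = (\<tau> * (real k * \<tau> ^ (k - 1))) * \<chi>" by (simp only: mult_ac)
    finally show ?thesis unfolding \<tau>k[OF disjI1[OF refl]] .
  qed
  moreover have "\<bar>f a $ 2 * P $ 0\<bar> \<le> \<tau> ^ k * \<chi>" using m[OF f(3) P(1)] by (simp only: mult.commute)
  moreover have "0 \<le> real k * \<tau> ^ k * \<chi>" using nn by simp
  ultimately have 2: "\<bar>(f a * P) $ 2\<bar> \<le> (real (Suc k))\<^sup>2 * \<tau> ^ k * \<chi>"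
    unfolding fps_mult_nth_2 power2_eq_square of_nat_Suc distrib_right distrib_left mult_1_left mult_1_right
    by linarith
  show ?case unfolding pr ca using m[OF f(1) P(1)] 1 2 by simp
qed

text \<open>There are at most 2^(card I) products, and (j + 1)^2 is a common bound for the factors
  1, j and j^2 coming from \<open>prod_jet_bound\<close>.\<close>

lemma es_jet_bound:
  fixes f :: "nat \<Rightarrow> real fps"
  assumes "finite I" "\<forall>i\<in>I. \<bar>f i $ 0\<bar> \<le> \<tau> \<and> \<bar>f i $ Suc 0\<bar> \<le> \<omega> \<and> \<bar>f i $ 2\<bar> \<le> \<chi>"
    and nn: "0 \<le> \<tau>" "0 \<le> \<omega>" "0 \<le> \<chi>" and \<omega>: "\<omega>\<^sup>2 \<le> \<tau> * \<chi>"
  shows "\<bar>es I j f $ 0\<bar> \<le> 2 ^ card I * (real j + 1)\<^sup>2 * \<tau> ^ j"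
    and "\<bar>es I j f $ Suc 0\<bar> \<le> 2 ^ card I * (real j + 1)\<^sup>2 * (\<tau> ^ (j - 1) * \<omega>)"
    and "\<bar>es I j f $ 2\<bar> \<le> 2 ^ card I * (real j + 1)\<^sup>2 * (\<tau> ^ (j - 1) * \<chi>)"
proof -
  let ?S = "{S. S \<subseteq> I \<and> card S = j}"
  have P: "\<bar>(\<Prod>i\<in>S. f i) $ 0\<bar> \<le> \<tau> ^ j" "\<bar>(\<Prod>i\<in>S. f i) $ Suc 0\<bar> \<le> real j * \<tau> ^ (j - 1) * \<omega>"
    "\<bar>(\<Prod>i\<in>S. f i) $ 2\<bar> \<le> (real j)\<^sup>2 * \<tau> ^ (j - 1) * \<chi>" if "S \<in> ?S" for S
    using prod_jet_bound[of S f \<tau> \<omega> \<chi>] assms that finite_subset[of S I] by auto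
  have cardS: "real (card ?S) \<le> 2 ^ card I"
  proof -
    have "card ?S \<le> card (Pow I)" using assms(1) by (intro card_mono) auto
    then show ?thesis using assms(1) by (simp add: card_Pow flip: of_nat_le_iff)
  qed
  have j: "1 \<le> (real j + 1)\<^sup>2" "real j \<le> (real j + 1)\<^sup>2" "(real j)\<^sup>2 \<le> (real j + 1)\<^sup>2"
    by (simp_all add: power2_eq_square algebra_simps)
  have bnd: "\<bar>es I j f $ m\<bar> \<le> 2 ^ card I * (real j + 1)\<^sup>2 * W"
    if "\<And>S. S \<in> ?S \<Longrightarrow> \<bar>(\<Prod>i\<in>S. f i) $ m\<bar> \<le> w * W" "0 \<le> W" "w \<le> (real j + 1)\<^sup>2" for m w W
  proof -
    have "\<bar>es I j f $ m\<bar> \<le> (\<Sum>S\<in>?S. \<bar>(\<Prod>i\<in>S. f i) $ m\<bar>)"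
      unfolding es_def fps_sum_nth by (rule sum_abs)
    also have "\<dots> \<le> (\<Sum>S\<in>?S. (real j + 1)\<^sup>2 * W)"
      using that by (intro sum_mono) (meson mult_right_mono order_trans)
    also have "\<dots> = real (card ?S) * ((real j + 1)\<^sup>2 * W)" by simp
    also have "\<dots> \<le> 2 ^ card I * ((real j + 1)\<^sup>2 * W)" using cardS that by (intro mult_right_mono) auto
    finally show ?thesis by (simp add: mult.assoc)
  qed
  show "\<bar>es I j f $ 0\<bar> \<le> 2 ^ card I * (real j + 1)\<^sup>2 * \<tau> ^ j"
    by (rule bnd[of 0 1]) (use P j nn in auto)
  show "\<bar>es I j f $ Suc 0\<bar> \<le> 2 ^ card I * (real j + 1)\<^sup>2 * (\<tau> ^ (j - 1) * \<omega>)"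
    by (rule bnd[of "Suc 0" "real j"]) (use P j nn in \<open>auto simp: mult.assoc\<close>)
  show "\<bar>es I j f $ 2\<bar> \<le> 2 ^ card I * (real j + 1)\<^sup>2 * (\<tau> ^ (j - 1) * \<chi>)"
    by (rule bnd[of 2 "(real j)\<^sup>2"]) (use P j nn in \<open>auto simp: mult.assoc\<close>)
qed

text \<open>The weights \<tau>, \<omega>, \<chi> stand for the sizes of the three coefficients of
  the reciprocals of the large variables, and \<mu> for the size of the direction in the small
  variables. The last assumption is Cauchy-Schwarz for these sizes.\<close>

locale jet_weights =
  fixes \<Omega> :: "'p set" and \<tau> \<omega> \<chi> \<mu> :: "'p \<Rightarrow> real"
  assumes nonneg: "p \<in> \<Omega> \<Longrightarrow> 0 \<le> \<tau> p" "p \<in> \<Omega> \<Longrightarrow> 0 \<le> \<omega> p" "p \<in> \<Omega> \<Longrightarrow> 0 \<le> \<chi> p" "p \<in> \<Omega> \<Longrightarrow> 0 \<le> \<mu> p"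
    and \<tau>_le: "p \<in> \<Omega> \<Longrightarrow> \<tau> p \<le> 1"
    and \<omega>_le: "p \<in> \<Omega> \<Longrightarrow> (\<omega> p)\<^sup>2 \<le> \<tau> p * \<chi> p"
begin

text \<open>\<open>small_jet\<close> is the size of a function of the small variables alone,
  \<open>power_jet j\<close> that of a form of degree j in the reciprocals, and
  \<open>rest_jet\<close> that of a remainder of degree at least two in the reciprocals with
  coefficients depending on all variables.\<close>

abbreviation small_jet where "small_jet \<equiv> jetB \<Omega> (\<lambda>_. 1) \<mu> (\<lambda>p. (\<mu> p)\<^sup>2)"
abbreviation any_jet where "any_jet \<equiv> jetB \<Omega> (\<lambda>_. 1) (\<lambda>p. \<mu> p + \<omega> p) (\<lambda>p. (\<mu> p)\<^sup>2 + \<chi> p)"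
abbreviation power_jet where
  "power_jet j \<equiv> jetB \<Omega> (\<lambda>p. \<tau> p ^ j) (\<lambda>p. \<tau> p ^ (j - 1) * \<omega> p) (\<lambda>p. \<tau> p ^ (j - 1) * \<chi> p)"
abbreviation rest_jet where
  "rest_jet \<equiv> jetB \<Omega> (\<lambda>p. (\<tau> p)\<^sup>2) (\<lambda>p. \<tau> p * (\<omega> p + \<tau> p * \<mu> p)) (\<lambda>p. \<tau> p * (\<chi> p + \<tau> p * (\<mu> p)\<^sup>2))"

text \<open>The arithmetic-geometric mean inequality combined with \<omega>^2 <= \<tau> \<chi>. It
  lets products of a large and a small first derivative disappear in the last weight of
  \<open>rest_jet\<close>.\<close>

lemma \<omega>\<mu>_le: "p \<in> \<Omega> \<Longrightarrow> 2 * (\<omega> p * \<mu> p) \<le> \<chi> p + \<tau> p * (\<mu> p)\<^sup>2"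
proof (rule power2_le_imp_le)
  assume p: "p \<in> \<Omega>"
  have "(2 * (\<omega> p * \<mu> p))\<^sup>2 = 4 * ((\<omega> p)\<^sup>2 * (\<mu> p)\<^sup>2)" by (simp add: power_mult_distrib)
  also have "\<dots> \<le> 4 * (\<tau> p * \<chi> p * (\<mu> p)\<^sup>2)" using \<omega>_le[OF p] by (intro mult_left_mono mult_right_mono) auto
  also have "\<dots> \<le> (\<chi> p + \<tau> p * (\<mu> p)\<^sup>2)\<^sup>2"
    using zero_le_power2[of "\<chi> p - \<tau> p * (\<mu> p)\<^sup>2"] by (simp add: power2_eq_square algebra_simps)
  finally show "(2 * (\<omega> p * \<mu> p))\<^sup>2 \<le> (\<chi> p + \<tau> p * (\<mu> p)\<^sup>2)\<^sup>2" .
qed (use nonneg in auto)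

lemma \<omega>2_le: "p \<in> \<Omega> \<Longrightarrow> (\<omega> p)\<^sup>2 \<le> \<chi> p"
  using \<omega>_le[of p] mult_right_mono[OF \<tau>_le nonneg(3), of p p] by simp

lemma small_jet_imp_any: "small_jet f \<Longrightarrow> any_jet f"
  by (erule jetB_mono[where D = 1]) (use nonneg in auto)

lemma small_jet_mult: "small_jet f \<Longrightarrow> small_jet g \<Longrightarrow> small_jet (\<lambda>p. f p * g p)"
  by (erule (1) jetB_mult[where D = 3]) (use nonneg in \<open>auto simp: power2_eq_square\<close>)

lemma small_jet_inverse:
  "small_jet f \<Longrightarrow> 0 < c0 \<Longrightarrow> (\<And>p. p \<in> \<Omega> \<Longrightarrow> c0 \<le> f p $ 0) \<Longrightarrow> small_jet (\<lambda>p. inverse (f p))"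
  by (erule jetB_inverse[where D = 1]) (use nonneg in auto)

lemma any_sq_le: "p \<in> \<Omega> \<Longrightarrow> (\<mu> p + \<omega> p)\<^sup>2 \<le> 2 * ((\<mu> p)\<^sup>2 + \<chi> p)"
  using \<omega>2_le[of p] zero_le_power2[of "\<mu> p - \<omega> p"] by (simp add: power2_eq_square algebra_simps)

lemma any_jet_mult: "any_jet f \<Longrightarrow> any_jet g \<Longrightarrow> any_jet (\<lambda>p. f p * g p)"
proof (erule (1) jetB_mult[where D = 4])
  fix p assume p: "p \<in> \<Omega>"
  show "1 * ((\<mu> p)\<^sup>2 + \<chi> p) + (\<mu> p + \<omega> p) * (\<mu> p + \<omega> p) + ((\<mu> p)\<^sup>2 + \<chi> p) * 1 \<le> 4 * ((\<mu> p)\<^sup>2 + \<chi> p)"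
    using any_sq_le[OF p] by (simp add: power2_eq_square)
qed (use nonneg in auto)

lemma any_jet_inverse:
  "any_jet f \<Longrightarrow> 0 < c0 \<Longrightarrow> (\<And>p. p \<in> \<Omega> \<Longrightarrow> c0 \<le> f p $ 0) \<Longrightarrow> any_jet (\<lambda>p. inverse (f p))"
  by (erule jetB_inverse[where D = 2]) (use nonneg any_sq_le in auto)

lemma \<tau>_power_le: "p \<in> \<Omega> \<Longrightarrow> i \<le> j \<Longrightarrow> \<tau> p ^ j \<le> \<tau> p ^ i"
  using nonneg \<tau>_le by (intro power_decreasing) auto

lemma power_jet_mono:
  assumes "power_jet j f" "i \<le> j"
  shows "power_jet i f"
proof (rule jetB_mono[OF assms(1), where D = 1])
  fix p assume p: "p \<in> \<Omega>"
  have "\<tau> p ^ (j - 1) \<le> \<tau> p ^ (i - 1)" using assms(2) by (intro \<tau>_power_le[OF p]) auto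
  then show "\<tau> p ^ (j - 1) * \<omega> p \<le> 1 * (\<tau> p ^ (i - 1) * \<omega> p)" "\<tau> p ^ (j - 1) * \<chi> p \<le> 1 * (\<tau> p ^ (i - 1) * \<chi> p)"
    using nonneg[OF p] by (auto intro: mult_right_mono)
  show "\<tau> p ^ j \<le> 1 * \<tau> p ^ i" using \<tau>_power_le[OF p assms(2)] by simp
qed simp

lemma power_jet_imp_any: "power_jet j f \<Longrightarrow> any_jet f"
proof (erule jetB_mono[where D = 1])
  fix p assume p: "p \<in> \<Omega>"
  note n = nonneg[OF p]
  have t: "\<tau> p ^ i * v \<le> v" if "0 \<le> v" for i v
    using that n \<tau>_power_le[OF p, of 0 i] by (intro mult_left_le_one_le) auto
  show "\<tau> p ^ j \<le> 1 * 1" using \<tau>_power_le[OF p, of 0 j] by simp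
  show "\<tau> p ^ (j - 1) * \<omega> p \<le> 1 * (\<mu> p + \<omega> p)" using t[OF n(2), of "j - 1"] n(4) unfolding mult_1_left by linarith
  show "\<tau> p ^ (j - 1) * \<chi> p \<le> 1 * ((\<mu> p)\<^sup>2 + \<chi> p)" using t[OF n(3), of "j - 1"] zero_le_power2[of "\<mu> p"] unfolding mult_1_left by linarith
qed simp

lemma power_jet_mult:
  assumes "power_jet i f" "power_jet j g" "1 \<le> i" "1 \<le> j"
  shows "power_jet (i + j) (\<lambda>p. f p * g p)"
proof (rule jetB_mult[OF assms(1,2), where D = 3])
  fix p assume p: "p \<in> \<Omega>"
  obtain i' j' where ij: "i = Suc i'" "j = Suc j'" using assms(3,4) by (metis Suc_le_D One_nat_def)
  show "\<tau> p ^ i * \<tau> p ^ j \<le> 3 * \<tau> p ^ (i + j)" using nonneg(1)[OF p] by (simp add: power_add)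
  show "\<tau> p ^ i * (\<tau> p ^ (j - 1) * \<omega> p) + \<tau> p ^ (i - 1) * \<omega> p * \<tau> p ^ j \<le> 3 * (\<tau> p ^ (i + j - 1) * \<omega> p)"
    using nonneg[OF p] by (simp add: ij power_add)
  have "\<tau> p ^ i' * \<tau> p ^ j' * (\<omega> p)\<^sup>2 \<le> \<tau> p ^ i' * \<tau> p ^ j' * (\<tau> p * \<chi> p)"
    using nonneg[OF p] \<omega>_le[OF p] by (intro mult_left_mono) auto
  then show "\<tau> p ^ i * (\<tau> p ^ (j - 1) * \<chi> p) + \<tau> p ^ (i - 1) * \<omega> p * (\<tau> p ^ (j - 1) * \<omega> p) +
       \<tau> p ^ (i - 1) * \<chi> p * \<tau> p ^ j \<le> 3 * (\<tau> p ^ (i + j - 1) * \<chi> p)"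
    by (simp add: ij power_add power2_eq_square mult_ac)
qed simp

lemma power_jet_imp_rest:
  assumes "power_jet j f" "2 \<le> j" shows "rest_jet f"
  by (rule jetB_mono[OF power_jet_mono[OF assms], where D = 1]) (use nonneg in \<open>auto simp: distrib_left\<close>)

lemma rest_jet_mult_any:
  assumes "rest_jet f" "any_jet g"
  shows "rest_jet (\<lambda>p. f p * g p)"
proof (rule jetB_mult[OF assms, where D = 5])
  fix p assume p: "p \<in> \<Omega>"
  note n = nonneg[OF p]
  have t: "\<tau> p * y \<le> y" if "0 \<le> y" for y using that n(1) \<tau>_le[OF p] by (simp add: mult_left_le_one_le)
  show "(\<tau> p)\<^sup>2 * 1 \<le> 5 * (\<tau> p)\<^sup>2" by simp
  have "\<tau> p * (\<mu> p + \<omega> p) + (\<omega> p + \<tau> p * \<mu> p) \<le> 5 * (\<omega> p + \<tau> p * \<mu> p)"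
    using t[of "\<omega> p"] n mult_nonneg_nonneg[OF n(1,4)] unfolding distrib_left by linarith
  from mult_left_mono[OF this n(1)]
  show "(\<tau> p)\<^sup>2 * (\<mu> p + \<omega> p) + \<tau> p * (\<omega> p + \<tau> p * \<mu> p) * 1 \<le> 5 * (\<tau> p * (\<omega> p + \<tau> p * \<mu> p))"
    by (simp add: power2_eq_square algebra_simps)
  have "\<tau> p * ((\<mu> p)\<^sup>2 + \<chi> p) + (\<omega> p + \<tau> p * \<mu> p) * (\<mu> p + \<omega> p) + (\<chi> p + \<tau> p * (\<mu> p)\<^sup>2)
     = 2 * (\<tau> p * (\<mu> p)\<^sup>2) + (\<tau> p * \<chi> p) + \<omega> p * \<mu> p + (\<omega> p)\<^sup>2 + \<tau> p * (\<mu> p)\<^sup>2 + \<tau> p * (\<mu> p * \<omega> p) + \<chi> p"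
    by (simp add: power2_eq_square algebra_simps)
  also have "\<dots> \<le> 5 * (\<chi> p + \<tau> p * (\<mu> p)\<^sup>2)"
    using t[OF n(3)] t[OF mult_nonneg_nonneg[OF n(4,2)]] \<omega>\<mu>_le[OF p] \<omega>2_le[OF p] n(3)
      mult_nonneg_nonneg[OF n(1) zero_le_power2[of "\<mu> p"]] mult.commute[of "\<mu> p" "\<omega> p"]
    unfolding distrib_left by linarith
  finally have "\<tau> p * ((\<mu> p)\<^sup>2 + \<chi> p) + (\<omega> p + \<tau> p * \<mu> p) * (\<mu> p + \<omega> p) + (\<chi> p + \<tau> p * (\<mu> p)\<^sup>2)
    \<le> 5 * (\<chi> p + \<tau> p * (\<mu> p)\<^sup>2)" .
  from mult_left_mono[OF this n(1)]
  show "(\<tau> p)\<^sup>2 * ((\<mu> p)\<^sup>2 + \<chi> p) + \<tau> p * (\<omega> p + \<tau> p * \<mu> p) * (\<mu> p + \<omega> p) + \<tau> p * (\<chi> p + \<tau> p * (\<mu> p)\<^sup>2) * 1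
       \<le> 5 * (\<tau> p * (\<chi> p + \<tau> p * (\<mu> p)\<^sup>2))"
    by (simp add: power2_eq_square algebra_simps)
qed simp

text \<open>The quotient \<open>N / M\<close> is \<open>G - E\<^sub>1 w\<close> up to terms quadratic in the large variables' inverses.\<close>
lemma quotient_expansion:
  fixes E A B :: "nat \<Rightarrow> 'p \<Rightarrow> real fps" and s :: nat
  defines "N \<equiv> \<lambda>p. \<Sum>j\<le>s. E j p * A j p" and "M \<equiv> \<lambda>p. \<Sum>j\<le>s. E j p * B j p"
  defines "G \<equiv> \<lambda>p. A 0 p * inverse (B 0 p)"
  defines "w \<equiv> \<lambda>p. (G p * B 1 p - A 1 p) * inverse (B 0 p)"
  assumes s: "1 \<le> s" and E0: "\<And>p. p \<in> \<Omega> \<Longrightarrow> E 0 p = 1" and E: "\<And>j. 1 \<le> j \<Longrightarrow> power_jet j (E j)"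
    and A: "\<And>j. small_jet (A j)" and B: "\<And>j. small_jet (B j)"
    and c0: "0 < c0" "\<And>p. p \<in> \<Omega> \<Longrightarrow> c0 \<le> B 0 p $ 0" "\<And>p. p \<in> \<Omega> \<Longrightarrow> c0 \<le> M p $ 0"
  shows "small_jet G" "small_jet w" "rest_jet (\<lambda>p. N p * inverse (M p) - (G p - E 1 p * w p))"
proof -
  have iB: "small_jet (\<lambda>p. inverse (B 0 p))" by (rule small_jet_inverse[OF B c0(1,2)])
  show G: "small_jet G" unfolding G_def by (intro small_jet_mult A iB)
  show w: "small_jet w" unfolding w_def by (intro small_jet_mult jetB_diff A B G iB)
  have one: "any_jet (\<lambda>_. 1)" by (rule jetBI[of 1]) (use nonneg in auto)
  have "any_jet (E j)" for j
  proof (cases "j = 0")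
    case True
    then show ?thesis using one E0 jetB_cong[of \<Omega> "E 0" "\<lambda>_. 1"] by auto
  next
    case False
    then show ?thesis using power_jet_imp_any[OF E[of j]] by simp
  qed
  then have "any_jet M" unfolding M_def
    by (intro jetB_sum any_jet_mult small_jet_imp_any[OF B]) auto
  then have iM: "any_jet (\<lambda>p. inverse (M p))" by (rule any_jet_inverse[OF _ c0(1,3)])
  \<comment> \<open>X is the numerator N - G M + E_1 w M of the remainder. The terms without E
    cancel because A_0 = G B_0, and the term E_1 (A_1 - G B_1) cancels against E_1 w B_0, which is
    what determines w.\<close>
  define X where "X p = (\<Sum>j=2..s. E j p * (A j p - G p * B j p)) + (\<Sum>j=1..s. (E 1 p * E j p) * (w p * B j p))" for p
  have "rest_jet (\<lambda>p. E j p * (A j p - G p * B j p))" if "j \<in> {2..s}" for j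
    using that by (intro rest_jet_mult_any[OF power_jet_imp_rest[OF E]] small_jet_imp_any[OF jetB_diff] small_jet_mult A B G) auto
  moreover have "rest_jet (\<lambda>p. (E 1 p * E j p) * (w p * B j p))" if "j \<in> {1..s}" for j
    using that by (intro rest_jet_mult_any[OF power_jet_imp_rest[OF power_jet_mult[OF E E]]] small_jet_imp_any[OF small_jet_mult] w B) auto
  ultimately have "rest_jet X" unfolding X_def
    by (intro jetB_add jetB_sum) auto
  then have "rest_jet (\<lambda>p. X p * inverse (M p))" using iM by (rule rest_jet_mult_any)
  moreover have "N p * inverse (M p) - (G p - E 1 p * w p) = X p * inverse (M p)" if p: "p \<in> \<Omega>" for p
  proof -
    have split: "(\<Sum>j\<le>s. f j) = f 0 + (\<Sum>j=1..s. f j)" "(\<Sum>j=1..s. f j) = f 1 + (\<Sum>j=2..s. f j)" for f :: "nat \<Rightarrow> real fps"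
    proof -
      show "(\<Sum>j\<le>s. f j) = f 0 + (\<Sum>j=1..s. f j)"
        by (simp add: atMost_atLeast0 sum.atLeast_Suc_atMost)
      show "(\<Sum>j=1..s. f j) = f 1 + (\<Sum>j=2..s. f j)"
        using s by (simp add: sum.atLeast_Suc_atMost numeral_2_eq_2)
    qed
    have M0: "M p $ 0 \<noteq> 0" and B0: "B 0 p $ 0 \<noteq> 0" using c0(1) c0(2)[OF p] c0(3)[OF p] by linarith+
    have MM: "M p * inverse (M p) = 1" using M0 by (simp add: inverse_mult_eq_1')
    have G0: "A 0 p - G p * B 0 p = 0" unfolding G_def using B0 by (simp add: fps_mult_inverse_cancel)
    have w0: "w p * B 0 p = G p * B 1 p - A 1 p" unfolding w_def using B0 by (simp add: fps_mult_inverse_cancel)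
    have "N p - G p * M p = (\<Sum>j\<le>s. E j p * (A j p - G p * B j p))"
      by (simp add: N_def M_def sum_distrib_left sum_subtractf algebra_simps)
    also have "\<dots> = E 1 p * (A 1 p - G p * B 1 p) + (\<Sum>j=2..s. E j p * (A j p - G p * B j p))"
      unfolding split(1) split(2) G0 by simp
    also have "E 1 p * (A 1 p - G p * B 1 p) = - (E 1 p * (w p * B 0 p))" unfolding w0 by (simp add: algebra_simps)
    finally have 1: "N p - G p * M p = - (E 1 p * (w p * B 0 p)) + (\<Sum>j=2..s. E j p * (A j p - G p * B j p))" .
    have "M p = B 0 p + (\<Sum>j=1..s. E j p * B j p)" unfolding M_def split(1) using E0[OF p] by simp
    then have 2: "E 1 p * w p * M p = E 1 p * (w p * B 0 p) + (\<Sum>j=1..s. (E 1 p * E j p) * (w p * B j p))"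
      by (simp add: distrib_left sum_distrib_left mult_ac)
    have "X p = N p - G p * M p + E 1 p * w p * M p" unfolding 1 2 X_def by simp
    then have "X p * inverse (M p) = (N p - G p * M p + E 1 p * w p * M p) * inverse (M p)" by (simp only:)
    also have "\<dots> = N p * inverse (M p) - (G p - E 1 p * w p) * (M p * inverse (M p))"
      by (simp only: algebra_simps)
    finally show ?thesis unfolding MM by simp
  qed
  ultimately show "rest_jet (\<lambda>p. N p * inverse (M p) - (G p - E 1 p * w p))"
    using jetB_cong[of \<Omega> "\<lambda>p. N p * inverse (M p) - (G p - E 1 p * w p)" "\<lambda>p. X p * inverse (M p)"] by auto
qed

end

subsection \<open>Separating large and small variables\<close>

definition inv_line :: "(nat \<Rightarrow> real) \<Rightarrow> (nat \<Rightarrow> real) \<Rightarrow> nat \<Rightarrow> real fps" where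
  "inv_line x u i = inverse (line x u i)"

lemma inv_line_nth:
  assumes "x i \<noteq> 0"
  shows "inv_line x u i $ 0 = 1 / x i" "inv_line x u i $ Suc 0 = - u i / (x i)\<^sup>2" "inv_line x u i $ 2 = (u i)\<^sup>2 / (x i) ^ 3"
proof -
  have m: "inv_line x u i * line x u i = 1" using assms by (simp add: inv_line_def inverse_mult_eq_1)
  note nth = fps_quotient_nth[OF m, unfolded line_nth, OF assms]
  show 0: "inv_line x u i $ 0 = 1 / x i" using nth(1) by simp
  show 1: "inv_line x u i $ Suc 0 = - u i / (x i)\<^sup>2" unfolding nth(2) 0 by (simp add: power2_eq_square)
  show "inv_line x u i $ 2 = (u i)\<^sup>2 / (x i) ^ 3" unfolding nth(3) 1 by (simp add: power2_eq_square power3_eq_cube)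
qed

definition w\<tau> :: "nat \<Rightarrow> (nat \<Rightarrow> real) \<times> (nat \<Rightarrow> real) \<Rightarrow> real" where
  "w\<tau> s p = (\<Sum>i=1..s. 1 / fst p i)"
definition w\<omega> :: "nat \<Rightarrow> (nat \<Rightarrow> real) \<times> (nat \<Rightarrow> real) \<Rightarrow> real" where
  "w\<omega> s p = (\<Sum>i=1..s. \<bar>snd p i\<bar> / (fst p i)\<^sup>2)"
definition w\<chi> :: "nat \<Rightarrow> (nat \<Rightarrow> real) \<times> (nat \<Rightarrow> real) \<Rightarrow> real" where
  "w\<chi> s p = (\<Sum>i=1..s. (snd p i)\<^sup>2 / (fst p i) ^ 3)"
definition w\<mu> :: "nat \<Rightarrow> nat \<Rightarrow> (nat \<Rightarrow> real) \<times> (nat \<Rightarrow> real) \<Rightarrow> real" where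
  "w\<mu> s n p = sqrt (\<Sum>i=s+1..n. (snd p i)\<^sup>2)"

text \<open>The bound \<open>n\<close> for the large variables makes the sum \<open>w\<tau>\<close> of their inverses at most \<open>1\<close>.\<close>
definition gapdom :: "nat \<Rightarrow> nat \<Rightarrow> nat \<Rightarrow> real \<Rightarrow> ((nat \<Rightarrow> real) \<times> (nat \<Rightarrow> real)) set" where
  "gapdom s n k c = {(x, u). (\<forall>i\<in>{1..s}. real n \<le> x i) \<and> (\<forall>i\<in>{s+1..n}. 0 \<le> x i \<and> x i \<le> 1) \<and> (\<forall>i\<in>{s+1..k}. c \<le> x i)}"

lemma gapdom_large: "(x, u) \<in> gapdom s n k c \<Longrightarrow> s \<le> n \<Longrightarrow> i \<in> {1..s} \<Longrightarrow> real n \<le> x i \<and> 1 \<le> x i"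
  unfolding gapdom_def by (fastforce intro: order_trans[of 1 "real n"])

lemma gapdom_admissible:
  assumes "(x, u) \<in> gapdom s n k c" "k \<le> n"
  shows "admissible n c (k - s) {s+1..n} x"
  unfolding admissible_def using assms
  by (intro conjI exI[of _ "{s+1..k}"]) (auto simp: gapdom_def)

text \<open>The quantity |u|/x^2 is the geometric mean of 1/x and u^2/x^3.\<close>

lemma inverse_weights_Cauchy_Schwarz:
  fixes x u :: "nat \<Rightarrow> real"
  assumes x0: "\<And>i. i \<in> I \<Longrightarrow> 0 < x i"
  shows "(\<Sum>i\<in>I. \<bar>u i\<bar> / (x i)\<^sup>2)\<^sup>2 \<le> (\<Sum>i\<in>I. 1 / x i) * (\<Sum>i\<in>I. (u i)\<^sup>2 / (x i) ^ 3)"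
proof -
  have "\<bar>u i\<bar> / (x i)\<^sup>2 = sqrt (1 / x i) * sqrt ((u i)\<^sup>2 / (x i) ^ 3)" for i
  proof -
    have "sqrt (1 / x i) * sqrt ((u i)\<^sup>2 / (x i) ^ 3) = sqrt ((u i / (x i)\<^sup>2)\<^sup>2)"
      unfolding real_sqrt_mult[symmetric] by (simp add: power2_eq_square power3_eq_cube)
    then show ?thesis by (simp add: abs_divide)
  qed
  then have "(\<Sum>i\<in>I. \<bar>u i\<bar> / (x i)\<^sup>2)\<^sup>2 = (\<Sum>i\<in>I. sqrt (1 / x i) * sqrt ((u i)\<^sup>2 / (x i) ^ 3))\<^sup>2" by simp
  also have "\<dots> \<le> (\<Sum>i\<in>I. (sqrt (1 / x i))\<^sup>2) * (\<Sum>i\<in>I. (sqrt ((u i)\<^sup>2 / (x i) ^ 3))\<^sup>2)"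
    by (rule Cauchy_Schwarz_ineq_sum)
  also have "(\<Sum>i\<in>I. (sqrt (1 / x i))\<^sup>2) = (\<Sum>i\<in>I. 1 / x i)"
    by (intro sum.cong refl real_sqrt_pow2) (auto intro!: less_imp_le[OF x0])
  also have "(\<Sum>i\<in>I. (sqrt ((u i)\<^sup>2 / (x i) ^ 3))\<^sup>2) = (\<Sum>i\<in>I. (u i)\<^sup>2 / (x i) ^ 3)"
    by (intro sum.cong refl real_sqrt_pow2) (auto intro!: divide_nonneg_nonneg zero_le_power[OF less_imp_le[OF x0]])
  finally show ?thesis .
qed

lemma jet_weights_gapdom:
  assumes "1 \<le> s" "s \<le> n"
  shows "jet_weights (gapdom s n k c) (w\<tau> s) (w\<omega> s) (w\<chi> s) (w\<mu> s n)"
proof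
  fix p assume "p \<in> gapdom s n k c"
  then obtain x u where p: "p = (x, u)" and d: "(x, u) \<in> gapdom s n k c" by (cases p) auto
  have x: "real n \<le> x i" "1 \<le> x i" if "i \<in> {1..s}" for i using gapdom_large[OF d assms(2) that] by auto
  have x0: "0 < x i" if "i \<in> {1..s}" for i using x(2)[OF that] by linarith
  show "0 \<le> w\<tau> s p" "0 \<le> w\<omega> s p" "0 \<le> w\<chi> s p" "0 \<le> w\<mu> s n p"
    unfolding p w\<tau>_def w\<omega>_def w\<chi>_def w\<mu>_def
    by (auto intro!: sum_nonneg divide_nonneg_nonneg less_imp_le[OF x0] zero_le_power[OF less_imp_le[OF x0]])
  have "w\<tau> s p \<le> (\<Sum>i=1..s. 1 / real n)"
    unfolding p w\<tau>_def using x assms by (intro sum_mono) (auto intro!: divide_left_mono mult_pos_pos x0)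
  also have "\<dots> \<le> 1" using assms by (simp add: divide_le_eq)
  finally show "w\<tau> s p \<le> 1" .
  show "(w\<omega> s p)\<^sup>2 \<le> w\<tau> s p * w\<chi> s p"
    unfolding p w\<tau>_def w\<omega>_def w\<chi>_def fst_conv snd_conv by (rule inverse_weights_Cauchy_Schwarz) (rule x0)
qed

definition ejet :: "nat \<Rightarrow> nat \<Rightarrow> (nat \<Rightarrow> real) \<times> (nat \<Rightarrow> real) \<Rightarrow> real fps" where
  "ejet s j p = es {1..s} j (inv_line (fst p) (snd p))"

definition rjet :: "nat \<Rightarrow> nat \<Rightarrow> nat \<Rightarrow> (nat \<Rightarrow> real) \<times> (nat \<Rightarrow> real) \<Rightarrow> real fps" where
  "rjet s n j p = es {s+1..n} j (line (fst p) (snd p))"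

lemma ejet_0 [simp]: "ejet s 0 p = 1"
  by (simp add: ejet_def)

lemma ejet_1_nth:
  assumes "(x, u) \<in> gapdom s n k c" "s \<le> n"
  shows "ejet s 1 (x, u) $ 0 = w\<tau> s (x, u)" "ejet s 1 (x, u) $ Suc 0 = - (\<Sum>i=1..s. u i / (x i)\<^sup>2)"
    "ejet s 1 (x, u) $ 2 = w\<chi> s (x, u)"
proof -
  have x: "x i \<noteq> 0" if "i \<in> {1..s}" for i using gapdom_large[OF assms that] by auto
  have "ejet s 1 (x, u) = (\<Sum>i=1..s. inv_line x u i)" by (simp add: ejet_def es_1)
  then show "ejet s 1 (x, u) $ 0 = w\<tau> s (x, u)" "ejet s 1 (x, u) $ Suc 0 = - (\<Sum>i=1..s. u i / (x i)\<^sup>2)"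
    "ejet s 1 (x, u) $ 2 = w\<chi> s (x, u)"
    using x by (simp_all add: fps_sum_nth inv_line_nth w\<tau>_def w\<chi>_def sum_negf)
qed

lemma ejet_power_jet:
  assumes "1 \<le> s" "s \<le> n"
  shows "jet_weights.power_jet (gapdom s n k c) (w\<tau> s) (w\<omega> s) (w\<chi> s) j (ejet s j)"
proof -
  interpret jet_weights "gapdom s n k c" "w\<tau> s" "w\<omega> s" "w\<chi> s" "w\<mu> s n"
    by (rule jet_weights_gapdom[OF assms])
  have b: "\<bar>ejet s j p $ 0\<bar> \<le> 2 ^ s * (real j + 1)\<^sup>2 * w\<tau> s p ^ j"
    "\<bar>ejet s j p $ Suc 0\<bar> \<le> 2 ^ s * (real j + 1)\<^sup>2 * (w\<tau> s p ^ (j - 1) * w\<omega> s p)"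
    "\<bar>ejet s j p $ 2\<bar> \<le> 2 ^ s * (real j + 1)\<^sup>2 * (w\<tau> s p ^ (j - 1) * w\<chi> s p)" if "p \<in> gapdom s n k c" for p
  proof -
    obtain x u where p: "p = (x, u)" and d: "(x, u) \<in> gapdom s n k c" using \<open>p \<in> _\<close> by (cases p) auto
    have x: "1 \<le> x i" if "i \<in> {1..s}" for i using gapdom_large[OF d assms(2) that] by auto
    have nn: "0 \<le> 1 / x i" "0 \<le> \<bar>u i\<bar> / (x i)\<^sup>2" "0 \<le> (u i)\<^sup>2 / (x i) ^ 3" if "i \<in> {1..s}" for i
      using x[OF that] by auto
    have "\<forall>i\<in>{1..s}. \<bar>inv_line x u i $ 0\<bar> \<le> w\<tau> s p \<and> \<bar>inv_line x u i $ Suc 0\<bar> \<le> w\<omega> s p \<and> \<bar>inv_line x u i $ 2\<bar> \<le> w\<chi> s p"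
    proof
      fix i assume i: "i \<in> {1..s}"
      have xi: "x i \<noteq> 0" using x[OF i] by auto
      have "1 / x i \<le> w\<tau> s p" unfolding p w\<tau>_def fst_conv by (rule member_le_sum[OF i]) (use nn in auto)
      moreover have "\<bar>u i\<bar> / (x i)\<^sup>2 \<le> w\<omega> s p" unfolding p w\<omega>_def fst_conv snd_conv by (rule member_le_sum[OF i]) (use nn in auto)
      moreover have "(u i)\<^sup>2 / (x i) ^ 3 \<le> w\<chi> s p" unfolding p w\<chi>_def fst_conv snd_conv by (rule member_le_sum[OF i]) (use nn in auto)
      ultimately show "\<bar>inv_line x u i $ 0\<bar> \<le> w\<tau> s p \<and> \<bar>inv_line x u i $ Suc 0\<bar> \<le> w\<omega> s p \<and> \<bar>inv_line x u i $ 2\<bar> \<le> w\<chi> s p"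
        unfolding inv_line_nth[of x i, OF xi] using nn[OF i] x[OF i] by (simp add: abs_divide)
    qed
    from es_jet_bound[OF _ this nonneg(1,2,3)[OF that] \<omega>_le[OF that], of j]
    show "\<bar>ejet s j p $ 0\<bar> \<le> 2 ^ s * (real j + 1)\<^sup>2 * w\<tau> s p ^ j"
      "\<bar>ejet s j p $ Suc 0\<bar> \<le> 2 ^ s * (real j + 1)\<^sup>2 * (w\<tau> s p ^ (j - 1) * w\<omega> s p)"
      "\<bar>ejet s j p $ 2\<bar> \<le> 2 ^ s * (real j + 1)\<^sup>2 * (w\<tau> s p ^ (j - 1) * w\<chi> s p)"
      unfolding p ejet_def by simp_all
  qed
  show ?thesis by (rule jetBI[of "2 ^ s * (real j + 1)\<^sup>2"]) (use b in auto)
qed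

lemma rjet_small_jet:
  assumes "1 \<le> s" "s \<le> n"
  shows "jet_weights.small_jet (gapdom s n k c) (w\<mu> s n) (rjet s n j)"
proof -
  have b: "\<bar>rjet s n j p $ 0\<bar> \<le> 2 ^ (n - s) * (real j + 1)\<^sup>2 * 1"
    "\<bar>rjet s n j p $ Suc 0\<bar> \<le> 2 ^ (n - s) * (real j + 1)\<^sup>2 * w\<mu> s n p"
    "\<bar>rjet s n j p $ 2\<bar> \<le> 2 ^ (n - s) * (real j + 1)\<^sup>2 * (w\<mu> s n p)\<^sup>2" if "p \<in> gapdom s n k c" for p
  proof -
    obtain x u where p: "p = (x, u)" and d: "(x, u) \<in> gapdom s n k c" using \<open>p \<in> _\<close> by (cases p) auto
    have mu: "0 \<le> w\<mu> s n p" unfolding w\<mu>_def by (intro real_sqrt_ge_zero sum_nonneg) auto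
    have "\<forall>i\<in>{s+1..n}. \<bar>line x u i $ 0\<bar> \<le> 1 \<and> \<bar>line x u i $ Suc 0\<bar> \<le> w\<mu> s n p \<and> \<bar>line x u i $ 2\<bar> \<le> (w\<mu> s n p)\<^sup>2"
    proof
      fix i assume i: "i \<in> {s+1..n}"
      have "(u i)\<^sup>2 \<le> (\<Sum>i=s+1..n. (u i)\<^sup>2)" by (rule member_le_sum[OF i]) auto
      then have "\<bar>u i\<bar> \<le> w\<mu> s n p" unfolding p w\<mu>_def snd_conv by (intro real_le_rsqrt) simp
      then show "\<bar>line x u i $ 0\<bar> \<le> 1 \<and> \<bar>line x u i $ Suc 0\<bar> \<le> w\<mu> s n p \<and> \<bar>line x u i $ 2\<bar> \<le> (w\<mu> s n p)\<^sup>2"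
        using d i by (auto simp: gapdom_def)
    qed
    from es_jet_bound[OF _ this _ mu, of j]
    show "\<bar>rjet s n j p $ 0\<bar> \<le> 2 ^ (n - s) * (real j + 1)\<^sup>2 * 1"
      "\<bar>rjet s n j p $ Suc 0\<bar> \<le> 2 ^ (n - s) * (real j + 1)\<^sup>2 * w\<mu> s n p"
      "\<bar>rjet s n j p $ 2\<bar> \<le> 2 ^ (n - s) * (real j + 1)\<^sup>2 * (w\<mu> s n p)\<^sup>2"
      unfolding p rjet_def by simp_all
  qed
  show ?thesis by (rule jetBI[of "2 ^ (n - s) * (real j + 1)\<^sup>2"]) (use b in auto)
qed

lemma es_line_split:
  assumes "(x, u) \<in> gapdom s n k c" "1 \<le> s" "s \<le> n"
  shows "es {1..n} (s + a) (line x u) = (\<Prod>i=1..s. line x u i) * (\<Sum>j\<le>s. ejet s j (x, u) * rjet s n (a + j) (x, u))"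
    and "s = Suc l \<Longrightarrow> es {1..n} l (line x u) = (\<Prod>i=1..s. line x u i) * (\<Sum>j=1..s. ejet s j (x, u) * rjet s n (j - 1) (x, u))"
    and "(\<Prod>i=1..s. line x u i) $ 0 \<noteq> 0"
proof -
  have x: "x i \<noteq> 0" if "i \<in> {1..s}" for i using gapdom_large[OF assms(1,3) that] by auto
  have inv: "line x u i * inv_line x u i = 1" if "i \<in> {1..s}" for i
    using x[OF that] by (simp add: inv_line_def inverse_mult_eq_1')
  have un: "{1..s} \<union> {s+1..n} = {1..n}" using assms by auto
  show "es {1..n} (s + a) (line x u) = (\<Prod>i=1..s. line x u i) * (\<Sum>j\<le>s. ejet s j (x, u) * rjet s n (a + j) (x, u))"
    using es_split_large[of "{1..s}" "{s+1..n}" "line x u" "inv_line x u" a] inv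
    unfolding un by (simp add: ejet_def rjet_def)
  show "es {1..n} l (line x u) = (\<Prod>i=1..s. line x u i) * (\<Sum>j=1..s. ejet s j (x, u) * rjet s n (j - 1) (x, u))" if "s = Suc l"
    using es_split_large_pred[of "{1..s}" "{s+1..n}" "line x u" "inv_line x u" l] inv that
    unfolding un by (simp add: ejet_def rjet_def)
  show "(\<Prod>i=1..s. line x u i) $ 0 \<noteq> 0" using x by (simp add: fps_prod_nth_0)
qed

lemma fps_cancel_left:
  fixes P N M :: "real fps"
  assumes "P $ 0 \<noteq> 0"
  shows "P * N * inverse (P * M) = N * inverse M"
proof -
  have "P * N * inverse (P * M) = (P * inverse P) * (N * inverse M)" by (simp add: fps_inverse_mult mult_ac)
  also have "P * inverse P = 1" using assms by (simp add: inverse_mult_eq_1')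
  finally show ?thesis by simp
qed

text \<open>The value of the quotient when the reciprocals of the large variables vanish.\<close>

definition limq :: "nat \<Rightarrow> nat \<Rightarrow> nat \<Rightarrow> nat \<Rightarrow> (nat \<Rightarrow> real) \<times> (nat \<Rightarrow> real) \<Rightarrow> real fps" where
  "limq s n a b p = rjet s n a p * inverse (rjet s n b p)"

text \<open>Minus the derivative of the quotient with respect to the sum of the reciprocals. With
  this sign its value is a Newton gap over a square, see \<open>corrq_nth_0\<close>.\<close>

definition corrq :: "nat \<Rightarrow> nat \<Rightarrow> nat \<Rightarrow> nat \<Rightarrow> (nat \<Rightarrow> real) \<times> (nat \<Rightarrow> real) \<Rightarrow> real fps" where
  "corrq s n a b p = (limq s n a b p * rjet s n (Suc b) p - rjet s n (Suc a) p) * inverse (rjet s n b p)"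

lemma ejet_0_nonneg: "(x, u) \<in> gapdom s n k c \<Longrightarrow> s \<le> n \<Longrightarrow> 0 \<le> ejet s j (x, u) $ 0"
proof -
  assume d: "(x, u) \<in> gapdom s n k c" "s \<le> n"
  have "0 \<le> inv_line x u i $ 0" if "i \<in> {1..s}" for i
  proof -
    have "1 \<le> x i" using gapdom_large[OF d that] by simp
    then show ?thesis by (subst inv_line_nth) auto
  qed
  then show ?thesis by (auto simp: ejet_def es_nth_0 intro: es_nonneg)
qed

lemma rjet_0_nonneg: "(x, u) \<in> gapdom s n k c \<Longrightarrow> 0 \<le> rjet s n j (x, u) $ 0"
  by (auto simp: rjet_def es_nth_0 gapdom_def intro!: es_nonneg)

text \<open>The last three conjuncts compare F with G - E_1 w coefficient by coefficient, where E_1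
  has the coefficients \<tau>, minus the sum of u_i / x_i^2, and \<chi>. The second coefficient of G
  is kept exactly because its sign matters.\<close>

definition expansion_bounds :: "real \<Rightarrow> nat \<Rightarrow> nat \<Rightarrow> real fps \<Rightarrow> real fps \<Rightarrow> real fps \<Rightarrow> (nat \<Rightarrow> real) \<times> (nat \<Rightarrow> real) \<Rightarrow> bool" where
  "expansion_bounds C s n G w F p \<longleftrightarrow>
    \<bar>G $ 0\<bar> \<le> C \<and> \<bar>G $ Suc 0\<bar> \<le> C * w\<mu> s n p \<and> \<bar>w $ 0\<bar> \<le> C \<and> \<bar>w $ Suc 0\<bar> \<le> C * w\<mu> s n p \<and> \<bar>w $ 2\<bar> \<le> C * (w\<mu> s n p)\<^sup>2 \<and>
    \<bar>F $ 0 - (G $ 0 - w\<tau> s p * w $ 0)\<bar> \<le> C * (w\<tau> s p)\<^sup>2 \<and>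
    \<bar>F $ Suc 0 - (G $ Suc 0 + (\<Sum>i=1..s. snd p i / (fst p i)\<^sup>2) * w $ 0 - w\<tau> s p * w $ Suc 0)\<bar>
      \<le> C * (w\<tau> s p * (w\<omega> s p + w\<tau> s p * w\<mu> s n p)) \<and>
    \<bar>F $ 2 - (G $ 2 - w\<chi> s p * w $ 0 + (\<Sum>i=1..s. snd p i / (fst p i)\<^sup>2) * w $ Suc 0 - w\<tau> s p * w $ 2)\<bar>
      \<le> C * (w\<tau> s p * (w\<chi> s p + w\<tau> s p * (w\<mu> s n p)\<^sup>2))"

lemma qjet_expansion:
  assumes "1 \<le> s" "s \<le> n" "s + a \<le> n" "b < a" "0 < c"
  defines "\<Omega> \<equiv> gapdom s n (s + a) c"
  obtains C where "0 \<le> C" "\<And>x u. (x, u) \<in> \<Omega> \<Longrightarrow>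
    expansion_bounds C s n (limq s n a b (x, u)) (corrq s n a b (x, u)) (qjet n (s + a) (s + b) x u) (x, u)"
proof -
  interpret jet_weights \<Omega> "w\<tau> s" "w\<omega> s" "w\<chi> s" "w\<mu> s n"
    unfolding \<Omega>_def by (rule jet_weights_gapdom[OF assms(1,2)])
  define E where "E j = ejet s j" for j
  define A B where "A j = rjet s n (a + j)" and "B j = rjet s n (b + j)" for j
  have E: "power_jet j (E j)" for j unfolding E_def \<Omega>_def by (rule ejet_power_jet[OF assms(1,2)])
  have A: "small_jet (A j)" and B: "small_jet (B j)" for j
    unfolding A_def B_def \<Omega>_def by (rule rjet_small_jet[OF assms(1,2)])+
  have c0: "0 < c ^ b" using assms by simp
  have B0: "c ^ b \<le> B 0 p $ 0" if "p \<in> \<Omega>" for p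
  proof -
    obtain x u where p: "p = (x, u)" by (cases p)
    have "admissible n c a {s+1..n} x" using gapdom_admissible[of x u s n "s + a" c] that assms p by (simp add: \<Omega>_def)
    then show ?thesis using admissible_es_ge[of n c a "{s+1..n}" x b] assms by (simp add: p B_def rjet_def)
  qed
  \<comment> \<open>All terms of the denominator are nonnegative, so its term j = 0 alone bounds it
    from below.\<close>
  have M0: "c ^ b \<le> (\<Sum>j\<le>s. E j p * B j p) $ 0" if "p \<in> \<Omega>" for p
  proof -
    obtain x u where p: "p = (x, u)" by (cases p)
    have d: "(x, u) \<in> gapdom s n (s + a) c" using that p by (simp add: \<Omega>_def)
    have "c ^ b \<le> E 0 p $ 0 * B 0 p $ 0" using B0[OF that] by (simp add: E_def)
    also have "\<dots> \<le> (\<Sum>j\<le>s. E j p $ 0 * B j p $ 0)"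
      by (rule member_le_sum) (use ejet_0_nonneg[OF d assms(2)] rjet_0_nonneg[OF d] p in \<open>auto simp: E_def B_def\<close>)
    finally show ?thesis by (simp add: fps_sum_nth)
  qed
  note exp = quotient_expansion[of s E A B "c ^ b", OF assms(1) _ E A B c0 B0 M0]
  have lim: "limq s n a b = (\<lambda>p. A 0 p * inverse (B 0 p))" by (auto simp: limq_def A_def B_def)
  have cor: "corrq s n a b = (\<lambda>p. (limq s n a b p * B 1 p - A 1 p) * inverse (B 0 p))"
    by (auto simp: corrq_def A_def B_def)
  have G: "small_jet (limq s n a b)" unfolding lim by (rule exp(1)) (auto simp: E_def)
  have w: "small_jet (corrq s n a b)" unfolding cor lim by (rule exp(2)) (auto simp: E_def)
  define rest where "rest p = (\<Sum>j\<le>s. E j p * A j p) * inverse (\<Sum>j\<le>s. E j p * B j p) - (limq s n a b p - E 1 p * corrq s n a b p)" for p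
  have r: "rest_jet rest" unfolding rest_def cor lim by (rule exp(3)) (auto simp: E_def)
  obtain C1 where C1: "0 \<le> C1" "\<And>p. p \<in> \<Omega> \<Longrightarrow> \<bar>limq s n a b p $ 0\<bar> \<le> C1 * 1"
    "\<And>p. p \<in> \<Omega> \<Longrightarrow> \<bar>limq s n a b p $ Suc 0\<bar> \<le> C1 * w\<mu> s n p" "\<And>p. p \<in> \<Omega> \<Longrightarrow> \<bar>limq s n a b p $ 2\<bar> \<le> C1 * (w\<mu> s n p)\<^sup>2"
    using jetBE[OF G] by blast
  obtain C2 where C2: "0 \<le> C2" "\<And>p. p \<in> \<Omega> \<Longrightarrow> \<bar>corrq s n a b p $ 0\<bar> \<le> C2 * 1"
    "\<And>p. p \<in> \<Omega> \<Longrightarrow> \<bar>corrq s n a b p $ Suc 0\<bar> \<le> C2 * w\<mu> s n p" "\<And>p. p \<in> \<Omega> \<Longrightarrow> \<bar>corrq s n a b p $ 2\<bar> \<le> C2 * (w\<mu> s n p)\<^sup>2"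
    using jetBE[OF w] by blast
  obtain C3 where C3: "0 \<le> C3" "\<And>p. p \<in> \<Omega> \<Longrightarrow> \<bar>rest p $ 0\<bar> \<le> C3 * (w\<tau> s p)\<^sup>2"
    "\<And>p. p \<in> \<Omega> \<Longrightarrow> \<bar>rest p $ Suc 0\<bar> \<le> C3 * (w\<tau> s p * (w\<omega> s p + w\<tau> s p * w\<mu> s n p))"
    "\<And>p. p \<in> \<Omega> \<Longrightarrow> \<bar>rest p $ 2\<bar> \<le> C3 * (w\<tau> s p * (w\<chi> s p + w\<tau> s p * (w\<mu> s n p)\<^sup>2))"
    using jetBE[OF r] by blast
  define C where "C = C1 + C2 + C3"
  have C: "0 \<le> C" "C1 \<le> C" "C2 \<le> C" "C3 \<le> C" using C1(1) C2(1) C3(1) by (auto simp: C_def)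
  have "expansion_bounds C s n G w F (x, u)"
    if d: "(x, u) \<in> \<Omega>" and G: "G = limq s n a b (x, u)" and w: "w = corrq s n a b (x, u)"
      and F: "F = qjet n (s + a) (s + b) x u" for x u G w F
    unfolding expansion_bounds_def fst_conv snd_conv
  proof (intro conjI)
    have d': "(x, u) \<in> gapdom s n (s + a) c" using d by (simp add: \<Omega>_def)
    have up: "y \<le> C * v" if "y \<le> D * v" "D \<le> C" "0 \<le> v" for y D v
      using that mult_right_mono[of D C v] by linarith
    note n = nonneg[OF d]
    have "F = (\<Sum>j\<le>s. E j (x, u) * A j (x, u)) * inverse (\<Sum>j\<le>s. E j (x, u) * B j (x, u))"
      unfolding F qjet_def es_line_split(1)[OF d' assms(1,2)] E_def A_def B_def
      by (rule fps_cancel_left[OF es_line_split(3)[OF d' assms(1,2)]])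
    then have Fr: "F = G - E 1 (x, u) * w + rest (x, u)" by (simp add: rest_def G w)
    have e1: "E 1 (x, u) $ 0 = w\<tau> s (x, u)" "E 1 (x, u) $ Suc 0 = - (\<Sum>i=1..s. u i / (x i)\<^sup>2)"
      "E 1 (x, u) $ 2 = w\<chi> s (x, u)"
      unfolding E_def by (rule ejet_1_nth[OF d' assms(2)])+
    have "\<bar>G $ 0\<bar> \<le> C * 1" unfolding G by (rule up[OF C1(2)[OF d] C(2)]) simp
    then show "\<bar>G $ 0\<bar> \<le> C" by simp
    show "\<bar>G $ Suc 0\<bar> \<le> C * w\<mu> s n (x, u)" unfolding G by (rule up[OF C1(3)[OF d] C(2)]) (use n in auto)
    have "\<bar>w $ 0\<bar> \<le> C * 1" unfolding w by (rule up[OF C2(2)[OF d] C(3)]) simp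
    then show "\<bar>w $ 0\<bar> \<le> C" by simp
    show "\<bar>w $ Suc 0\<bar> \<le> C * w\<mu> s n (x, u)" unfolding w by (rule up[OF C2(3)[OF d] C(3)]) (use n in auto)
    show "\<bar>w $ 2\<bar> \<le> C * (w\<mu> s n (x, u))\<^sup>2" unfolding w by (rule up[OF C2(4)[OF d] C(3)]) (use n in auto)
    have "F $ 0 - (G $ 0 - w\<tau> s (x, u) * w $ 0) = rest (x, u) $ 0"
      by (simp add: Fr e1[unfolded One_nat_def])
    then show "\<bar>F $ 0 - (G $ 0 - w\<tau> s (x, u) * w $ 0)\<bar> \<le> C * (w\<tau> s (x, u))\<^sup>2"
      using up[OF C3(2)[OF d] C(4)] n by simp
    have "F $ Suc 0 - (G $ Suc 0 + (\<Sum>i=1..s. u i / (x i)\<^sup>2) * w $ 0 - w\<tau> s (x, u) * w $ Suc 0) = rest (x, u) $ Suc 0"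
      unfolding Fr fps_add_nth fps_sub_nth fps_mult_nth_Suc_0 e1 by (simp add: algebra_simps)
    then show "\<bar>F $ Suc 0 - (G $ Suc 0 + (\<Sum>i=1..s. u i / (x i)\<^sup>2) * w $ 0 - w\<tau> s (x, u) * w $ Suc 0)\<bar>
      \<le> C * (w\<tau> s (x, u) * (w\<omega> s (x, u) + w\<tau> s (x, u) * w\<mu> s n (x, u)))"
      using up[OF C3(3)[OF d] C(4)] n by simp
    have "F $ 2 - (G $ 2 - w\<chi> s (x, u) * w $ 0 + (\<Sum>i=1..s. u i / (x i)\<^sup>2) * w $ Suc 0 - w\<tau> s (x, u) * w $ 2) = rest (x, u) $ 2"
      unfolding Fr fps_add_nth fps_sub_nth fps_mult_nth_2 e1 by (simp add: algebra_simps)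
    then show "\<bar>F $ 2 - (G $ 2 - w\<chi> s (x, u) * w $ 0 + (\<Sum>i=1..s. u i / (x i)\<^sup>2) * w $ Suc 0 - w\<tau> s (x, u) * w $ 2)\<bar>
      \<le> C * (w\<tau> s (x, u) * (w\<chi> s (x, u) + w\<tau> s (x, u) * (w\<mu> s n (x, u))\<^sup>2))"
      using up[OF C3(4)[OF d] C(4)] n by simp
  qed
  then show ?thesis using that[of C] C(1) by blast
qed

subsection \<open>At least two comparable small variables\<close>

text \<open>The entries give \<tau> <= 1, keep F0 within a factor 2 of G0, and let c/2 dominate the
  collected error constant in \<open>comparable_numeric\<close>.\<close>

definition threshold_comparable :: "real \<Rightarrow> real \<Rightarrow> real" where
  "threshold_comparable C c = min 1 (min (c / (4 * C + 1)) (c / (2 * (66 * C\<^sup>2 / c + 4 * C + 2 * C) + 1)))"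

lemma threshold_comparable_pos: "0 \<le> C \<Longrightarrow> 0 < c \<Longrightarrow> 0 < threshold_comparable C c"
  by (auto simp: threshold_comparable_def intro!: divide_pos_pos add_nonneg_pos)

text \<open>The curvature c \<mu>^2 of the limit pays for the mixed term Z w1, whose \<chi>-part
  carries a factor \<tau>. The main term is 2 \<chi> w0, and the half that exceeds 3/2 pays for the
  errors in \<chi>.\<close>

lemma comparable_numeric:
  fixes C c \<tau> \<omega> \<chi> \<mu> :: real
  assumes C: "0 \<le> C" "0 < c"
    and h: "0 \<le> \<tau>" "\<tau> \<le> threshold_comparable C c" "0 \<le> \<omega>" "0 \<le> \<chi>" "0 \<le> \<mu>" "\<omega>\<^sup>2 \<le> \<tau> * \<chi>"
      "\<bar>w0\<bar> \<le> C" "\<bar>w1\<bar> \<le> C * \<mu>" "\<bar>w2\<bar> \<le> C * \<mu>\<^sup>2" "\<bar>Z\<bar> \<le> \<omega>" "c \<le> w0" "c \<le> G0"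
    and F0: "\<bar>F0 - (G0 - \<tau> * w0)\<bar> \<le> C * \<tau>\<^sup>2"
    and F1: "\<bar>F1 - (G1 + Z * w0 - \<tau> * w1)\<bar> \<le> C * (\<tau> * (\<omega> + \<tau> * \<mu>))"
    and F2: "\<bar>F2 - (G2 - \<chi> * w0 + Z * w1 - \<tau> * w2)\<bar> \<le> C * (\<tau> * (\<chi> + \<tau> * \<mu>\<^sup>2))"
    and G: "c * \<mu>\<^sup>2 \<le> 4 * G1\<^sup>2 / G0 - 2 * G2"
  shows "(3 / 2) * (\<chi> * (w0 + C * \<tau>)) \<le> 16 * F1\<^sup>2 / F0 - 2 * F2"
proof -
  \<comment> \<open>The 64 comes from replacing G1 by F1, the 2 from the mixed term Z w1, and 4 C
    from \<tau> w2 together with the remainder of F2.\<close>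
  define D where "D = 66 * C\<^sup>2 / c + 4 * C"
  have D: "0 \<le> D" using C by (simp add: D_def)
  have \<tau>1: "\<tau> \<le> 1" and \<tau>2: "\<tau> * (4 * C + 1) \<le> c" and \<tau>3: "\<tau> * (2 * (D + 2 * C) + 1) \<le> c"
    using h(2) C D unfolding threshold_comparable_def D_def[symmetric] by (auto simp: pos_le_divide_eq)
  have \<tau>2': "4 * (C * \<tau>) \<le> c" using \<tau>2 h(1) by (simp add: algebra_simps)
  have t: "\<tau> * y \<le> y" if "0 \<le> y" for y using that h(1) \<tau>1 by (simp add: mult_left_le_one_le)
  define e where "e = \<chi> + \<mu>\<^sup>2"
  have e: "0 \<le> e" "\<mu>\<^sup>2 \<le> e" "\<chi> \<le> e" using h by (auto simp: e_def)
  have "C * \<tau>\<^sup>2 \<le> C * \<tau>" using t[OF h(1)] C by (auto simp: power2_eq_square intro: mult_left_mono)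
  moreover have "\<bar>\<tau> * w0\<bar> \<le> C * \<tau>" using h mult_left_mono[of "\<bar>w0\<bar>" C \<tau>] by (simp add: abs_mult mult.commute)
  ultimately have "\<bar>F0 - G0\<bar> \<le> 2 * (C * \<tau>)" using F0 by linarith
  then have F0': "0 < F0" "F0 \<le> 2 * G0" using \<tau>2' h(12) C by linarith+
  define v where "v = \<omega> + \<tau> * \<mu>"
  have v: "0 \<le> v" using h by (simp add: v_def)
  have "\<bar>Z * w0\<bar> \<le> C * \<omega>" using h C mult_mono[of "\<bar>Z\<bar>" \<omega> "\<bar>w0\<bar>" C] by (simp add: abs_mult mult.commute)
  moreover have "\<bar>\<tau> * w1\<bar> \<le> C * (\<tau> * \<mu>)"
    using h mult_left_mono[of "\<bar>w1\<bar>" "C * \<mu>" \<tau>] by (simp add: abs_mult mult_ac)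
  moreover have "C * (\<tau> * (\<omega> + \<tau> * \<mu>)) \<le> C * v" using t[OF v] C unfolding v_def by (intro mult_left_mono) auto
  ultimately have "\<bar>F1 - G1\<bar> \<le> 2 * C * v" using F1 by (simp add: v_def algebra_simps)
  then have "(F1 - G1)\<^sup>2 \<le> (2 * C * v)\<^sup>2" using abs_le_square_iff[of "F1 - G1" "2 * C * v"] C v by simp
  also have "\<dots> = 4 * C\<^sup>2 * v\<^sup>2" by (simp add: power_mult_distrib)
  also have "v\<^sup>2 \<le> 2 * (\<tau> * e)"
  proof -
    have "v\<^sup>2 \<le> 2 * \<omega>\<^sup>2 + 2 * (\<tau> * \<mu>)\<^sup>2" unfolding v_def by (rule square_sum_le)
    also have "(\<tau> * \<mu>)\<^sup>2 \<le> \<tau> * \<mu>\<^sup>2"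
      using t[of "\<tau> * \<mu>\<^sup>2"] h(1,5) by (simp add: power2_eq_square mult_ac)
    finally show ?thesis using h(6) by (simp add: e_def algebra_simps)
  qed
  finally have e1: "(F1 - G1)\<^sup>2 \<le> 8 * C\<^sup>2 * (\<tau> * e)" using C by (simp add: mult_left_mono)
  have G0: "0 < G0" using h(12) C by linarith
  have "G1\<^sup>2 \<le> 2 * F1\<^sup>2 + 2 * (F1 - G1)\<^sup>2" using square_diff_le[of F1 "F1 - G1"] by simp
  then have "4 * G1\<^sup>2 / G0 \<le> (8 * F1\<^sup>2 + 64 * C\<^sup>2 * (\<tau> * e)) / G0"
    using e1 G0 by (intro divide_right_mono) auto
  also have "\<dots> = 8 * F1\<^sup>2 / G0 + 64 * C\<^sup>2 * (\<tau> * e) / G0" by (simp add: add_divide_distrib)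
  also have "8 * F1\<^sup>2 / G0 \<le> 16 * F1\<^sup>2 / F0"
    using F0' G0 by (simp add: field_simps) (metis mult_right_mono zero_le_power2 mult.commute mult.assoc)
  also have "64 * C\<^sup>2 * (\<tau> * e) / G0 \<le> 64 * C\<^sup>2 * (\<tau> * e) / c"
    using h e C by (intro divide_left_mono) (auto intro!: mult_pos_pos G0)
  finally have s1: "4 * G1\<^sup>2 / G0 \<le> 16 * F1\<^sup>2 / F0 + 64 * C\<^sup>2 / c * (\<tau> * e)" by simp
  have "\<bar>Z * w1\<bar> \<le> \<omega> * (C * \<mu>)" using h mult_mono[of "\<bar>Z\<bar>" \<omega> "\<bar>w1\<bar>" "C * \<mu>"] by (simp add: abs_mult)
  moreover have "\<bar>\<tau> * w2\<bar> \<le> \<tau> * (C * \<mu>\<^sup>2)" using h by (simp add: abs_mult mult_left_mono)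
  moreover have "\<tau> * (C * \<mu>\<^sup>2) \<le> C * (\<tau> * e)"
    using e(2) h(1) C mult_left_mono[of "\<mu>\<^sup>2" e "C * \<tau>"] by (simp add: mult_ac)
  moreover have "C * (\<tau> * (\<chi> + \<tau> * \<mu>\<^sup>2)) \<le> C * (\<tau> * e)"
    using t[of "\<mu>\<^sup>2"] h C unfolding e_def by (intro mult_left_mono add_mono) auto
  ultimately have "2 * F2 \<le> 2 * G2 - 2 * (\<chi> * w0) + 2 * (\<omega> * (C * \<mu>)) + 4 * (C * (\<tau> * e))"
    using F2 by linarith
  moreover have "2 * (\<omega> * (C * \<mu>)) \<le> c / 2 * \<mu>\<^sup>2 + 2 * C\<^sup>2 / c * (\<tau> * e)"
  proof -
    have "0 \<le> (c * \<mu> - 2 * C * \<omega>)\<^sup>2" by simp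
    also have "\<dots> = c\<^sup>2 * \<mu>\<^sup>2 - 4 * c * C * \<omega> * \<mu> + 4 * C\<^sup>2 * \<omega>\<^sup>2" by (simp add: power2_eq_square algebra_simps)
    finally have "2 * (\<omega> * (C * \<mu>)) \<le> c / 2 * \<mu>\<^sup>2 + 2 * C\<^sup>2 / c * \<omega>\<^sup>2"
      using C(2) by (simp add: field_simps power2_eq_square)
    moreover have "\<omega>\<^sup>2 \<le> \<tau> * e" using h(6) mult_left_mono[OF e(3) h(1)] by linarith
    then have "2 * C\<^sup>2 / c * \<omega>\<^sup>2 \<le> 2 * C\<^sup>2 / c * (\<tau> * e)" using C by (intro mult_left_mono) auto
    ultimately show ?thesis by linarith
  qed
  ultimately have "c * \<mu>\<^sup>2 + 2 * (\<chi> * w0) \<le> 16 * F1\<^sup>2 / F0 + 64 * C\<^sup>2 / c * (\<tau> * e) - 2 * F2 + c / 2 * \<mu>\<^sup>2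
      + 2 * C\<^sup>2 / c * (\<tau> * e) + 4 * (C * (\<tau> * e))"
    using G s1 by linarith
  also have "\<dots> = 16 * F1\<^sup>2 / F0 - 2 * F2 + c / 2 * \<mu>\<^sup>2 + D * (\<tau> * e)"
    by (simp add: D_def algebra_simps add_divide_distrib)
  finally have main: "c / 2 * \<mu>\<^sup>2 + 2 * (\<chi> * w0) \<le> 16 * F1\<^sup>2 / F0 - 2 * F2 + D * (\<tau> * e)" by (simp add: field_simps)
  have "(D + 2 * C) * \<tau> * e \<le> c / 2 * e"
  proof (rule mult_right_mono)
    show "(D + 2 * C) * \<tau> \<le> c / 2" using \<tau>3 h(1) by (simp add: algebra_simps)
  qed (use e in simp)
  moreover have "C * (\<tau> * \<chi>) \<le> C * (\<tau> * e)" using h e C by (intro mult_left_mono) auto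
  moreover have "0 \<le> C * (\<tau> * e)" using h e C by auto
  moreover have "c * \<chi> \<le> \<chi> * w0" using mult_left_mono[OF h(11) h(4)] by (simp add: mult.commute)
  ultimately have "D * (\<tau> * e) + (3 / 2) * (\<chi> * (C * \<tau>)) \<le> c / 2 * \<mu>\<^sup>2 + (\<chi> * w0) / 2"
    by (simp add: e_def algebra_simps)
  then show ?thesis using main F0' by (simp add: algebra_simps)
qed

section \<open>Weights and expansion in the direction of the first variable\<close>

definition unitv :: "nat \<Rightarrow> nat \<Rightarrow> real" where
  "unitv i = (\<lambda>j. if j = i then 1 else 0)"

lemma gapdom_direction: "(x, u) \<in> gapdom s n k c \<Longrightarrow> (x, v) \<in> gapdom s n k c"
  by (simp add: gapdom_def)

lemma weights_unitv_large:
  assumes "1 \<le> s"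
  shows "w\<omega> s (x, unitv 1) = 1 / (x 1)\<^sup>2" "w\<chi> s (x, unitv 1) = 1 / (x 1) ^ 3" "w\<mu> s n (x, unitv 1) = 0"
    "(\<Sum>i=1..s. unitv 1 i / (x i)\<^sup>2) = 1 / (x 1)\<^sup>2"
proof -
  have "w\<omega> s (x, unitv 1) = (\<Sum>i=1..s. (if i = 1 then 1 / (x i)\<^sup>2 else 0))"
    unfolding w\<omega>_def unitv_def by (intro sum.cong) auto
  then show "w\<omega> s (x, unitv 1) = 1 / (x 1)\<^sup>2" using assms by simp
  have "w\<chi> s (x, unitv 1) = (\<Sum>i=1..s. (if i = 1 then 1 / (x i) ^ 3 else 0))"
    unfolding w\<chi>_def unitv_def by (intro sum.cong) auto
  then show "w\<chi> s (x, unitv 1) = 1 / (x 1) ^ 3" using assms by simp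
  show "w\<mu> s n (x, unitv 1) = 0" using assms unfolding w\<mu>_def unitv_def by (auto intro!: sum.neutral)
  have "(\<Sum>i=1..s. unitv 1 i / (x i)\<^sup>2) = (\<Sum>i=1..s. (if i = 1 then 1 / (x i)\<^sup>2 else 0))"
    unfolding unitv_def by (intro sum.cong) auto
  then show "(\<Sum>i=1..s. unitv 1 i / (x i)\<^sup>2) = 1 / (x 1)\<^sup>2" using assms by simp
qed

lemma w\<tau>_snd: "w\<tau> s (x, u) = w\<tau> s (x, v)"
  by (simp add: w\<tau>_def)

lemma rjet_nth_0: "rjet s n j (x, u) $ 0 = es {s+1..n} j x"
  by (simp add: rjet_def)

lemma limq_nth_0:
  assumes "es {s+1..n} b x \<noteq> 0"
  shows "limq s n a b (x, u) $ 0 = es {s+1..n} a x / es {s+1..n} b x"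
proof -
  have "limq s n a b (x, u) * rjet s n b (x, u) = rjet s n a (x, u)"
    using assms by (simp add: limq_def fps_mult_inverse_cancel rjet_nth_0)
  from fps_quotient_nth(1)[OF this] show ?thesis using assms by (simp add: rjet_nth_0)
qed

text \<open>Being a Newton gap, this value is bounded away from 0 by \<open>newton_gap_ge\<close>,
  so the main term \<chi> w0 has the full size of \<chi>.\<close>

lemma corrq_nth_0:
  assumes "es {s+1..n} b x \<noteq> 0"
  shows "corrq s n a b (x, u) $ 0 = newton_gap {s+1..n} x (Suc b) a / (es {s+1..n} b x)\<^sup>2"
proof -
  have "corrq s n a b (x, u) * rjet s n b (x, u) = limq s n a b (x, u) * rjet s n (Suc b) (x, u) - rjet s n (Suc a) (x, u)"
    using assms by (simp add: corrq_def fps_mult_inverse_cancel rjet_nth_0)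
  from fps_quotient_nth(1)[OF this] show ?thesis
    using assms by (simp add: rjet_nth_0 limq_nth_0 newton_gap_def field_simps power2_eq_square)
qed

lemma abs_sum_div_le_w\<omega>: "\<bar>\<Sum>i=1..s. u i / (x i)\<^sup>2\<bar> \<le> w\<omega> s (x, u)"
  unfolding w\<omega>_def fst_conv snd_conv by (rule order_trans[OF sum_abs]) (simp add: abs_divide)

text \<open>A derivative of order 1/x_1^2 makes the right-hand side of the target comparable with
  the first summand of \<chi>.\<close>

lemma pderiv_large_bound:
  fixes P :: real
  assumes "(x, u) \<in> gapdom s n k c" "1 \<le> s" "s \<le> n" "0 \<le> y" "P \<le> y / (x 1)\<^sup>2"
  shows "P * (u 1)\<^sup>2 / x 1 \<le> y * ((u 1)\<^sup>2 / (x 1) ^ 3)" "(u 1)\<^sup>2 / (x 1) ^ 3 \<le> w\<chi> s (x, u)"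
proof -
  have x: "1 \<le> x i" if "i \<in> {1..s}" for i using gapdom_large[OF assms(1,3) that] by auto
  have x1: "0 < x 1" using x[of 1] assms(2) by simp
  have "P * (u 1)\<^sup>2 / x 1 \<le> y / (x 1)\<^sup>2 * (u 1)\<^sup>2 / x 1"
    using assms(5) x1 by (intro divide_right_mono mult_right_mono) auto
  also have "\<dots> = y * ((u 1)\<^sup>2 / (x 1) ^ 3)" by (simp add: power2_eq_square power3_eq_cube)
  finally show "P * (u 1)\<^sup>2 / x 1 \<le> y * ((u 1)\<^sup>2 / (x 1) ^ 3)" .
  have nn: "0 \<le> (u i)\<^sup>2 / (x i) ^ 3" if "i \<in> {1..s}" for i using x[OF that] by simp
  show "(u 1)\<^sup>2 / (x 1) ^ 3 \<le> w\<chi> s (x, u)"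
    unfolding w\<chi>_def fst_conv snd_conv by (rule member_le_sum) (use nn assms(2) in auto)
qed

lemma gap_inequality_comparable:
  assumes s: "1 \<le> s" "s + a \<le> n" and a: "2 \<le> a" and b: "b = a - 1 \<or> b = a - 2" and c: "0 < c"
  shows "\<exists>\<rho>>0. \<forall>x u F. (x, u) \<in> gapdom s n (s + a) c \<longrightarrow> w\<tau> s (x, u) \<le> \<rho> \<longrightarrow> F = qjet n (s + a) (s + b) x u \<longrightarrow>
    (3 / 2) * (qjet n (s + a) (s + b) x (unitv 1) $ Suc 0 * (u 1)\<^sup>2 / x 1) \<le> 16 * (F $ Suc 0)\<^sup>2 / F $ 0 - 2 * F $ 2"
proof -
  have sn: "s \<le> n" and ba: "b < a" using s a b by auto
  define \<Omega> where "\<Omega> = gapdom s n (s + a) c"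
  interpret jet_weights \<Omega> "w\<tau> s" "w\<omega> s" "w\<chi> s" "w\<mu> s n"
    unfolding \<Omega>_def by (rule jet_weights_gapdom[OF s(1) sn])
  obtain C where C: "0 \<le> C" and ex: "\<And>x u. (x, u) \<in> \<Omega> \<Longrightarrow>
    expansion_bounds C s n (limq s n a b (x, u)) (corrq s n a b (x, u)) (qjet n (s + a) (s + b) x u) (x, u)"
    using qjet_expansion[OF s(1) sn s(2) ba c] unfolding \<Omega>_def by blast
  obtain c1 where c1: "0 < c1" and conc: "\<And>I x u G. admissible n c a I x \<Longrightarrow> G = es I a (line x u) * inverse (es I b (line x u)) \<Longrightarrow>
    c1 * (\<Sum>i\<in>I. (u i)\<^sup>2) \<le> 4 * (G $ Suc 0)\<^sup>2 / G $ 0 - 2 * G $ 2"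
    using quotient_strictly_concave[OF a c b, of n] by blast
  \<comment> \<open>One constant that bounds below the concavity of the limit, the value of the
    limit, and the Newton gap divided by sigma_b^2.\<close>
  define c2 where "c2 = min c1 (min (c ^ a / 2 ^ n) (c ^ (Suc b + a) / (2 ^ n)\<^sup>2))"
  have c2: "0 < c2" "c2 \<le> c1" "c2 \<le> c ^ a / 2 ^ n" "c2 \<le> c ^ (Suc b + a) / (2 ^ n)\<^sup>2"
    using c c1 by (auto simp: c2_def)
  define \<rho> where "\<rho> = threshold_comparable C c2"
  have \<rho>: "0 < \<rho>" unfolding \<rho>_def by (rule threshold_comparable_pos[OF C c2(1)])
  have "(3 / 2) * (qjet n (s + a) (s + b) x (unitv 1) $ Suc 0 * (u 1)\<^sup>2 / x 1) \<le> 16 * (F $ Suc 0)\<^sup>2 / F $ 0 - 2 * F $ 2"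
    if d: "(x, u) \<in> \<Omega>" and \<tau>: "w\<tau> s (x, u) \<le> \<rho>" and F: "F = qjet n (s + a) (s + b) x u" for x u F
  proof -
    have d': "(x, u) \<in> gapdom s n (s + a) c" and du: "(x, unitv 1) \<in> \<Omega>"
      using d gapdom_direction by (auto simp: \<Omega>_def)
    have adm: "admissible n c a {s+1..n} x" using gapdom_admissible[OF d' s(2)] by simp
    define G w where "G = limq s n a b (x, u)" and "w = corrq s n a b (x, u)"
    have Bpos: "0 < es {s+1..n} b x" "es {s+1..n} b x \<le> 2 ^ n"
      using admissible_es_pos[OF adm c] admissible_es_le[OF adm] ba by auto
    have G0: "c2 \<le> G $ 0"
    proof -
      have "c ^ a / 2 ^ n \<le> es {s+1..n} a x / es {s+1..n} b x"
        using admissible_es_ge[OF adm, of a] admissible_es_pos[OF adm c, of a] Bpos c by (intro frac_le) auto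
      then show ?thesis using c2(3) Bpos unfolding G_def by (subst limq_nth_0) auto
    qed
    have w0: "c2 \<le> w $ 0"
    proof -
      have "c ^ (Suc b + a) \<le> newton_gap {s+1..n} x (Suc b) a"
      proof (rule newton_gap_ge[where J = "{s+1..s+a}"])
        show "\<forall>i\<in>{s+1..n}. 0 \<le> x i" "\<forall>i\<in>{s+1..s+a}. c \<le> x i" using d' by (auto simp: gapdom_def)
      qed (use s ba c in auto)
      then have "c ^ (Suc b + a) / (2 ^ n)\<^sup>2 \<le> newton_gap {s+1..n} x (Suc b) a / (es {s+1..n} b x)\<^sup>2"
        using Bpos c by (intro frac_le power_mono) (auto intro: order_trans[rotated])
      then show ?thesis using c2(4) Bpos unfolding w_def by (subst corrq_nth_0) auto
    qed
    have \<mu>2: "(w\<mu> s n (x, u))\<^sup>2 = (\<Sum>i\<in>{s+1..n}. (u i)\<^sup>2)"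
      unfolding w\<mu>_def snd_conv by (intro real_sqrt_pow2 sum_nonneg) auto
    have "c2 * (w\<mu> s n (x, u))\<^sup>2 \<le> c1 * (w\<mu> s n (x, u))\<^sup>2" using c2(2) by (intro mult_right_mono) auto
    also have "\<dots> \<le> 4 * (G $ Suc 0)\<^sup>2 / G $ 0 - 2 * G $ 2"
      unfolding \<mu>2 by (rule conc[OF adm]) (simp add: G_def limq_def rjet_def)
    finally have conc': "c2 * (w\<mu> s n (x, u))\<^sup>2 \<le> 4 * (G $ Suc 0)\<^sup>2 / G $ 0 - 2 * G $ 2" .
    note e = ex[OF d, folded G_def w_def F, unfolded expansion_bounds_def fst_conv snd_conv]
    have main: "(3 / 2) * (w\<chi> s (x, u) * (w $ 0 + C * w\<tau> s (x, u))) \<le> 16 * (F $ Suc 0)\<^sup>2 / F $ 0 - 2 * F $ 2"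
      using comparable_numeric[OF C c2(1) nonneg(1)[OF d] \<tau>[unfolded \<rho>_def] nonneg(2,3,4)[OF d] \<omega>_le[OF d] _ _ _ abs_sum_div_le_w\<omega> w0 G0 _ _ _ conc'] e by blast
    define P where "P = qjet n (s + a) (s + b) x (unitv 1) $ Suc 0"
    define w' where "w' = corrq s n a b (x, unitv 1)"
    have w'0: "w' $ 0 = w $ 0" using Bpos unfolding w'_def w_def by (simp add: corrq_nth_0)
    have "P \<le> (w $ 0 + C * w\<tau> s (x, u)) / (x 1)\<^sup>2"
    proof -
      \<comment> \<open>In this direction \<mu> = 0, so the first coefficients of the limit and of w
        vanish, and the expansion leaves w0 / x_1^2 with an error C \<tau> / x_1^2.\<close>
      note e' = ex[OF du, folded w'_def, unfolded expansion_bounds_def fst_conv snd_conv weights_unitv_large[OF s(1)] w\<tau>_snd[of s x "unitv 1" u] w'0 P_def[symmetric]]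
      have "limq s n a b (x, unitv 1) $ Suc 0 = 0" "w' $ Suc 0 = 0" using e' by auto
      then have "\<bar>P - 1 / (x 1)\<^sup>2 * w $ 0\<bar> \<le> C * (w\<tau> s (x, u) * (1 / (x 1)\<^sup>2))" using e' by auto
      then show ?thesis by (simp add: add_divide_distrib)
    qed
    moreover have y: "0 \<le> w $ 0 + C * w\<tau> s (x, u)" using w0 c2(1) C nonneg(1)[OF d] by (simp add: add_nonneg_nonneg)
    ultimately have "P * (u 1)\<^sup>2 / x 1 \<le> (w $ 0 + C * w\<tau> s (x, u)) * ((u 1)\<^sup>2 / (x 1) ^ 3)"
      and "(u 1)\<^sup>2 / (x 1) ^ 3 \<le> w\<chi> s (x, u)"
      using pderiv_large_bound[OF d' s(1) sn] by blast+
    moreover from this y have "(w $ 0 + C * w\<tau> s (x, u)) * ((u 1)\<^sup>2 / (x 1) ^ 3) \<le> (w $ 0 + C * w\<tau> s (x, u)) * w\<chi> s (x, u)"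
      by (intro mult_left_mono) auto
    ultimately show ?thesis using main unfolding P_def by (simp add: mult.commute)
  qed
  then show ?thesis using \<rho> unfolding \<Omega>_def by blast
qed

subsection \<open>A single small scale, quotient of degree one\<close>

text \<open>The product has exactly the order of the available term T \<mu>^2, so this is the
  critical estimate.\<close>

lemma degree_one_quadratic:
  fixes T \<mu> Z V w0 \<kappa> :: real
  assumes T: "0 < T" and \<mu>: "0 \<le> \<mu>" and w0: "0 \<le> w0" and \<kappa>: "\<kappa> \<le> 1 / 100"
    and V: "V\<^sup>2 \<le> w0 * \<mu>\<^sup>2" and Z: "Z\<^sup>2 \<le> T * y"
  shows "2 * (Z * V) \<le> (1 - \<kappa>) * T * \<mu>\<^sup>2 + 100 / 99 * (w0 * y)"
proof -
  \<comment> \<open>One percent of T is reserved for the errors; the price is the factor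
    100/99.\<close>
  define r where "r = 99 / 100 * T"
  have r: "0 < r" using T by (simp add: r_def)
  have "\<bar>V\<bar> \<le> \<bar>sqrt w0 * \<mu>\<bar>"
    unfolding abs_le_square_iff using V w0 by (simp add: power_mult_distrib)
  then have "\<bar>Z\<bar> * \<bar>V\<bar> \<le> \<bar>Z\<bar> * (sqrt w0 * \<mu>)" using \<mu> w0 by (intro mult_left_mono) auto
  moreover have "Z * V \<le> \<bar>Z\<bar> * \<bar>V\<bar>" by (metis abs_ge_self abs_mult)
  ultimately have "2 * (Z * V) \<le> 2 * (\<bar>Z\<bar> * (sqrt w0 * \<mu>))" by linarith
  also have "\<dots> \<le> r * \<mu>\<^sup>2 + (Z\<^sup>2 * w0) / r"
  proof -
    have "0 \<le> (r * \<mu> - \<bar>Z\<bar> * sqrt w0)\<^sup>2" by simp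
    also have "\<dots> = r\<^sup>2 * \<mu>\<^sup>2 - 2 * r * (\<bar>Z\<bar> * (sqrt w0 * \<mu>)) + Z\<^sup>2 * w0"
      using w0 by (simp add: power2_diff power_mult_distrib algebra_simps)
    finally show ?thesis using r by (simp add: field_simps power2_eq_square)
  qed
  also have "r * \<mu>\<^sup>2 \<le> (1 - \<kappa>) * T * \<mu>\<^sup>2"
    unfolding r_def using \<kappa> T by (intro mult_right_mono) auto
  also have "(Z\<^sup>2 * w0) / r \<le> (T * y * w0) / r"
    using Z w0 r by (intro divide_right_mono mult_right_mono) auto
  also have "(T * y * w0) / r = 100 / 99 * (w0 * y)" using T by (simp add: r_def field_simps)
  finally show ?thesis by simp
qed

text \<open>The inner bracket is D + 4 C + 1 with the D of \<open>degree_one_numeric\<close>; each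
  error constant times \<tau> then stays below 1/100.\<close>

definition threshold_degree_one :: "real \<Rightarrow> real" where
  "threshold_degree_one C = 1 / (100 * ((2 * C + C ^ 3 + 48 * C) + 4 * C + 1))"

lemma threshold_degree_one_pos: "1 \<le> C \<Longrightarrow> 0 < threshold_degree_one C"
  by (auto simp: threshold_degree_one_def intro!: add_nonneg_pos)

text \<open>Besides terms with U, which the square of F1 controls, -2 F2 contains 2 \<chi> w0 - 2 Z
  V + \<tau> \<mu>^2. Plain Cauchy-Schwarz would spend \<chi> w0 on Z V and leave only \<chi> w0.
  The sum S adds 2 X1 \<mu>^2, and then only about w0 (\<chi> - 2/3 \<chi>1) is spent.\<close>

lemma degree_one_numeric:
  fixes C \<tau> \<omega> \<chi> \<mu> :: real
  assumes C: "1 \<le> C"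
    and h: "0 \<le> \<tau>" "\<tau> \<le> threshold_degree_one C" "0 \<le> \<omega>" "0 \<le> \<chi>1" "\<chi>1 \<le> \<chi>" "0 \<le> \<mu>" "\<omega>\<^sup>2 \<le> \<tau> * \<chi>" "0 < X1"
      "Z\<^sup>2 \<le> (\<tau> + 2 * X1) * (\<chi> - 2 / 3 * \<chi>1)" "V\<^sup>2 \<le> w0 * \<mu>\<^sup>2" "1 \<le> w0" "w0 \<le> C" "1 \<le> G0" "G0 \<le> C"
      "\<bar>G0 * U + V\<bar> \<le> C * \<mu>" "\<bar>Z\<bar> \<le> \<omega>" and S: "(1 - 2 * C * \<tau>) * (2 * X1 * \<mu>\<^sup>2) \<le> S"
    and F0: "\<bar>F0 - (G0 - \<tau> * w0)\<bar> \<le> C * \<tau>\<^sup>2"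
    and F1: "\<bar>F1 - (U + Z * w0 - \<tau> * (G0 * U + V))\<bar> \<le> C * (\<tau> * (\<omega> + \<tau> * \<mu>))"
    and F2: "\<bar>F2 - (- \<chi> * w0 + Z * (G0 * U + V) - \<tau> * ((U\<^sup>2 + \<mu>\<^sup>2) / 2))\<bar> \<le> C * (\<tau> * (\<chi> + \<tau> * \<mu>\<^sup>2))"
  shows "(3 / 2) * ((w0 + C * \<tau>) * \<chi>1) \<le> 16 * F1\<^sup>2 / F0 - 2 * F2 + S"
proof -
  \<comment> \<open>2 C comes from the remainder of F2, C^3 from the product of Z and G0 U, and 48 C
    from replacing U by F1.\<close>
  define D where "D = 2 * C + C ^ 3 + 48 * C"
  have D: "0 \<le> D" using C by (simp add: D_def)
  have pos: "0 < 100 * (D + 4 * C + 1)" using C D by simp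
  have \<tau>D: "(D + 4 * C + 1) * \<tau> \<le> 1 / 100" using h(2) pos unfolding threshold_degree_one_def D_def[symmetric] by (simp add: field_simps)
  have nnD: "0 \<le> D * \<tau>" "0 \<le> C * \<tau>" using D C h(1) by auto
  have small: "D * \<tau> + 4 * (C * \<tau>) + \<tau> \<le> 1 / 100" using \<tau>D by (simp add: algebra_simps)
  have \<tau>1: "\<tau> \<le> 1" using small nnD by linarith
  have \<chi>: "0 \<le> \<chi>" using h by linarith
  have t: "\<tau> * y \<le> y" if "0 \<le> y" for y using that h(1) \<tau>1 by (simp add: mult_left_le_one_le)
  define e where "e = \<chi> + \<tau> * \<mu>\<^sup>2"
  have e: "0 \<le> e" using h(1) \<chi> by (auto simp: e_def)
  have "C * \<tau>\<^sup>2 \<le> C * \<tau>" using t[OF h(1)] C by (auto simp: power2_eq_square intro: mult_left_mono)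
  moreover have "\<tau> * w0 \<le> C * \<tau>" using h mult_left_mono[of w0 C \<tau>] by (simp add: mult.commute)
  moreover have "0 \<le> \<tau> * w0" using h by auto
  ultimately have F0': "0 < F0" "F0 \<le> 2 * C" using F0 small nnD h(1,13,14) C by linarith+
  define v where "v = \<omega> + \<tau> * \<mu>"
  have v: "0 \<le> v" using h by (simp add: v_def)
  have "\<bar>Z * w0\<bar> \<le> C * \<omega>" using h C mult_mono[of "\<bar>Z\<bar>" \<omega> "\<bar>w0\<bar>" C] by (simp add: abs_mult mult.commute)
  moreover have "\<bar>\<tau> * (G0 * U + V)\<bar> \<le> C * (\<tau> * \<mu>)"
    using h mult_left_mono[of "\<bar>G0 * U + V\<bar>" "C * \<mu>" \<tau>] by (simp add: abs_mult mult_ac)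
  moreover have "C * (\<tau> * (\<omega> + \<tau> * \<mu>)) \<le> C * v" using t[OF v] C unfolding v_def by (intro mult_left_mono) auto
  ultimately have "\<bar>F1 - U\<bar> \<le> 2 * C * v" using F1 by (simp add: v_def algebra_simps)
  then have "(F1 - U)\<^sup>2 \<le> (2 * C * v)\<^sup>2" using abs_le_square_iff[of "F1 - U" "2 * C * v"] C v by simp
  also have "\<dots> = 4 * C\<^sup>2 * v\<^sup>2" by (simp add: power_mult_distrib)
  also have "v\<^sup>2 \<le> 2 * (\<tau> * e)"
  proof -
    have "v\<^sup>2 \<le> 2 * \<omega>\<^sup>2 + 2 * (\<tau> * \<mu>)\<^sup>2" unfolding v_def by (rule square_sum_le)
    then show ?thesis using h(7) by (simp add: e_def algebra_simps power2_eq_square)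
  qed
  finally have e1: "(F1 - U)\<^sup>2 \<le> 8 * C\<^sup>2 * (\<tau> * e)" using C by (simp add: mult_left_mono)
  have "U\<^sup>2 \<le> 2 * F1\<^sup>2 + 2 * (F1 - U)\<^sup>2" using square_diff_le[of F1 "F1 - U"] by simp
  \<comment> \<open>Because F0 <= 2 C, the term with F1^2 controls U^2 / C, and part of this pays
    for the product of Z and G0 U.\<close>
  then have "(3 / C) * U\<^sup>2 \<le> (3 / C) * (2 * F1\<^sup>2 + 16 * C\<^sup>2 * (\<tau> * e))"
    using e1 C by (intro mult_left_mono) auto
  also have "\<dots> = 6 * F1\<^sup>2 / C + 48 * C * (\<tau> * e)" using C by (simp add: field_simps power2_eq_square)
  also have "6 * F1\<^sup>2 / C \<le> 16 * F1\<^sup>2 / F0"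
  proof -
    have "6 * F1\<^sup>2 / C \<le> 8 * F1\<^sup>2 / C" using C by (intro divide_right_mono) auto
    also have "\<dots> = 16 * F1\<^sup>2 / (2 * C)" by simp
    also have "\<dots> \<le> 16 * F1\<^sup>2 / F0" using F0' C by (intro divide_left_mono) auto
    finally show ?thesis .
  qed
  finally have s1: "(3 / C) * U\<^sup>2 \<le> 16 * F1\<^sup>2 / F0 + 48 * C * (\<tau> * e)" by simp
  have s2: "2 * (Z * (G0 * U)) \<le> (1 / C) * U\<^sup>2 + C ^ 3 * (\<tau> * e)"
  proof -
    have "0 \<le> (U - C * G0 * Z)\<^sup>2" by simp
    also have "\<dots> = U\<^sup>2 - 2 * C * (Z * (G0 * U)) + C\<^sup>2 * G0\<^sup>2 * Z\<^sup>2" by (simp add: power2_eq_square algebra_simps)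
    finally have "2 * (Z * (G0 * U)) \<le> (1 / C) * U\<^sup>2 + C * G0\<^sup>2 * Z\<^sup>2"
      using C by (simp add: field_simps power2_eq_square)
    moreover have "C * G0\<^sup>2 * Z\<^sup>2 \<le> C * C\<^sup>2 * (\<tau> * e)"
    proof (intro mult_mono power_mono)
      have "Z\<^sup>2 \<le> \<omega>\<^sup>2" using power_mono[OF h(16) abs_ge_zero, of 2] by simp
      also have "\<dots> \<le> \<tau> * e" using h(1,7) \<chi> mult_left_mono[of \<chi> e \<tau>] by (simp add: e_def)
      finally show "Z\<^sup>2 \<le> \<tau> * e" .
    qed (use h C e in auto)
    ultimately show ?thesis by (simp add: power3_eq_cube power2_eq_square)
  qed
  have "2 * F2 \<le> - 2 * (\<chi> * w0) + 2 * (Z * (G0 * U)) + 2 * (Z * V) - \<tau> * U\<^sup>2 - \<tau> * \<mu>\<^sup>2 + 2 * C * (\<tau> * e)"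
  proof -
    have "F2 \<le> - \<chi> * w0 + Z * (G0 * U + V) - \<tau> * ((U\<^sup>2 + \<mu>\<^sup>2) / 2) + C * (\<tau> * e)"
      using F2 unfolding e_def by linarith
    moreover have "Z * (G0 * U + V) = Z * (G0 * U) + Z * V" "\<tau> * ((U\<^sup>2 + \<mu>\<^sup>2) / 2) = (\<tau> * U\<^sup>2) / 2 + (\<tau> * \<mu>\<^sup>2) / 2"
      "- \<chi> * w0 = - (\<chi> * w0)" "2 * C * (\<tau> * e) = 2 * (C * (\<tau> * e))"
      by (simp_all add: algebra_simps add_divide_distrib)
    ultimately show ?thesis by linarith
  qed
  moreover have "0 \<le> \<tau> * U\<^sup>2" "0 \<le> (2 / C) * U\<^sup>2" using h C by auto
  moreover have "(3 / C) * U\<^sup>2 = (1 / C) * U\<^sup>2 + (2 / C) * U\<^sup>2" by (simp add: field_simps)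
  moreover have "D * (\<tau> * e) = 2 * C * (\<tau> * e) + C ^ 3 * (\<tau> * e) + 48 * C * (\<tau> * e)"
    by (simp add: D_def algebra_simps)
  ultimately have main: "2 * (\<chi> * w0) + \<tau> * \<mu>\<^sup>2 - 2 * (Z * V) - D * (\<tau> * e) \<le> 16 * F1\<^sup>2 / F0 - 2 * F2"
    using s1 s2 by linarith
  define T where "T = \<tau> + 2 * X1"
  define \<kappa> where "\<kappa> = D * \<tau> + 2 * (C * \<tau>)"
  have T: "0 < T" using h by (simp add: T_def)
  have \<kappa>: "\<kappa> \<le> 1 / 100" using small nnD h(1) by (simp add: \<kappa>_def)
  have ZV: "2 * (Z * V) \<le> (1 - \<kappa>) * T * \<mu>\<^sup>2 + 100 / 99 * (w0 * (\<chi> - 2 / 3 * \<chi>1))"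
    by (rule degree_one_quadratic[OF T h(6) _ \<kappa> h(10) h(9)[folded T_def]]) (use h in simp)
  have T\<mu>: "(1 - \<kappa>) * T * \<mu>\<^sup>2 \<le> \<tau> * \<mu>\<^sup>2 + (1 - 2 * C * \<tau>) * (2 * X1 * \<mu>\<^sup>2) - D * \<tau> * (\<tau> * \<mu>\<^sup>2)"
  proof -
    have "0 \<le> 2 * (C * \<tau>) * (\<tau> * \<mu>\<^sup>2)" "0 \<le> D * \<tau> * (2 * X1 * \<mu>\<^sup>2)" using nnD h by auto
    then show ?thesis unfolding T_def \<kappa>_def by (simp add: algebra_simps)
  qed
  \<comment> \<open>With \<chi>1 <= \<chi> and w0 >= 1 this rests on 2 - 1/100 - 100/99 + 200/297 >
    3/2 + 3/200.\<close>
  have "2 * (\<chi> * w0) - D * (\<tau> * \<chi>) - 100 / 99 * (w0 * (\<chi> - 2 / 3 * \<chi>1)) \<ge> (3 / 2) * ((w0 + C * \<tau>) * \<chi>1)"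
  proof -
    have "D * \<tau> * \<chi> \<le> 1 / 100 * \<chi>" using small nnD h(1) \<chi> by (intro mult_right_mono) auto
    moreover have "C * \<tau> * \<chi>1 \<le> 1 / 100 * \<chi>1" using small nnD h(1,4) by (intro mult_right_mono) auto
    moreover have "\<chi> \<le> \<chi> * w0" "\<chi>1 \<le> \<chi>1 * w0" using h(4,11) \<chi> mult_left_mono[of 1 w0 \<chi>] mult_left_mono[of 1 w0 \<chi>1] by auto
    moreover have "\<chi>1 * w0 \<le> \<chi> * w0" using h by (intro mult_right_mono) auto
    moreover have e1: "100 / 99 * (w0 * (\<chi> - 2 / 3 * \<chi>1)) = 100 / 99 * (\<chi> * w0) - 200 / 297 * (\<chi>1 * w0)"
      by (simp add: field_simps)
    moreover have e2: "(3 / 2) * ((w0 + C * \<tau>) * \<chi>1) = 3 / 2 * (\<chi>1 * w0) + 3 / 2 * (C * \<tau> * \<chi>1)"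
      by (simp add: algebra_simps)
    moreover have e3: "D * (\<tau> * \<chi>) = D * \<tau> * \<chi>" by simp
    ultimately show ?thesis using h(4) unfolding e1 e2 e3 by linarith
  qed
  moreover have "D * (\<tau> * e) = D * (\<tau> * \<chi>) + D * \<tau> * (\<tau> * \<mu>\<^sup>2)" by (simp add: e_def algebra_simps)
  ultimately show ?thesis using main ZV T\<mu> S by linarith
qed

text \<open>Giving the first variable the weight \<open>3\<close> leaves the factor \<open>2 - 1/3 > 3/2\<close> in front of \<open>\<xi>\<^sub>1\<^sup>2\<close>.\<close>
lemma weighted_Cauchy_Schwarz:
  fixes x u :: "nat \<Rightarrow> real"
  assumes "1 \<le> s" and x: "\<And>i. i \<in> {1..s} \<Longrightarrow> 0 < x i"
  defines "\<chi>1 \<equiv> (u 1)\<^sup>2 / (x 1) ^ 3"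
  shows "(\<Sum>i=1..s. u i / (x i)\<^sup>2)\<^sup>2 \<le> (w\<tau> s (x, u) + 2 * (1 / x 1)) * (w\<chi> s (x, u) - 2 / 3 * \<chi>1)"
proof -
  have split: "(\<Sum>i=1..s. f i) = f 1 + (\<Sum>i=2..s. f i)" for f :: "nat \<Rightarrow> real"
    using assms(1) by (simp add: sum.atLeast_Suc_atMost numeral_2_eq_2)
  define X1 z1 Z2 \<tau>2 \<chi>2 where d: "X1 = 1 / x 1" "z1 = u 1 / (x 1)\<^sup>2" "Z2 = (\<Sum>i=2..s. u i / (x i)\<^sup>2)"
    "\<tau>2 = (\<Sum>i=2..s. 1 / x i)" "\<chi>2 = (\<Sum>i=2..s. (u i)\<^sup>2 / (x i) ^ 3)"
  have x1: "0 < x 1" using x[of 1] assms(1) by simp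
  have x': "0 < x i" if "i \<in> {2..s}" for i using x[of i] that by simp
  have z1: "z1\<^sup>2 = X1 * \<chi>1" using x1 by (simp add: d \<chi>1_def power2_eq_square power3_eq_cube)
  have "\<bar>Z2\<bar> \<le> (\<Sum>i=2..s. \<bar>u i\<bar> / (x i)\<^sup>2)" unfolding d by (rule order_trans[OF sum_abs]) (simp add: abs_divide)
  then have "Z2\<^sup>2 \<le> (\<Sum>i=2..s. \<bar>u i\<bar> / (x i)\<^sup>2)\<^sup>2" by (metis abs_ge_zero power2_abs power_mono)
  also have "\<dots> \<le> \<tau>2 * \<chi>2" unfolding d by (rule inverse_weights_Cauchy_Schwarz[OF x'])
  finally have Z2: "Z2\<^sup>2 \<le> \<tau>2 * \<chi>2" .
  have nn: "0 \<le> X1" "0 \<le> \<chi>1" "0 \<le> \<tau>2" "0 \<le> \<chi>2"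
    unfolding d \<chi>1_def using x1 by (auto intro!: sum_nonneg divide_nonneg_nonneg zero_le_power[OF less_imp_le[OF x']] less_imp_le[OF x'])
  have "2 * (z1 * Z2) \<le> 3 * X1 * \<chi>2 + \<tau>2 * \<chi>1 / 3"
  proof (rule power2_le_imp_le)
    have "(2 * (z1 * Z2))\<^sup>2 = 4 * (z1\<^sup>2 * Z2\<^sup>2)" by (simp add: power_mult_distrib)
    also have "\<dots> \<le> 4 * (X1 * \<chi>1 * (\<tau>2 * \<chi>2))" unfolding z1 using Z2 nn by (intro mult_left_mono) auto
    also have "\<dots> \<le> (3 * X1 * \<chi>2 + \<tau>2 * \<chi>1 / 3)\<^sup>2"
      using zero_le_power2[of "3 * X1 * \<chi>2 - \<tau>2 * \<chi>1 / 3"] by (simp add: power2_eq_square algebra_simps)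
    finally show "(2 * (z1 * Z2))\<^sup>2 \<le> (3 * X1 * \<chi>2 + \<tau>2 * \<chi>1 / 3)\<^sup>2" .
  qed (use nn in simp)
  then have "(z1 + Z2)\<^sup>2 \<le> (3 * X1 + \<tau>2) * (\<chi>1 / 3 + \<chi>2)"
    using z1 Z2 by (simp add: power2_sum algebra_simps)
  moreover have "(\<Sum>i=1..s. u i / (x i)\<^sup>2) = z1 + Z2" "w\<tau> s (x, u) = X1 + \<tau>2" "w\<chi> s (x, u) = \<chi>1 + \<chi>2"
    unfolding w\<tau>_def w\<chi>_def fst_conv snd_conv split by (simp_all add: d \<chi>1_def)
  ultimately show ?thesis unfolding d(1)[symmetric] by (simp add: algebra_simps)
qed

lemma rjet_1: "rjet s n (Suc 0) (x, u) = (\<Sum>i=s+1..n. line x u i)"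
  by (simp add: rjet_def es_1)

lemma rjet_2_nth:
  "rjet s n 2 (x, u) $ 0 = ((\<Sum>i=s+1..n. x i)\<^sup>2 - (\<Sum>i=s+1..n. (x i)\<^sup>2)) / 2"
  "rjet s n 2 (x, u) $ Suc 0 = (\<Sum>i=s+1..n. x i) * (\<Sum>i=s+1..n. u i) - (\<Sum>i=s+1..n. x i * u i)"
  "rjet s n 2 (x, u) $ 2 = ((\<Sum>i=s+1..n. u i)\<^sup>2 - (\<Sum>i=s+1..n. (u i)\<^sup>2)) / 2"
proof -
  define S where "S = (\<Sum>i=s+1..n. line x u i)"
  have two: "2 * rjet s n 2 (x, u) = S * S - (\<Sum>i=s+1..n. line x u i * line x u i)"
    using es_2_eq[of "{s+1..n}" "line x u"] by (simp add: rjet_def S_def power2_eq_square)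
  have S: "S $ 0 = (\<Sum>i=s+1..n. x i)" "S $ Suc 0 = (\<Sum>i=s+1..n. u i)" "S $ 2 = 0"
    by (simp_all add: S_def fps_sum_nth)
  have c: "(2 * f) $ m = 2 * f $ m" for f :: "real fps" and m
    by (simp only: mult_2 fps_add_nth)
  have "2 * rjet s n 2 (x, u) $ 0 = (\<Sum>i=s+1..n. x i)\<^sup>2 - (\<Sum>i=s+1..n. (x i)\<^sup>2)"
    using arg_cong[OF two, of "\<lambda>f. f $ 0"] unfolding c by (simp add: S fps_sum_nth power2_eq_square)
  then show "rjet s n 2 (x, u) $ 0 = ((\<Sum>i=s+1..n. x i)\<^sup>2 - (\<Sum>i=s+1..n. (x i)\<^sup>2)) / 2" by simp
  have "2 * rjet s n 2 (x, u) $ Suc 0 = 2 * ((\<Sum>i=s+1..n. x i) * (\<Sum>i=s+1..n. u i)) - 2 * (\<Sum>i=s+1..n. x i * u i)"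
    using arg_cong[OF two, of "\<lambda>f. f $ Suc 0"] unfolding c
    by (simp add: S fps_sum_nth fps_mult_nth_Suc_0 sum.distrib mult.commute flip: sum_distrib_left)
  then show "rjet s n 2 (x, u) $ Suc 0 = (\<Sum>i=s+1..n. x i) * (\<Sum>i=s+1..n. u i) - (\<Sum>i=s+1..n. x i * u i)" by simp
  have "2 * rjet s n 2 (x, u) $ 2 = (\<Sum>i=s+1..n. u i)\<^sup>2 - (\<Sum>i=s+1..n. (u i)\<^sup>2)"
    using arg_cong[OF two, of "\<lambda>f. f $ 2"] unfolding c by (simp add: S fps_sum_nth fps_mult_nth_2 power2_eq_square)
  then show "rjet s n 2 (x, u) $ 2 = ((\<Sum>i=s+1..n. u i)\<^sup>2 - (\<Sum>i=s+1..n. (u i)\<^sup>2)) / 2" by simp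
qed

lemma limq_1_0_nth:
  "limq s n 1 0 (x, u) $ 0 = (\<Sum>i=s+1..n. x i)" "limq s n 1 0 (x, u) $ Suc 0 = (\<Sum>i=s+1..n. u i)" "limq s n 1 0 (x, u) $ 2 = 0"
proof -
  have "limq s n 1 0 (x, u) = (\<Sum>i=s+1..n. line x u i)" by (simp add: limq_def rjet_def es_1)
  then show "limq s n 1 0 (x, u) $ 0 = (\<Sum>i=s+1..n. x i)" "limq s n 1 0 (x, u) $ Suc 0 = (\<Sum>i=s+1..n. u i)" "limq s n 1 0 (x, u) $ 2 = 0"
    by (simp_all add: fps_sum_nth)
qed

text \<open>Here w = sigma_1^2 - sigma_2 is the complete homogeneous polynomial of degree two. Its
  convexity yields the term \<tau> \<mu>^2, the only curvature in the small variables when the limit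
  is linear.\<close>

lemma corrq_1_0_nth:
  fixes x u :: "nat \<Rightarrow> real" and s n :: nat
  defines "\<sigma> \<equiv> \<Sum>i=s+1..n. x i" and "U \<equiv> \<Sum>i=s+1..n. u i"
  shows "corrq s n 1 0 (x, u) $ 0 = (\<sigma>\<^sup>2 + (\<Sum>i=s+1..n. (x i)\<^sup>2)) / 2"
    "corrq s n 1 0 (x, u) $ Suc 0 = \<sigma> * U + (\<Sum>i=s+1..n. x i * u i)"
    "corrq s n 1 0 (x, u) $ 2 = (U\<^sup>2 + (\<Sum>i=s+1..n. (u i)\<^sup>2)) / 2"
proof -
  have lim: "limq s n 1 0 (x, u) = rjet s n (Suc 0) (x, u)" by (simp add: limq_def rjet_def)
  have "corrq s n 1 0 (x, u) = limq s n 1 0 (x, u) * limq s n 1 0 (x, u) - rjet s n 2 (x, u)"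
    by (simp add: corrq_def lim[unfolded One_nat_def] numeral_2_eq_2) (simp add: rjet_def)
  then show "corrq s n 1 0 (x, u) $ 0 = (\<sigma>\<^sup>2 + (\<Sum>i=s+1..n. (x i)\<^sup>2)) / 2"
    "corrq s n 1 0 (x, u) $ Suc 0 = \<sigma> * U + (\<Sum>i=s+1..n. x i * u i)"
    "corrq s n 1 0 (x, u) $ 2 = (U\<^sup>2 + (\<Sum>i=s+1..n. (u i)\<^sup>2)) / 2"
    unfolding \<sigma>_def U_def
    by (simp_all only: fps_sub_nth fps_mult_nth_0 fps_mult_nth_Suc_0 fps_mult_nth_2 limq_1_0_nth rjet_2_nth)
       (simp_all add: power2_eq_square field_simps)
qed

lemma gap_inequality_degree_one:
  assumes s: "1 \<le> s" "s + 1 \<le> n"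
  shows "\<exists>\<rho>>0. \<forall>x u F. (x, u) \<in> gapdom s n (s + 1) 1 \<longrightarrow> w\<tau> s (x, u) \<le> \<rho> \<longrightarrow> F = qjet n (s + 1) (s + 0) x u \<longrightarrow>
    (3 / 2) * (qjet n (s + 1) (s + 0) x (unitv 1) $ Suc 0 * (u 1)\<^sup>2 / x 1) \<le> 16 * (F $ Suc 0)\<^sup>2 / F $ 0 - 2 * F $ 2
      + (\<Sum>j=s+1..n. 2 * qjet n (s + 1) (s + 0) x (unitv j) $ Suc 0 * (u j)\<^sup>2 / x 1)"
proof -
  have sn: "s \<le> n" using s by simp
  define \<Omega> where "\<Omega> = gapdom s n (s + 1) 1"
  interpret jet_weights \<Omega> "w\<tau> s" "w\<omega> s" "w\<chi> s" "w\<mu> s n"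
    unfolding \<Omega>_def by (rule jet_weights_gapdom[OF s(1) sn])
  obtain C' where C': "0 \<le> C'" and ex': "\<And>x u. (x, u) \<in> \<Omega> \<Longrightarrow>
    expansion_bounds C' s n (limq s n 1 0 (x, u)) (corrq s n 1 0 (x, u)) (qjet n (s + 1) (s + 0) x u) (x, u)"
    using qjet_expansion[OF s(1) sn s(2), of 0 1] unfolding \<Omega>_def by auto
  define C where "C = C' + 1"
  have C: "1 \<le> C" "C' \<le> C" using C' by (auto simp: C_def)
  have up: "y \<le> C * v" if "y \<le> C' * v" "0 \<le> v" for y v
    using that C(2) mult_right_mono[of C' C v] by linarith
  define \<rho> where "\<rho> = threshold_degree_one C"
  have \<rho>: "0 < \<rho>" unfolding \<rho>_def by (rule threshold_degree_one_pos[OF C(1)])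
  have "(3 / 2) * (qjet n (s + 1) (s + 0) x (unitv 1) $ Suc 0 * (u 1)\<^sup>2 / x 1) \<le> 16 * (F $ Suc 0)\<^sup>2 / F $ 0 - 2 * F $ 2
      + (\<Sum>j=s+1..n. 2 * qjet n (s + 1) (s + 0) x (unitv j) $ Suc 0 * (u j)\<^sup>2 / x 1)"
    if d: "(x, u) \<in> \<Omega>" and \<tau>: "w\<tau> s (x, u) \<le> \<rho>" and F: "F = qjet n (s + 1) (s + 0) x u" for x u F
  proof -
    have d': "(x, u) \<in> gapdom s n (s + 1) 1" and du: "(x, v) \<in> \<Omega>" for v
      using d gapdom_direction by (auto simp: \<Omega>_def)
    have xl: "1 \<le> x i" if "i \<in> {1..s}" for i using gapdom_large[OF d' sn that] by simp
    have x1: "0 < x 1" using xl[of 1] s by simp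
    have xs: "0 \<le> x i" "x i \<le> 1" if "i \<in> {s+1..n}" for i using d' that by (auto simp: gapdom_def)
    have xs1: "1 \<le> x (s + 1)" using d' by (auto simp: gapdom_def)
    define t \<omega> \<chi> \<mu> where wt: "t = w\<tau> s (x, u)" "\<omega> = w\<omega> s (x, u)" "\<chi> = w\<chi> s (x, u)" "\<mu> = w\<mu> s n (x, u)"
    note n = nonneg[OF d, folded wt]
    define \<sigma> U V q where dd: "\<sigma> = (\<Sum>i=s+1..n. x i)" "U = (\<Sum>i=s+1..n. u i)" "V = (\<Sum>i=s+1..n. x i * u i)"
      "q = (\<Sum>i=s+1..n. (x i)\<^sup>2)"
    have \<mu>2: "\<mu>\<^sup>2 = (\<Sum>i=s+1..n. (u i)\<^sup>2)"
      unfolding wt w\<mu>_def snd_conv by (intro real_sqrt_pow2 sum_nonneg) auto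
    define w where "w = corrq s n 1 0 (x, u)"
    have w: "w $ 0 = (\<sigma>\<^sup>2 + q) / 2" "w $ Suc 0 = \<sigma> * U + V" "w $ 2 = (U\<^sup>2 + \<mu>\<^sup>2) / 2"
      unfolding w_def corrq_1_0_nth \<mu>2 dd by simp_all
    have \<sigma>1: "1 \<le> \<sigma>"
    proof -
      have "x (s + 1) \<le> \<sigma>" unfolding dd by (rule member_le_sum) (use xs s in auto)
      then show ?thesis using xs1 by linarith
    qed
    have q1: "1 \<le> q"
    proof -
      have "(x (s + 1))\<^sup>2 \<le> q" unfolding dd by (rule member_le_sum) (use s in auto)
      moreover have "1 \<le> (x (s + 1))\<^sup>2" using xs1 by (rule one_le_power)
      ultimately show ?thesis by linarith
    qed
    have "q \<le> \<sigma>\<^sup>2"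
    proof -
      have "\<sigma>\<^sup>2 = q + 2 * es {s+1..n} 2 x" unfolding dd by (rule es_2_eq) simp
      moreover have "0 \<le> es {s+1..n} 2 x" using xs by (intro es_nonneg)
      ultimately show ?thesis by simp
    qed
    then have qw: "q \<le> w $ 0" using w(1) by simp
    define S where "S = (\<Sum>j=s+1..n. 2 * qjet n (s + 1) (s + 0) x (unitv j) $ Suc 0 * (u j)\<^sup>2 / x 1)"
    have S: "(1 - 2 * C * t) * (2 * (1 / x 1) * \<mu>\<^sup>2) \<le> S"
    proof -
      \<comment> \<open>The limit sigma_1 has derivative 1 in each small direction, so each F_j is
        nearly at least 1 and S is at least about 2 \<mu>^2 / x_1.\<close>
      have Fj: "1 - 2 * C * t \<le> qjet n (s + 1) (s + 0) x (unitv j) $ Suc 0" if j: "j \<in> {s+1..n}" for j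
      proof -
        have z: "w\<omega> s (x, unitv j) = 0" "(\<Sum>i=1..s. unitv j i / (x i)\<^sup>2) = 0"
          using j by (auto simp: w\<omega>_def unitv_def intro!: sum.neutral)
        have sj: "(\<Sum>i=s+1..n. (unitv j i)\<^sup>2) = 1" "(\<Sum>i=s+1..n. unitv j i) = 1"
          using j by (simp_all add: unitv_def if_distrib[of "\<lambda>v. v\<^sup>2"] cong: if_cong)
        then have m: "w\<mu> s n (x, unitv j) = 1" by (simp add: w\<mu>_def)
        define w' P where "w' = corrq s n 1 0 (x, unitv j)" and "P = qjet n (s + 1) (s + 0) x (unitv j)"
        have "\<bar>w' $ Suc 0\<bar> \<le> C' * 1"
          "\<bar>P $ Suc 0 - (1 + 0 * w' $ 0 - t * w' $ Suc 0)\<bar> \<le> C' * (t * (0 + t * 1))"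
          using ex'[OF du, of "unitv j"] unfolding w'_def[symmetric] P_def[symmetric] expansion_bounds_def fst_conv snd_conv z m limq_1_0_nth sj w\<tau>_snd[of s x "unitv j" u] wt(1)[symmetric]
          by blast+
        then have a: "\<bar>w' $ Suc 0\<bar> \<le> C'" "\<bar>P $ Suc 0 - (1 - t * w' $ Suc 0)\<bar> \<le> C' * (t * t)" by simp_all
        have "t * w' $ Suc 0 \<le> t * C'" using a(1) n(1) by (intro mult_left_mono) auto
        moreover have "t * t \<le> t" using n(1) \<tau>_le[OF d, folded wt] by (simp add: mult_left_le_one_le)
        then have "C' * (t * t) \<le> C' * t" using C' by (intro mult_left_mono) auto
        moreover have "C' * t \<le> C * t" using C n(1) by (intro mult_right_mono) auto
        ultimately have "1 - 2 * (C * t) \<le> P $ Suc 0" using a(2) mult.commute[of t C'] by linarith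
        then show ?thesis unfolding P_def by simp
      qed
      have "(1 - 2 * C * t) * (2 * (1 / x 1) * \<mu>\<^sup>2) = (\<Sum>j=s+1..n. 2 * (1 - 2 * C * t) * (u j)\<^sup>2 / x 1)"
        unfolding \<mu>2 sum_distrib_left by (intro sum.cong refl) simp
      also have "\<dots> \<le> S" unfolding S_def
      proof (rule sum_mono)
        fix j assume j: "j \<in> {s+1..n}"
        show "2 * (1 - 2 * C * t) * (u j)\<^sup>2 / x 1 \<le> 2 * qjet n (s + 1) (s + 0) x (unitv j) $ Suc 0 * (u j)\<^sup>2 / x 1"
          using Fj[OF j] x1 by (intro divide_right_mono mult_right_mono) auto
      qed
      finally show ?thesis .
    qed
    define Z where "Z = (\<Sum>i=1..s. u i / (x i)\<^sup>2)"
    note e = ex'[OF d, folded w_def F, unfolded expansion_bounds_def fst_conv snd_conv limq_1_0_nth, folded dd(1,2) wt Z_def]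
    have V: "V\<^sup>2 \<le> w $ 0 * \<mu>\<^sup>2"
    proof -
      have "V\<^sup>2 \<le> q * \<mu>\<^sup>2" unfolding dd \<mu>2 by (rule Cauchy_Schwarz_ineq_sum)
      also have "\<dots> \<le> w $ 0 * \<mu>\<^sup>2" using qw by (intro mult_right_mono) auto
      finally show ?thesis .
    qed
    define \<chi>1 where "\<chi>1 = (u 1)\<^sup>2 / (x 1) ^ 3"
    define P where "P = qjet n (s + 1) (s + 0) x (unitv 1) $ Suc 0"
    have w0C: "w $ 0 \<le> C" "\<sigma> \<le> C" using e C by auto
    have \<chi>1: "0 \<le> \<chi>1" using x1 by (simp add: \<chi>1_def)
    have y: "0 \<le> w $ 0 + C * t" using qw q1 C n(1) by (intro add_nonneg_nonneg mult_nonneg_nonneg) auto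
    have "P \<le> (w $ 0 + C * t) / (x 1)\<^sup>2"
    proof -
      define w' where "w' = corrq s n 1 0 (x, unitv 1)"
      have w'0: "w' $ 0 = w $ 0" unfolding w'_def w_def corrq_1_0_nth ..
      note e' = ex'[OF du, of "unitv 1", folded w'_def, unfolded expansion_bounds_def fst_conv snd_conv weights_unitv_large[OF s(1)] w\<tau>_snd[of s x "unitv 1" u] w'0 P_def[symmetric] wt(1)[symmetric]]
      have "limq s n 1 0 (x, unitv 1) $ Suc 0 = 0" "w' $ Suc 0 = 0" using e' by auto
      then have "\<bar>P - 1 / (x 1)\<^sup>2 * w $ 0\<bar> \<le> C' * (t * (1 / (x 1)\<^sup>2))" using e' by auto
      moreover have "C' * (t * (1 / (x 1)\<^sup>2)) \<le> C * (t * (1 / (x 1)\<^sup>2))" using C n(1) by (intro mult_right_mono) auto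
      ultimately show ?thesis by (simp add: add_divide_distrib)
    qed
    from pderiv_large_bound[OF d' s(1) sn y this]
    have P: "P * (u 1)\<^sup>2 / x 1 \<le> (w $ 0 + C * t) * \<chi>1" and \<chi>le: "\<chi>1 \<le> \<chi>" by (simp_all add: \<chi>1_def wt)
    have "(3 / 2) * ((w $ 0 + C * t) * \<chi>1) \<le> 16 * (F $ Suc 0)\<^sup>2 / F $ 0 - 2 * F $ 2 + S"
    proof (rule degree_one_numeric[OF C(1), where Z = Z and \<omega> = \<omega> and \<chi> = \<chi> and \<mu> = \<mu> and ?G0.0 = \<sigma> and U = U and V = V and ?X1.0 = "1 / x 1"])
      show "0 \<le> t" "0 \<le> \<omega>" "0 \<le> \<mu>" "t \<le> threshold_degree_one C" using n \<tau> by (auto simp: wt \<rho>_def)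
      show "0 \<le> \<chi>1" "\<chi>1 \<le> \<chi>" by fact+
      show "\<omega>\<^sup>2 \<le> t * \<chi>" using \<omega>_le[OF d] by (simp add: wt)
      show "0 < 1 / x 1" using x1 by simp
      show "Z\<^sup>2 \<le> (t + 2 * (1 / x 1)) * (\<chi> - 2 / 3 * \<chi>1)"
        unfolding Z_def wt \<chi>1_def by (rule weighted_Cauchy_Schwarz[OF s(1)]) (use xl in force)
      show "V\<^sup>2 \<le> w $ 0 * \<mu>\<^sup>2" "w $ 0 \<le> C" "1 \<le> \<sigma>" "\<sigma> \<le> C" by fact+
      show "1 \<le> w $ 0" using qw q1 by linarith
      show "\<bar>\<sigma> * U + V\<bar> \<le> C * \<mu>" using e up n unfolding w(2) by blast
      show "\<bar>Z\<bar> \<le> \<omega>" unfolding Z_def wt by (rule abs_sum_div_le_w\<omega>)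
      show "(1 - 2 * C * t) * (2 * (1 / x 1) * \<mu>\<^sup>2) \<le> S" by fact
      have nn: "0 \<le> t\<^sup>2" "0 \<le> t * (\<omega> + t * \<mu>)" "0 \<le> t * (\<chi> + t * \<mu>\<^sup>2)" using n by auto
      show "\<bar>F $ 0 - (\<sigma> - t * w $ 0)\<bar> \<le> C * t\<^sup>2" using e up nn(1) by blast
      show "\<bar>F $ Suc 0 - (U + Z * w $ 0 - t * (\<sigma> * U + V))\<bar> \<le> C * (t * (\<omega> + t * \<mu>))"
        using e up nn(2) unfolding w(2) by blast
      have "\<bar>F $ 2 - (0 - \<chi> * w $ 0 + Z * w $ Suc 0 - t * w $ 2)\<bar> \<le> C * (t * (\<chi> + t * \<mu>\<^sup>2))"
        using e up nn(3) by blast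
      then show "\<bar>F $ 2 - (- \<chi> * w $ 0 + Z * (\<sigma> * U + V) - t * ((U\<^sup>2 + \<mu>\<^sup>2) / 2))\<bar> \<le> C * (t * (\<chi> + t * \<mu>\<^sup>2))"
        unfolding w(2,3) by simp
    qed
    then show ?thesis using P unfolding P_def S_def by simp
  qed
  then show ?thesis using \<rho> unfolding \<Omega>_def by blast
qed

subsection \<open>A single small scale, quotient of degree two\<close>

text \<open>The denominator is the Q of \<open>degree_two_numeric\<close>; each of its summands
  yields one smallness condition on \<tau>.\<close>

definition threshold_degree_two :: "real \<Rightarrow> real" where
  "threshold_degree_two C = 1 / (10 * C + 6 * C * (C\<^sup>2 / 4 + (72 * C ^ 4 + 16 * C\<^sup>2) + 4 * C)
    + 8 * (124 * C\<^sup>2 + 8 * C + 24 * C ^ 3 + 5 * C) + 5 * C\<^sup>2 + 1)"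

lemma threshold_degree_two_pos: "1 \<le> C \<Longrightarrow> 0 < threshold_degree_two C"
  by (auto simp: threshold_degree_two_def intro!: add_nonneg_pos add_nonneg_nonneg)

text \<open>The inequality is divided by F, whose logarithmic derivative is N1/N0 - M1/M0. The gains
  are \<chi>/\<tau> from M2/M0 and \<tau> \<mu>^2 / (3 C) from the second coefficient of sigma_2 in
  N, which is negative up to a term in U; U is recovered from the logarithmic derivatives of F and
  M.\<close>

lemma degree_two_numeric:
  fixes C :: real
  assumes C: "1 \<le> C"
    and \<tau>: "0 < \<tau>" "\<tau> \<le> threshold_degree_two C" and h: "0 \<le> \<omega>" "0 \<le> \<chi>" "0 \<le> \<mu>" "\<omega>\<^sup>2 \<le> \<tau> * \<chi>"
    and N0: "1 \<le> N0" "N0 \<le> 3 * C" and N1: "\<bar>N1 - U\<bar> \<le> 2 * C * (\<omega> + \<tau> * \<mu>)"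
    and N2: "\<bar>N2 - \<tau> * ((U\<^sup>2 - \<mu>\<^sup>2) / 2)\<bar> \<le> C * (\<chi> + \<omega> * \<mu>) + C * (\<tau> * (\<chi> + \<tau> * \<mu>\<^sup>2))"
    and M0: "\<tau> \<le> M0" "M0 \<le> \<tau> + C * \<tau>\<^sup>2" and M1: "\<bar>M1\<bar> \<le> \<omega> + C * (\<tau> * (\<omega> + \<tau> * \<mu>))"
    and M2: "\<bar>M2 - \<chi>\<bar> \<le> C * (\<tau> * (\<chi> + \<omega> * \<mu> + \<tau>\<^sup>2 * \<mu>\<^sup>2))"
  shows "(3 / 2) * (\<chi> * (1 / \<tau> + 3 * C)) \<le> 16 * (N1 / N0 - M1 / M0)\<^sup>2 - 2 * (N2 / N0)
      + 2 * ((N1 / N0 - M1 / M0) * (M1 / M0)) + 2 * (M2 / M0)"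
proof -
  \<comment> \<open>D1 collects the errors that multiply \<chi>, and D2 those that multiply e =
    \<tau>^2 \<mu>^2.\<close>
  define D1 D2 where "D1 = 124 * C\<^sup>2 + 8 * C + 24 * C ^ 3" and "D2 = C\<^sup>2 / 4 + (72 * C ^ 4 + 16 * C\<^sup>2) + 4 * C"
  have D: "0 \<le> D1" "0 \<le> D2" using C by (auto simp: D1_def D2_def)
  define Q where "Q = 10 * C + 6 * C * D2 + 8 * (D1 + 5 * C) + 5 * C\<^sup>2 + 1"
  have Q: "0 < Q" using C D by (auto simp: Q_def add_nonneg_pos)
  have "Q * \<tau> \<le> 1" using \<tau>(2) Q unfolding threshold_degree_two_def D1_def[symmetric] D2_def[symmetric] Q_def[symmetric] by (simp add: field_simps)
  then have Q\<tau>: "10 * (C * \<tau>) + 6 * (C * D2 * \<tau>) + 8 * ((D1 + 5 * C) * \<tau>) + 5 * (C\<^sup>2 * \<tau>) + \<tau> \<le> 1"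
    by (simp add: Q_def algebra_simps)
  have nn: "0 \<le> C * \<tau>" "0 \<le> C * D2 * \<tau>" "0 \<le> (D1 + 5 * C) * \<tau>" "0 \<le> C\<^sup>2 * \<tau>" using C D \<tau> by auto
  have \<tau>1: "\<tau> \<le> 1" "10 * (C * \<tau>) \<le> 1" "6 * (C * D2 * \<tau>) \<le> 1" "8 * ((D1 + 5 * C) * \<tau>) \<le> 1" "5 * (C\<^sup>2 * \<tau>) \<le> 1"
    using Q\<tau> nn \<tau>(1) by linarith+
  have t: "\<tau> * y \<le> y" if "0 \<le> y" for y using that \<tau> \<tau>1(1) by (simp add: mult_left_le_one_le)
  define y where "y = \<chi> / \<tau>"
  have y: "0 \<le> y" "\<chi> = \<tau> * y" using h \<tau> by (auto simp: y_def)
  define m f where "m = M1 / M0" and "f = N1 / N0 - m"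
  define e where "e = \<tau>\<^sup>2 * \<mu>\<^sup>2"
  have e0: "0 \<le> e" by (simp add: e_def)
  have \<omega>\<mu>: "0 \<le> \<omega> * \<mu>" using h by simp
  have M0p: "0 < M0" using M0 \<tau> by linarith

  have a: "y - 2 * (C * \<chi>) - C * (\<omega> * \<mu>) - C * e \<le> M2 / M0"
  proof -
    define r where "r = C * (\<chi> + \<omega> * \<mu> + e)"
    have r: "0 \<le> r" using C h \<omega>\<mu> e0 by (auto simp: r_def)
    \<comment> \<open>Subtracting C \<chi> = C \<tau> y compensates for the excess C \<tau>^2 in the
      upper bound for M0.\<close>
    have "(y - C * \<chi>) * M0 \<le> \<chi>"
    proof (cases "0 \<le> y - C * \<chi>")
      case True
      have "(y - C * \<chi>) * M0 \<le> (y - C * \<chi>) * (\<tau> + C * \<tau>\<^sup>2)" by (rule mult_left_mono[OF M0(2) True])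
      also have "\<dots> = \<chi> - (C * C) * (\<chi> * \<tau>\<^sup>2)" unfolding y(2) by (simp add: power2_eq_square algebra_simps)
      also have "\<dots> \<le> \<chi>" using h C by simp
      finally show ?thesis .
    next
      case False
      then have "(y - C * \<chi>) * M0 \<le> 0" using M0p by (simp add: mult_nonpos_nonneg)
      then show ?thesis using h by linarith
    qed
    moreover have "\<tau> * r \<le> r * M0" using mult_right_mono[OF M0(1) r] by (simp add: mult.commute)
    moreover have "\<chi> - \<tau> * r \<le> M2" using M2 unfolding r_def e_def by (simp add: algebra_simps abs_le_iff)
    ultimately have "(y - C * \<chi> - r) * M0 \<le> M2" by (simp add: algebra_simps)
    then have "y - C * \<chi> - r \<le> M2 / M0" using M0p by (simp add: pos_le_divide_eq)
    then show ?thesis by (simp add: r_def algebra_simps)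
  qed
  have b: "2 * (N2 / N0) \<le> - (\<tau> * \<mu>\<^sup>2) / (3 * C) + \<tau> * U\<^sup>2 + 4 * (C * \<chi>) + 2 * (C * (\<omega> * \<mu>)) + 2 * (C * e)"
  proof -
    define r where "r = \<tau> * U\<^sup>2 + 4 * (C * \<chi>) + 2 * (C * (\<omega> * \<mu>)) + 2 * (C * e)"
    have r: "0 \<le> r" using \<tau> C h \<omega>\<mu> e0 by (auto simp: r_def)
    have "N2 \<le> \<tau> * ((U\<^sup>2 - \<mu>\<^sup>2) / 2) + (C * (\<chi> + \<omega> * \<mu>) + C * (\<tau> * (\<chi> + \<tau> * \<mu>\<^sup>2)))" using N2 by linarith
    also have "\<dots> = (\<tau> * U\<^sup>2) / 2 - (\<tau> * \<mu>\<^sup>2) / 2 + C * \<chi> + C * (\<omega> * \<mu>) + \<tau> * (C * \<chi>) + C * e"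
      by (simp add: e_def power2_eq_square algebra_simps add_divide_distrib diff_divide_distrib)
    also have "\<tau> * (C * \<chi>) \<le> C * \<chi>" using C h by (intro t) auto
    finally have "2 * N2 \<le> - (\<tau> * \<mu>\<^sup>2) + r" using r unfolding r_def by linarith
    then have "2 * N2 / N0 \<le> (- (\<tau> * \<mu>\<^sup>2) + r) / N0" using N0 by (intro divide_right_mono) auto
    also have "\<dots> = - (\<tau> * \<mu>\<^sup>2 / N0) + r / N0" by (simp add: add_divide_distrib diff_divide_distrib)
    finally have "2 * (N2 / N0) \<le> - (\<tau> * \<mu>\<^sup>2 / N0) + r / N0" by simp
    moreover have "\<tau> * \<mu>\<^sup>2 / (3 * C) \<le> \<tau> * \<mu>\<^sup>2 / N0" using N0 \<tau> by (intro divide_left_mono) auto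
    moreover have "r / N0 \<le> r" using N0 r by (simp add: divide_le_eq mult_le_cancel_left1)
    ultimately show ?thesis unfolding r_def by simp
  qed
  have c: "m\<^sup>2 \<le> 3 * y + 2 * C\<^sup>2 * e"
  proof -
    have "\<bar>M1\<bar> \<le> (1 + C * \<tau>) * \<omega> + C * (\<tau> * (\<tau> * \<mu>))" using M1 by (simp add: algebra_simps)
    then have "M1\<^sup>2 \<le> ((1 + C * \<tau>) * \<omega> + C * (\<tau> * (\<tau> * \<mu>)))\<^sup>2"
      using power_mono[of "\<bar>M1\<bar>" _ 2] by simp
    also have "\<dots> \<le> 2 * ((1 + C * \<tau>) * \<omega>)\<^sup>2 + 2 * (C * (\<tau> * (\<tau> * \<mu>)))\<^sup>2" by (rule square_sum_le)
    also have "2 * (C * (\<tau> * (\<tau> * \<mu>)))\<^sup>2 = 2 * C\<^sup>2 * e * \<tau>\<^sup>2" by (simp add: e_def power2_eq_square)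
    also have "2 * ((1 + C * \<tau>) * \<omega>)\<^sup>2 \<le> 3 * (\<tau> * \<chi>)"
    proof -
      have "(1 + C * \<tau>)\<^sup>2 \<le> (11 / 10)\<^sup>2" using nn \<tau>1 by (intro power_mono) auto
      then have "2 * (1 + C * \<tau>)\<^sup>2 \<le> 3" by (simp add: power2_eq_square)
      then have "2 * (1 + C * \<tau>)\<^sup>2 * \<omega>\<^sup>2 \<le> 3 * (\<tau> * \<chi>)" using h(4) by (intro mult_mono) auto
      then show ?thesis by (simp add: power_mult_distrib)
    qed
    finally have "M1\<^sup>2 \<le> (3 * y + 2 * C\<^sup>2 * e) * \<tau>\<^sup>2" unfolding y(2) by (simp add: power2_eq_square algebra_simps)
    also have "\<dots> \<le> (3 * y + 2 * C\<^sup>2 * e) * M0\<^sup>2" using M0 \<tau> y e0 by (intro mult_left_mono power_mono) auto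
    finally show ?thesis unfolding m_def using M0p by (simp add: power_divide pos_divide_le_eq)
  qed
  \<comment> \<open>The difference is the square (8 f + m)^2 / 8. The remaining 8 f^2 is reserved
    for the bound on \<tau> U^2.\<close>
  have d: "8 * f\<^sup>2 - m\<^sup>2 / 8 \<le> 16 * f\<^sup>2 + 2 * (f * m)"
    using zero_le_power2[of "8 * f + m"] by (simp add: power2_eq_square algebra_simps)
  have U: "\<tau> * U\<^sup>2 \<le> 8 * f\<^sup>2 + 124 * C\<^sup>2 * \<chi> + (72 * C ^ 4 + 16 * C\<^sup>2) * e"
  proof -
    have "U\<^sup>2 \<le> 2 * N1\<^sup>2 + 2 * (N1 - U)\<^sup>2" using square_diff_le[of N1 "N1 - U"] by simp
    also have "(N1 - U)\<^sup>2 \<le> 8 * C\<^sup>2 * (\<tau> * \<chi> + e)"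
    proof -
      have "(N1 - U)\<^sup>2 \<le> (2 * C * (\<omega> + \<tau> * \<mu>))\<^sup>2" using power_mono[OF N1 abs_ge_zero, of 2] by simp
      also have "\<dots> = 4 * C\<^sup>2 * (\<omega> + \<tau> * \<mu>)\<^sup>2" by (simp add: power_mult_distrib)
      also have "\<dots> \<le> 4 * C\<^sup>2 * (2 * \<omega>\<^sup>2 + 2 * (\<tau> * \<mu>)\<^sup>2)" by (intro mult_left_mono square_sum_le) auto
      also have "\<dots> \<le> 4 * C\<^sup>2 * (2 * (\<tau> * \<chi>) + 2 * e)"
        using h(4) by (intro mult_left_mono add_mono) (auto simp: e_def power_mult_distrib)
      finally show ?thesis by (simp add: algebra_simps)
    qed
    also have "N1\<^sup>2 \<le> 18 * C\<^sup>2 * (f\<^sup>2 + m\<^sup>2)"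
    proof -
      have "N1 = N0 * (f + m)" using N0 by (simp add: f_def)
      then have "N1\<^sup>2 = N0\<^sup>2 * (f + m)\<^sup>2" by (simp add: power_mult_distrib)
      also have "\<dots> \<le> (3 * C)\<^sup>2 * (2 * f\<^sup>2 + 2 * m\<^sup>2)" using N0 by (intro mult_mono power_mono square_sum_le) auto
      finally show ?thesis by (simp add: power_mult_distrib algebra_simps)
    qed
    finally have "U\<^sup>2 \<le> 36 * C\<^sup>2 * (f\<^sup>2 + m\<^sup>2) + 16 * C\<^sup>2 * (\<tau> * \<chi> + e)" by simp
    also have "\<dots> \<le> 36 * C\<^sup>2 * (f\<^sup>2 + (3 * y + 2 * C\<^sup>2 * e)) + 16 * C\<^sup>2 * (\<tau> * \<chi> + e)"
      using c by (intro add_right_mono mult_left_mono add_left_mono) auto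
    finally have "\<tau> * U\<^sup>2 \<le> \<tau> * (36 * C\<^sup>2 * (f\<^sup>2 + (3 * y + 2 * C\<^sup>2 * e)) + 16 * C\<^sup>2 * (\<tau> * \<chi> + e))"
      using \<tau> by (intro mult_left_mono) auto
    also have "\<dots> = 36 * (C\<^sup>2 * \<tau>) * f\<^sup>2 + 108 * C\<^sup>2 * \<chi> + \<tau> * (72 * C ^ 4 * e) + \<tau> * (\<tau> * (16 * C\<^sup>2 * \<chi>)) + \<tau> * (16 * C\<^sup>2 * e)"
      unfolding y(2) by (simp add: eval_nat_numeral algebra_simps)
    also have "36 * (C\<^sup>2 * \<tau>) * f\<^sup>2 \<le> 8 * f\<^sup>2" using \<tau>1(5) by (intro mult_right_mono zero_le_power2) linarith
    also have "\<tau> * (72 * C ^ 4 * e) \<le> 72 * C ^ 4 * e" using e0 by (intro t) auto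
    also have "\<tau> * (16 * C\<^sup>2 * e) \<le> 16 * C\<^sup>2 * e" using e0 by (intro t) auto
    also have "\<tau> * (\<tau> * (16 * C\<^sup>2 * \<chi>)) \<le> 16 * C\<^sup>2 * \<chi>"
      using h \<tau> by (intro order_trans[OF t t]) auto
    finally show ?thesis by (simp add: algebra_simps)
  qed
  have f4: "4 * (C * (\<omega> * \<mu>)) \<le> \<tau> * \<mu>\<^sup>2 / (6 * C) + 24 * C ^ 3 * \<chi>"
  proof -
    have "0 \<le> (\<tau> * \<mu> - 12 * C\<^sup>2 * \<omega>)\<^sup>2" by simp
    also have "\<dots> = \<tau>\<^sup>2 * \<mu>\<^sup>2 - 24 * C\<^sup>2 * \<tau> * (\<omega> * \<mu>) + 144 * C ^ 4 * \<omega>\<^sup>2"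
      by (simp add: eval_nat_numeral algebra_simps)
    also have "\<dots> \<le> \<tau>\<^sup>2 * \<mu>\<^sup>2 - 24 * C\<^sup>2 * \<tau> * (\<omega> * \<mu>) + 144 * C ^ 4 * (\<tau> * \<chi>)"
      using h(4) by (intro add_left_mono mult_left_mono) auto
    finally have "\<tau> * (24 * C\<^sup>2 * (\<omega> * \<mu>)) \<le> \<tau> * (\<tau> * \<mu>\<^sup>2 + 144 * C ^ 4 * \<chi>)"
      by (simp add: power2_eq_square algebra_simps)
    then have "24 * C\<^sup>2 * (\<omega> * \<mu>) \<le> \<tau> * \<mu>\<^sup>2 + 144 * C ^ 4 * \<chi>" using \<tau> by simp
    then have "24 * C\<^sup>2 * (\<omega> * \<mu>) / (6 * C) \<le> (\<tau> * \<mu>\<^sup>2 + 144 * C ^ 4 * \<chi>) / (6 * C)"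
      using C by (intro divide_right_mono) auto
    moreover have "24 * C\<^sup>2 * (\<omega> * \<mu>) / (6 * C) = 4 * (C * (\<omega> * \<mu>))" using C by (simp add: power2_eq_square)
    moreover have "(\<tau> * \<mu>\<^sup>2 + 144 * C ^ 4 * \<chi>) / (6 * C) = \<tau> * \<mu>\<^sup>2 / (6 * C) + 24 * C ^ 3 * \<chi>"
      using C by (simp add: add_divide_distrib eval_nat_numeral)
    ultimately show ?thesis by simp
  qed
  \<comment> \<open>One half of this gain pays for the products \<omega> \<mu>, the other half for
    the errors in e.\<close>
  have third: "\<tau> * \<mu>\<^sup>2 / (3 * C) = 2 * (\<tau> * \<mu>\<^sup>2 / (6 * C))" by simp
  have g: "D2 * e \<le> \<tau> * \<mu>\<^sup>2 / (6 * C)"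
  proof -
    have "(6 * (C * D2 * \<tau>)) * (\<tau> * \<mu>\<^sup>2) \<le> 1 * (\<tau> * \<mu>\<^sup>2)" using \<tau>1(3) \<tau> by (intro mult_right_mono) auto
    then have "(D2 * e) * (6 * C) \<le> \<tau> * \<mu>\<^sup>2" by (simp add: e_def power2_eq_square algebra_simps)
    then show ?thesis using C by (simp add: pos_le_divide_eq)
  qed
  have k: "D1 * \<chi> + 5 * (C * \<chi>) \<le> y / 8"
  proof -
    have "(8 * ((D1 + 5 * C) * \<tau>)) * y \<le> 1 * y" using \<tau>1(4) y(1) by (intro mult_right_mono) auto
    then show ?thesis unfolding y(2) by (simp add: algebra_simps)
  qed
  have C\<chi>: "0 \<le> C * \<chi>" using C h by simp
  have D1e: "D1 * \<chi> = 124 * C\<^sup>2 * \<chi> + 8 * (C * \<chi>) + 24 * C ^ 3 * \<chi>" by (simp add: D1_def algebra_simps)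
  have D2e: "D2 * e = C\<^sup>2 * e / 4 + (72 * C ^ 4 + 16 * C\<^sup>2) * e + 4 * (C * e)" by (simp add: D2_def algebra_simps)
  \<comment> \<open>Of the gain 2 y, this step loses 3/8 y and \<open>k\<close> loses 1/8 y, which
    leaves exactly 3/2 y.\<close>
  have "m\<^sup>2 / 8 \<le> 3 / 8 * y + C\<^sup>2 * e / 4" using c mult.assoc[of 2 "C\<^sup>2" e] by linarith
  moreover have "- (\<tau> * \<mu>\<^sup>2) / (3 * C) = - 2 * (\<tau> * \<mu>\<^sup>2 / (6 * C))" by simp
  ultimately have "3 / 2 * y + 9 / 2 * (C * \<chi>) \<le> 16 * f\<^sup>2 - 2 * (N2 / N0) + 2 * (f * m) + 2 * (M2 / M0)"
    using a b d U f4 g k D1e D2e y(1) C\<chi> by linarith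
  moreover have "(3 / 2) * (\<chi> * (1 / \<tau> + 3 * C)) = 3 / 2 * y + 9 / 2 * (C * \<chi>)" by (simp add: y_def algebra_simps)
  ultimately show ?thesis unfolding f_def m_def by simp
qed

text \<open>Linearity along lines gives the third weight 0; this improves the term j = 2 of the
  denominator in \<open>degree_two_expansion\<close>.\<close>

lemma rjet_1_jet:
  assumes "1 \<le> s" "s \<le> n"
  shows "jetB (gapdom s n k c) (\<lambda>_. 1) (w\<mu> s n) (\<lambda>_. 0) (rjet s n 1)"
proof -
  obtain C where C: "0 \<le> C" "\<And>p. p \<in> gapdom s n k c \<Longrightarrow> \<bar>rjet s n 1 p $ 0\<bar> \<le> C * 1"
    "\<And>p. p \<in> gapdom s n k c \<Longrightarrow> \<bar>rjet s n 1 p $ Suc 0\<bar> \<le> C * w\<mu> s n p"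
    "\<And>p. p \<in> gapdom s n k c \<Longrightarrow> \<bar>rjet s n 1 p $ 2\<bar> \<le> C * (w\<mu> s n p)\<^sup>2"
    using jetBE[OF rjet_small_jet[OF assms, of k c 1]] by blast
  have "rjet s n 1 p $ 2 = 0" for p
    by (cases p) (simp add: rjet_1 fps_sum_nth)
  then show ?thesis by (intro jetBI[OF C(1-3)]) auto
qed

text \<open>The denominator vanishes with the reciprocals, so numerator and denominator are expanded
  separately. Since M has order \<tau>, an error \<tau>^2 \<mu>^2 in its second coefficient would
  become \<tau> \<mu>^2 after division, as large as the gain. Linearity of sigma_1 for j = 2 and the
  third power of \<tau> for j >= 3 improve it to \<tau>^3 \<mu>^2.\<close>

lemma degree_two_expansion:
  assumes s: "1 \<le> s" "s + 1 \<le> n"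
  defines "\<Omega> \<equiv> gapdom s n (s + 1) 1"
  defines "N \<equiv> \<lambda>p. \<Sum>j\<le>s. ejet s j p * rjet s n (1 + j) p" and "M \<equiv> \<lambda>p. \<Sum>j=1..s. ejet s j p * rjet s n (j - 1) p"
  shows "\<exists>C\<ge>1. \<forall>p\<in>\<Omega>. \<bar>rjet s n 1 p $ 0\<bar> \<le> C \<and> \<bar>rjet s n 2 p $ 0\<bar> \<le> C \<and> \<bar>rjet s n 2 p $ Suc 0\<bar> \<le> C * w\<mu> s n p \<and>
    \<bar>(N p - (rjet s n 1 p + ejet s 1 p * rjet s n 2 p)) $ 0\<bar> \<le> C * (w\<tau> s p)\<^sup>2 \<and>
    \<bar>(N p - (rjet s n 1 p + ejet s 1 p * rjet s n 2 p)) $ Suc 0\<bar> \<le> C * (w\<tau> s p * (w\<omega> s p + w\<tau> s p * w\<mu> s n p)) \<and>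
    \<bar>(N p - (rjet s n 1 p + ejet s 1 p * rjet s n 2 p)) $ 2\<bar> \<le> C * (w\<tau> s p * (w\<chi> s p + w\<tau> s p * (w\<mu> s n p)\<^sup>2)) \<and>
    \<bar>(M p - ejet s 1 p) $ 0\<bar> \<le> C * (w\<tau> s p)\<^sup>2 \<and>
    \<bar>(M p - ejet s 1 p) $ Suc 0\<bar> \<le> C * (w\<tau> s p * (w\<omega> s p + w\<tau> s p * w\<mu> s n p)) \<and>
    \<bar>(M p - ejet s 1 p) $ 2\<bar> \<le> C * (w\<tau> s p * (w\<chi> s p + w\<omega> s p * w\<mu> s n p + (w\<tau> s p)\<^sup>2 * (w\<mu> s n p)\<^sup>2))"
proof -
  have sn: "s \<le> n" using s by simp
  interpret jet_weights \<Omega> "w\<tau> s" "w\<omega> s" "w\<chi> s" "w\<mu> s n"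
    unfolding \<Omega>_def by (rule jet_weights_gapdom[OF s(1) sn])
  have E: "power_jet j (ejet s j)" for j unfolding \<Omega>_def by (rule ejet_power_jet[OF s(1) sn])
  have R: "small_jet (rjet s n j)" for j unfolding \<Omega>_def by (rule rjet_small_jet[OF s(1) sn])
  have split: "(\<Sum>j\<le>s. f j) = f 0 + (\<Sum>j=1..s. f j)" "(\<Sum>j=1..s. f j) = f 1 + (\<Sum>j=2..s. f j)" for f :: "nat \<Rightarrow> real fps"
    using s by (simp_all add: atMost_atLeast0 sum.atLeast_Suc_atMost numeral_2_eq_2)
  have NR: "N p - (rjet s n 1 p + ejet s 1 p * rjet s n 2 p) = (\<Sum>j=2..s. ejet s j p * rjet s n (1 + j) p)" for p
    unfolding N_def split(1) split(2) by (simp add: numeral_2_eq_2)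
  have MR: "M p - ejet s 1 p = (\<Sum>j=2..s. ejet s j p * rjet s n (j - 1) p)" for p
    unfolding M_def split(2) by (simp add: rjet_def)
  have N: "rest_jet (\<lambda>p. N p - (rjet s n 1 p + ejet s 1 p * rjet s n 2 p))"
    unfolding NR
  proof (rule jetB_sum)
    fix j assume "j \<in> {2..s}"
    then show "rest_jet (\<lambda>p. ejet s j p * rjet s n (1 + j) p)"
      by (intro rest_jet_mult_any[OF power_jet_imp_rest[OF E] small_jet_imp_any[OF R]]) auto
  qed simp
  have M: "jetB \<Omega> (\<lambda>p. (w\<tau> s p)\<^sup>2) (\<lambda>p. w\<tau> s p * (w\<omega> s p + w\<tau> s p * w\<mu> s n p))
      (\<lambda>p. w\<tau> s p * (w\<chi> s p + w\<omega> s p * w\<mu> s n p + (w\<tau> s p)\<^sup>2 * (w\<mu> s n p)\<^sup>2)) (\<lambda>p. M p - ejet s 1 p)"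
    unfolding MR
  proof (rule jetB_sum)
    fix j assume j: "j \<in> {2..s}"
    show "jetB \<Omega> (\<lambda>p. (w\<tau> s p)\<^sup>2) (\<lambda>p. w\<tau> s p * (w\<omega> s p + w\<tau> s p * w\<mu> s n p))
      (\<lambda>p. w\<tau> s p * (w\<chi> s p + w\<omega> s p * w\<mu> s n p + (w\<tau> s p)\<^sup>2 * (w\<mu> s n p)\<^sup>2)) (\<lambda>p. ejet s j p * rjet s n (j - 1) p)"
    proof (cases "j = 2")
      case True
      have "jetB \<Omega> (\<lambda>p. (w\<tau> s p)\<^sup>2) (\<lambda>p. w\<tau> s p * (w\<omega> s p + w\<tau> s p * w\<mu> s n p))
      (\<lambda>p. w\<tau> s p * (w\<chi> s p + w\<omega> s p * w\<mu> s n p + (w\<tau> s p)\<^sup>2 * (w\<mu> s n p)\<^sup>2)) (\<lambda>p. ejet s 2 p * rjet s n 1 p)"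
      proof (rule jetB_mult[OF E[of 2] rjet_1_jet[OF s(1) sn, of "s + 1" 1, folded \<Omega>_def], where D = 1])
        fix p assume p: "p \<in> \<Omega>"
        have "0 \<le> w\<tau> s p * ((w\<tau> s p)\<^sup>2 * (w\<mu> s n p)\<^sup>2)" using nonneg[OF p] by auto
        then show "(w\<tau> s p)\<^sup>2 * 0 + w\<tau> s p ^ (2 - 1) * w\<omega> s p * w\<mu> s n p + w\<tau> s p ^ (2 - 1) * w\<chi> s p * 1
          \<le> 1 * (w\<tau> s p * (w\<chi> s p + w\<omega> s p * w\<mu> s n p + (w\<tau> s p)\<^sup>2 * (w\<mu> s n p)\<^sup>2))"
          by (simp add: algebra_simps)
      qed (auto simp: power2_eq_square algebra_simps)
      then show ?thesis using True by simp
    next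
      case False
      then have "power_jet 3 (ejet s j)" using j by (intro power_jet_mono[OF E]) auto
      from this R[of "j - 1"] show ?thesis
      proof (rule jetB_mult[where D = 1])
        fix p assume p: "p \<in> \<Omega>"
        note n = nonneg[OF p]
        have t: "w\<tau> s p * y \<le> y" if "0 \<le> y" for y using that n(1) \<tau>_le[OF p] by (simp add: mult_left_le_one_le)
        show "w\<tau> s p ^ 3 * 1 \<le> 1 * (w\<tau> s p)\<^sup>2" using t[of "(w\<tau> s p)\<^sup>2"] by (simp add: power3_eq_cube power2_eq_square)
        have "w\<tau> s p * (w\<tau> s p * w\<mu> s n p + w\<omega> s p) \<le> w\<tau> s p * w\<mu> s n p + w\<omega> s p" using n by (intro t) auto
        from mult_left_mono[OF this n(1)]
        show "w\<tau> s p ^ 3 * w\<mu> s n p + w\<tau> s p ^ (3 - 1) * w\<omega> s p * 1 \<le> 1 * (w\<tau> s p * (w\<omega> s p + w\<tau> s p * w\<mu> s n p))"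
          by (simp add: power3_eq_cube power2_eq_square algebra_simps)
        have "w\<tau> s p * (w\<omega> s p * w\<mu> s n p + w\<chi> s p) \<le> w\<omega> s p * w\<mu> s n p + w\<chi> s p" using n by (intro t) auto
        from mult_left_mono[OF this n(1)]
        show "w\<tau> s p ^ 3 * (w\<mu> s n p)\<^sup>2 + w\<tau> s p ^ (3 - 1) * w\<omega> s p * w\<mu> s n p + w\<tau> s p ^ (3 - 1) * w\<chi> s p * 1
          \<le> 1 * (w\<tau> s p * (w\<chi> s p + w\<omega> s p * w\<mu> s n p + (w\<tau> s p)\<^sup>2 * (w\<mu> s n p)\<^sup>2))"
          by (simp add: power3_eq_cube power2_eq_square algebra_simps)
      qed simp
    qed
  qed simp
  obtain C1 where C1: "0 \<le> C1" "\<And>p. p \<in> \<Omega> \<Longrightarrow> \<bar>rjet s n 1 p $ 0\<bar> \<le> C1 * 1"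
    "\<And>p. p \<in> \<Omega> \<Longrightarrow> \<bar>rjet s n 1 p $ Suc 0\<bar> \<le> C1 * w\<mu> s n p" "\<And>p. p \<in> \<Omega> \<Longrightarrow> \<bar>rjet s n 1 p $ 2\<bar> \<le> C1 * (w\<mu> s n p)\<^sup>2"
    using jetBE[OF R[of 1]] by blast
  obtain C2 where C2: "0 \<le> C2" "\<And>p. p \<in> \<Omega> \<Longrightarrow> \<bar>rjet s n 2 p $ 0\<bar> \<le> C2 * 1"
    "\<And>p. p \<in> \<Omega> \<Longrightarrow> \<bar>rjet s n 2 p $ Suc 0\<bar> \<le> C2 * w\<mu> s n p" "\<And>p. p \<in> \<Omega> \<Longrightarrow> \<bar>rjet s n 2 p $ 2\<bar> \<le> C2 * (w\<mu> s n p)\<^sup>2"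
    using jetBE[OF R[of 2]] by blast
  obtain C3 where C3: "0 \<le> C3" "\<And>p. p \<in> \<Omega> \<Longrightarrow> \<bar>(N p - (rjet s n 1 p + ejet s 1 p * rjet s n 2 p)) $ 0\<bar> \<le> C3 * (w\<tau> s p)\<^sup>2"
    "\<And>p. p \<in> \<Omega> \<Longrightarrow> \<bar>(N p - (rjet s n 1 p + ejet s 1 p * rjet s n 2 p)) $ Suc 0\<bar> \<le> C3 * (w\<tau> s p * (w\<omega> s p + w\<tau> s p * w\<mu> s n p))"
    "\<And>p. p \<in> \<Omega> \<Longrightarrow> \<bar>(N p - (rjet s n 1 p + ejet s 1 p * rjet s n 2 p)) $ 2\<bar> \<le> C3 * (w\<tau> s p * (w\<chi> s p + w\<tau> s p * (w\<mu> s n p)\<^sup>2))"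
    using jetBE[OF N] by blast
  obtain C4 where C4: "0 \<le> C4" "\<And>p. p \<in> \<Omega> \<Longrightarrow> \<bar>(M p - ejet s 1 p) $ 0\<bar> \<le> C4 * (w\<tau> s p)\<^sup>2"
    "\<And>p. p \<in> \<Omega> \<Longrightarrow> \<bar>(M p - ejet s 1 p) $ Suc 0\<bar> \<le> C4 * (w\<tau> s p * (w\<omega> s p + w\<tau> s p * w\<mu> s n p))"
    "\<And>p. p \<in> \<Omega> \<Longrightarrow> \<bar>(M p - ejet s 1 p) $ 2\<bar> \<le> C4 * (w\<tau> s p * (w\<chi> s p + w\<omega> s p * w\<mu> s n p + (w\<tau> s p)\<^sup>2 * (w\<mu> s n p)\<^sup>2))"
    using jetBE[OF M] by blast
  define C where "C = C1 + C2 + C3 + C4 + 1"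
  have C: "1 \<le> C" "C1 \<le> C" "C2 \<le> C" "C3 \<le> C" "C4 \<le> C" using C1(1) C2(1) C3(1) C4(1) by (auto simp: C_def)
  have up: "y \<le> C * v" if "y \<le> D * v" "D \<le> C" "0 \<le> v" for y D v
    using that mult_right_mono[of D C v] by linarith
  show ?thesis
  proof (rule exI[of _ C], intro conjI C(1) ballI)
    fix p assume p: "p \<in> \<Omega>"
    note n = nonneg[OF p]
    have nn: "0 \<le> (w\<tau> s p)\<^sup>2" "0 \<le> w\<tau> s p * (w\<omega> s p + w\<tau> s p * w\<mu> s n p)" "0 \<le> w\<tau> s p * (w\<chi> s p + w\<tau> s p * (w\<mu> s n p)\<^sup>2)"
      "0 \<le> w\<tau> s p * (w\<chi> s p + w\<omega> s p * w\<mu> s n p + (w\<tau> s p)\<^sup>2 * (w\<mu> s n p)\<^sup>2)" using n by auto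
    show "\<bar>rjet s n 1 p $ 0\<bar> \<le> C" using up[OF C1(2)[OF p] C(2)] by simp
    show "\<bar>rjet s n 2 p $ 0\<bar> \<le> C" using up[OF C2(2)[OF p] C(3)] by simp
    show "\<bar>rjet s n 2 p $ Suc 0\<bar> \<le> C * w\<mu> s n p" by (rule up[OF C2(3)[OF p] C(3) n(4)])
  qed (use up[OF C3(2) C(4)] up[OF C3(3) C(4)] up[OF C3(4) C(4)] up[OF C4(2) C(5)] up[OF C4(3) C(5)] up[OF C4(4) C(5)] nonneg in \<open>auto simp del: fps_sub_nth fps_add_nth intro!: mult_nonneg_nonneg add_nonneg_nonneg\<close>)
qed

lemma gap_inequality_degree_two:
  assumes s: "s = Suc l" "s + 1 \<le> n"
  shows "\<exists>\<rho>>0. \<forall>x u F. (x, u) \<in> gapdom s n (s + 1) 1 \<longrightarrow> w\<tau> s (x, u) \<le> \<rho> \<longrightarrow> F = qjet n (s + 1) l x u \<longrightarrow>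
    (3 / 2) * (qjet n (s + 1) l x (unitv 1) $ Suc 0 * (u 1)\<^sup>2 / x 1) \<le> 16 * (F $ Suc 0)\<^sup>2 / F $ 0 - 2 * F $ 2"
proof -
  have s1: "1 \<le> s" and sn: "s \<le> n" using s by auto
  define \<Omega> where "\<Omega> = gapdom s n (s + 1) 1"
  interpret jet_weights \<Omega> "w\<tau> s" "w\<omega> s" "w\<chi> s" "w\<mu> s n"
    unfolding \<Omega>_def by (rule jet_weights_gapdom[OF s1 sn])
  define N M where "N = (\<lambda>p. \<Sum>j\<le>s. ejet s j p * rjet s n (1 + j) p)" and "M = (\<lambda>p. \<Sum>j=1..s. ejet s j p * rjet s n (j - 1) p)"
  define rN rM where "rN = (\<lambda>p. N p - (rjet s n 1 p + ejet s 1 p * rjet s n 2 p))" and "rM = (\<lambda>p. M p - ejet s 1 p)"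
  obtain C where C: "1 \<le> C" and ex: "\<And>p. p \<in> \<Omega> \<Longrightarrow> \<bar>rjet s n 1 p $ 0\<bar> \<le> C \<and> \<bar>rjet s n 2 p $ 0\<bar> \<le> C \<and> \<bar>rjet s n 2 p $ Suc 0\<bar> \<le> C * w\<mu> s n p \<and>
    \<bar>rN p $ 0\<bar> \<le> C * (w\<tau> s p)\<^sup>2 \<and>
    \<bar>rN p $ Suc 0\<bar> \<le> C * (w\<tau> s p * (w\<omega> s p + w\<tau> s p * w\<mu> s n p)) \<and>
    \<bar>rN p $ 2\<bar> \<le> C * (w\<tau> s p * (w\<chi> s p + w\<tau> s p * (w\<mu> s n p)\<^sup>2)) \<and>
    \<bar>rM p $ 0\<bar> \<le> C * (w\<tau> s p)\<^sup>2 \<and>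
    \<bar>rM p $ Suc 0\<bar> \<le> C * (w\<tau> s p * (w\<omega> s p + w\<tau> s p * w\<mu> s n p)) \<and>
    \<bar>rM p $ 2\<bar> \<le> C * (w\<tau> s p * (w\<chi> s p + w\<omega> s p * w\<mu> s n p + (w\<tau> s p)\<^sup>2 * (w\<mu> s n p)\<^sup>2))"
    using degree_two_expansion[OF s1 s(2)] unfolding \<Omega>_def rN_def rM_def N_def M_def by blast
  define \<rho> where "\<rho> = threshold_degree_two C"
  have \<rho>: "0 < \<rho>" unfolding \<rho>_def by (rule threshold_degree_two_pos[OF C])
  have base: "1 \<le> N (x, v) $ 0" "N (x, v) $ 0 \<le> 3 * C" "0 < w\<tau> s (x, v)" "w\<tau> s (x, v) \<le> M (x, v) $ 0"
    "M (x, v) $ 0 \<le> w\<tau> s (x, v) + C * (w\<tau> s (x, v))\<^sup>2"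
    "\<bar>N (x, v) $ Suc 0 - (\<Sum>i=s+1..n. v i)\<bar> \<le> 2 * C * (w\<omega> s (x, v) + w\<tau> s (x, v) * w\<mu> s n (x, v))"
    "\<bar>M (x, v) $ Suc 0\<bar> \<le> w\<omega> s (x, v) + C * (w\<tau> s (x, v) * (w\<omega> s (x, v) + w\<tau> s (x, v) * w\<mu> s n (x, v)))"
    "qjet n (s + 1) l x v * M (x, v) = N (x, v)"
    if d: "(x, v) \<in> \<Omega>" for x v
  proof -
    have d': "(x, v) \<in> gapdom s n (s + 1) 1" using d by (simp add: \<Omega>_def)
    define t \<omega> \<mu> where wt: "t = w\<tau> s (x, v)" "\<omega> = w\<omega> s (x, v)" "\<mu> = w\<mu> s n (x, v)"
    note n = nonneg(1,2,4)[OF d, folded wt]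
    note e = ex[OF d, folded wt]
    have t1: "t \<le> 1" using \<tau>_le[OF d] by (simp add: wt)
    have tt: "t * y \<le> y" if "0 \<le> y" for y using that n(1) t1 by (simp add: mult_left_le_one_le)
    have x1: "1 \<le> x i" if "i \<in> {1..s}" for i using gapdom_large[OF d' sn that] by simp
    note e1 = ejet_1_nth[OF d' sn, folded wt]
    define r1 r2 where r: "r1 = rjet s n 1 (x, v)" "r2 = rjet s n 2 (x, v)"
    have Np: "N (x, v) = r1 + ejet s 1 (x, v) * r2 + rN (x, v)" and Mp: "M (x, v) = ejet s 1 (x, v) + rM (x, v)"
      by (simp_all add: rN_def rM_def r)
    have nnE: "0 \<le> ejet s j (x, v) $ 0" and nnR: "0 \<le> rjet s n j (x, v) $ 0" for j
      using ejet_0_nonneg[OF d' sn] rjet_0_nonneg[OF d'] by auto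
    have "1 \<le> x (s + 1)" using d' by (simp add: gapdom_def)
    also have "x (s + 1) \<le> (\<Sum>i=s+1..n. x i)" by (rule member_le_sum) (use d' s in \<open>auto simp: gapdom_def\<close>)
    also have "\<dots> = ejet s 0 (x, v) $ 0 * rjet s n (1 + 0) (x, v) $ 0" by (simp add: rjet_1 fps_sum_nth)
    also have "\<dots> \<le> (\<Sum>j\<le>s. ejet s j (x, v) $ 0 * rjet s n (1 + j) (x, v) $ 0)"
      by (rule member_le_sum) (use nnE nnR in auto)
    finally show "1 \<le> N (x, v) $ 0" unfolding N_def fps_sum_nth by simp
    have "t * r2 $ 0 \<le> t * C" using e n(1) unfolding r by (intro mult_left_mono) auto
    moreover have "t * C \<le> C" using tt[of C] C by simp
    moreover have "C * t\<^sup>2 \<le> C" using power_le_one[OF n(1) t1, of 2] C by (simp add: mult_left_le)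
    moreover have "N (x, v) $ 0 = r1 $ 0 + t * r2 $ 0 + rN (x, v) $ 0" unfolding Np by (simp add: e1[unfolded One_nat_def])
    moreover have "r1 $ 0 \<le> C" "rN (x, v) $ 0 \<le> C * t\<^sup>2" using e unfolding r by auto
    ultimately show "N (x, v) $ 0 \<le> 3 * C" by linarith
    have "0 < 1 / x 1" using x1[of 1] s1 by simp
    also have "1 / x 1 \<le> t" unfolding wt w\<tau>_def fst_conv
      by (rule member_le_sum) (use x1 s1 in \<open>force+\<close>)
    finally show "0 < w\<tau> s (x, v)" by (simp add: wt)
    have "t = ejet s 1 (x, v) $ 0 * rjet s n (1 - 1) (x, v) $ 0" using e1 by (simp add: rjet_def)
    also have "\<dots> \<le> (\<Sum>j=1..s. ejet s j (x, v) $ 0 * rjet s n (j - 1) (x, v) $ 0)"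
      by (rule member_le_sum) (use nnE nnR s1 in auto)
    finally show "w\<tau> s (x, v) \<le> M (x, v) $ 0" unfolding M_def fps_sum_nth wt by simp
    have "rM (x, v) $ 0 \<le> C * t\<^sup>2" using e by auto
    then show "M (x, v) $ 0 \<le> w\<tau> s (x, v) + C * (w\<tau> s (x, v))\<^sup>2" unfolding Mp fps_add_nth e1 wt by simp
    define Z where "Z = (\<Sum>i=1..s. v i / (x i)\<^sup>2)"
    have Z: "\<bar>Z\<bar> \<le> \<omega>" unfolding Z_def wt by (rule abs_sum_div_le_w\<omega>)
    have tri: "C * (t * (\<omega> + t * \<mu>)) \<le> C * (\<omega> + t * \<mu>)" using tt[of "\<omega> + t * \<mu>"] n C by (intro mult_left_mono) auto
    have "\<bar>t * r2 $ Suc 0\<bar> \<le> t * (C * \<mu>)" unfolding abs_mult using e n by (intro mult_mono) (auto simp: r)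
    moreover have "\<bar>Z * r2 $ 0\<bar> \<le> \<omega> * C" unfolding abs_mult using Z e n by (intro mult_mono) (auto simp: r)
    moreover have "N (x, v) $ Suc 0 - (\<Sum>i=s+1..n. v i) = t * r2 $ Suc 0 - Z * r2 $ 0 + rN (x, v) $ Suc 0"
      unfolding Np fps_add_nth fps_mult_nth_Suc_0 e1 Z_def[symmetric] by (simp add: r rjet_1 fps_sum_nth)
    moreover have "\<bar>rN (x, v) $ Suc 0\<bar> \<le> C * (t * (\<omega> + t * \<mu>))" using e by auto
    ultimately have "\<bar>N (x, v) $ Suc 0 - (\<Sum>i=s+1..n. v i)\<bar> \<le> t * (C * \<mu>) + \<omega> * C + C * (\<omega> + t * \<mu>)" using tri by linarith
    then show "\<bar>N (x, v) $ Suc 0 - (\<Sum>i=s+1..n. v i)\<bar> \<le> 2 * C * (w\<omega> s (x, v) + w\<tau> s (x, v) * w\<mu> s n (x, v))"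
      unfolding wt[symmetric] by (simp add: algebra_simps)
    have "M (x, v) $ Suc 0 = - Z + rM (x, v) $ Suc 0" unfolding Mp fps_add_nth e1 Z_def ..
    moreover have "\<bar>rM (x, v) $ Suc 0\<bar> \<le> C * (t * (\<omega> + t * \<mu>))" using e by auto
    ultimately show "\<bar>M (x, v) $ Suc 0\<bar> \<le> w\<omega> s (x, v) + C * (w\<tau> s (x, v) * (w\<omega> s (x, v) + w\<tau> s (x, v) * w\<mu> s n (x, v)))"
      using Z unfolding wt by linarith
    have "qjet n (s + 1) l x v = N (x, v) * inverse (M (x, v))"
      unfolding qjet_def es_line_split(1)[OF d' s1 sn] es_line_split(2)[OF d' s1 sn s(1)] N_def M_def
      by (rule fps_cancel_left[OF es_line_split(3)[OF d' s1 sn]])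
    moreover have "M (x, v) $ 0 \<noteq> 0" using \<open>w\<tau> s (x, v) \<le> M (x, v) $ 0\<close> \<open>0 < w\<tau> s (x, v)\<close> by linarith
    ultimately show "qjet n (s + 1) l x v * M (x, v) = N (x, v)" by (simp add: fps_mult_inverse_cancel)
  qed
  have "(3 / 2) * (qjet n (s + 1) l x (unitv 1) $ Suc 0 * (u 1)\<^sup>2 / x 1) \<le> 16 * (F $ Suc 0)\<^sup>2 / F $ 0 - 2 * F $ 2"
    if d: "(x, u) \<in> \<Omega>" and \<tau>: "w\<tau> s (x, u) \<le> \<rho>" and F: "F = qjet n (s + 1) l x u" for x u F
  proof -
    have d': "(x, u) \<in> gapdom s n (s + 1) 1" and du: "(x, unitv 1) \<in> \<Omega>"
      using d gapdom_direction by (auto simp: \<Omega>_def)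
    define t \<omega> \<chi> \<mu> where wt: "t = w\<tau> s (x, u)" "\<omega> = w\<omega> s (x, u)" "\<chi> = w\<chi> s (x, u)" "\<mu> = w\<mu> s n (x, u)"
    define N0 N1 N2 M0 M1 M2 where nm: "N0 = N (x, u) $ 0" "N1 = N (x, u) $ Suc 0" "N2 = N (x, u) $ 2"
      "M0 = M (x, u) $ 0" "M1 = M (x, u) $ Suc 0" "M2 = M (x, u) $ 2"
    note b = base[OF d, folded wt nm F]
    note n = nonneg[OF d, folded wt]
    have pos: "0 < N0" "0 < M0" using b by linarith+
    have M0: "M (x, u) $ 0 \<noteq> 0" using pos by (simp add: nm)
    note q = fps_quotient_nth[OF b(8) M0, folded nm]
    define U where "U = (\<Sum>i=s+1..n. u i)"
    note e = ex[OF d, folded wt]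
    note e1 = ejet_1_nth[OF d' sn, folded wt]
    have \<mu>2: "\<mu>\<^sup>2 = (\<Sum>i=s+1..n. (u i)\<^sup>2)"
      unfolding wt w\<mu>_def snd_conv by (intro real_sqrt_pow2 sum_nonneg) auto
    have N2: "\<bar>N2 - t * ((U\<^sup>2 - \<mu>\<^sup>2) / 2)\<bar> \<le> C * (\<chi> + \<omega> * \<mu>) + C * (t * (\<chi> + t * \<mu>\<^sup>2))"
    proof -
      define Z where "Z = (\<Sum>i=1..s. u i / (x i)\<^sup>2)"
      have Z: "\<bar>Z\<bar> \<le> \<omega>" unfolding Z_def wt by (rule abs_sum_div_le_w\<omega>)
      define r2 where "r2 = rjet s n 2 (x, u)"
      have Np: "N (x, u) = rjet s n 1 (x, u) + ejet s 1 (x, u) * r2 + rN (x, u)" by (simp add: rN_def r2_def)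
      have r22: "r2 $ 2 = (U\<^sup>2 - \<mu>\<^sup>2) / 2" unfolding r2_def rjet_2_nth \<mu>2 U_def by simp
      have "N2 - t * ((U\<^sup>2 - \<mu>\<^sup>2) / 2) = - (Z * r2 $ Suc 0) + \<chi> * r2 $ 0 + rN (x, u) $ 2"
        unfolding nm Np fps_add_nth fps_mult_nth_2 e1 Z_def[symmetric] r22[symmetric] by (simp add: rjet_1 fps_sum_nth)
      moreover have "\<bar>Z * r2 $ Suc 0\<bar> \<le> \<omega> * (C * \<mu>)" unfolding abs_mult using Z e n by (intro mult_mono) (auto simp: r2_def)
      moreover have "\<bar>\<chi> * r2 $ 0\<bar> \<le> \<chi> * C" unfolding abs_mult using e n by (intro mult_mono) (auto simp: r2_def)
      moreover have "\<bar>rN (x, u) $ 2\<bar> \<le> C * (t * (\<chi> + t * \<mu>\<^sup>2))" using e by auto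
      moreover have "C * (\<chi> + \<omega> * \<mu>) = \<chi> * C + \<omega> * (C * \<mu>)" by (simp add: algebra_simps)
      ultimately show ?thesis by linarith
    qed
    have M2: "\<bar>M2 - \<chi>\<bar> \<le> C * (t * (\<chi> + \<omega> * \<mu> + t\<^sup>2 * \<mu>\<^sup>2))"
    proof -
      have "M (x, u) = ejet s 1 (x, u) + rM (x, u)" by (simp add: rM_def)
      then have "M2 - \<chi> = rM (x, u) $ 2" unfolding nm by (simp add: e1[unfolded One_nat_def])
      then show ?thesis using e by auto
    qed
    have main: "(3 / 2) * (\<chi> * (1 / t + 3 * C)) \<le> 16 * (N1 / N0 - M1 / M0)\<^sup>2 - 2 * (N2 / N0)
      + 2 * ((N1 / N0 - M1 / M0) * (M1 / M0)) + 2 * (M2 / M0)"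
      using degree_two_numeric[OF C b(3) \<tau>[folded wt, unfolded \<rho>_def] n(2,3,4) \<omega>_le[OF d, folded wt] b(1,2,6)[folded U_def] N2 b(4,5,7) M2] .
    have F0: "F $ 0 = N0 / M0" "0 < F $ 0" using q(1) pos by simp_all
    define T where "T = 16 * (N1 / N0 - M1 / M0)\<^sup>2 - 2 * (N2 / N0) + 2 * ((N1 / N0 - M1 / M0) * (M1 / M0)) + 2 * (M2 / M0)"
    have F1: "F $ Suc 0 = F $ 0 * (N1 / N0 - M1 / M0)" unfolding q(2) F0 using pos by (simp add: field_simps)
    have F2: "F $ 2 = F $ 0 * (N2 / N0 - (N1 / N0 - M1 / M0) * (M1 / M0) - M2 / M0)"
      unfolding q(3) F1 F0 using pos by (simp add: field_simps)
    have T: "16 * (F $ Suc 0)\<^sup>2 / F $ 0 - 2 * F $ 2 = F $ 0 * T"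
    proof -
      have *: "16 * (y * g)\<^sup>2 / y - 2 * (y * (h - g * m - k)) = y * (16 * g\<^sup>2 - 2 * h + 2 * (g * m) + 2 * k)"
        if "y \<noteq> 0" for y g h m k :: real
        using that by (simp add: power2_eq_square algebra_simps)
      show ?thesis unfolding F1 F2 T_def by (rule *) (use F0(2) in simp)
    qed
    define P where "P = qjet n (s + 1) l x (unitv 1)"
    have "P $ Suc 0 \<le> (F $ 0 * (1 / t + 3 * C)) / (x 1)\<^sup>2"
    proof -
      note b' = base[OF du, folded P_def, unfolded weights_unitv_large[OF s1] w\<tau>_snd[of s x "unitv 1" u] wt[symmetric]]
      have x1: "1 \<le> x 1" using gapdom_large[OF d' sn, of 1] s1 by simp
      define X where "X = 1 / (x 1)\<^sup>2"
      have X: "0 \<le> X" by (simp add: X_def)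
      have same: "N (x, unitv 1) $ 0 = N0" "M (x, unitv 1) $ 0 = M0"
        unfolding nm N_def M_def fps_sum_nth
        by (simp_all add: rjet_def ejet_def es_nth_0 inv_line_def)
      define N' M' where "N' = N (x, unitv 1) $ Suc 0" and "M' = M (x, unitv 1) $ Suc 0"
      have M0': "M (x, unitv 1) $ 0 \<noteq> 0" using pos same by simp
      have z: "(\<Sum>i=s+1..n. unitv 1 i) = 0" using s1 by (auto simp: unitv_def intro!: sum.neutral)
      have N': "\<bar>N'\<bar> \<le> 2 * C * X" using b'(6) unfolding z N'_def X_def by simp
      have t1: "t \<le> 1" using \<tau>_le[OF d] by (simp add: wt)
      have M': "\<bar>M'\<bar> \<le> X + C * (t * X)" using b'(7) unfolding M'_def X_def by simp
      have P1: "P $ Suc 0 = (N' - N0 / M0 * M') / M0"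
        using fps_quotient_nth(1,2)[OF b'(8) M0'] unfolding same N'_def M'_def by simp
      \<comment> \<open>The main term 1/\<tau> comes from the denominator; of the 3 C, two come from
        the numerator and one from the denominator.\<close>
      have "P $ Suc 0 = F $ 0 * (N' / N0 - M' / M0)" unfolding F0 P1 using pos by (simp add: field_simps)
      also have "\<dots> \<le> F $ 0 * ((1 / t + 3 * C) * X)"
      proof (rule mult_left_mono)
        have M'2: "- M' / M0 \<le> X / t + C * X"
        proof -
          have "- M' / M0 \<le> (X + C * (t * X)) / M0" using M' pos by (intro divide_right_mono) auto
          also have "\<dots> \<le> (X + C * (t * X)) / t" using b(3,4) X C by (intro divide_left_mono) auto
          also have "\<dots> = X / t + C * X" using b(3) by (simp add: field_simps)
          finally show ?thesis .
        qed
        have "N' / N0 \<le> 2 * C * X"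
        proof -
          have "N' / N0 \<le> (2 * C * X) / N0" using N' pos by (intro divide_right_mono) auto
          also have "\<dots> \<le> (2 * C * X) / 1" using b(1) C X by (intro divide_left_mono) auto
          finally show ?thesis by simp
        qed
        then have "N' / N0 - M' / M0 \<le> X / t + 3 * (C * X)" using M'2 by simp
        then show "N' / N0 - M' / M0 \<le> (1 / t + 3 * C) * X" by (simp add: algebra_simps)
      qed (use F0 in simp)
      finally show ?thesis by (simp add: X_def)
    qed
    then have P: "P $ Suc 0 * (u 1)\<^sup>2 / x 1 \<le> (F $ 0 * (1 / t + 3 * C)) * ((u 1)\<^sup>2 / (x 1) ^ 3)"
      and \<chi>: "(u 1)\<^sup>2 / (x 1) ^ 3 \<le> \<chi>"
      using pderiv_large_bound[OF d' s1 sn, of "F $ 0 * (1 / t + 3 * C)"] F0(2) b(3) C by (auto simp: wt)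
    have y: "0 \<le> F $ 0 * (1 / t + 3 * C)" using F0(2) b(3) C by simp
    have "(3 / 2) * (P $ Suc 0 * (u 1)\<^sup>2 / x 1) \<le> (3 / 2) * ((F $ 0 * (1 / t + 3 * C)) * \<chi>)"
      using order_trans[OF P mult_left_mono[OF \<chi> y]] by simp
    also have "\<dots> = F $ 0 * ((3 / 2) * (\<chi> * (1 / t + 3 * C)))" by (simp add: algebra_simps)
    also have "\<dots> \<le> F $ 0 * T" using main F0(2) unfolding T_def by (intro mult_left_mono) auto
    finally show ?thesis unfolding T P_def .
  qed
  then show ?thesis using \<rho> unfolding \<Omega>_def by blast
qed

subsection \<open>Scaling and choice of the gap\<close>

text \<open>In the numerator of F_i all terms that contain x_i cancel, and a Newton gap of the other
  variables remains.\<close>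

lemma qjet_unitv_nonneg:
  assumes pos: "0 < es {1..n} l x" and nn: "\<And>i. i \<in> {1..n} \<Longrightarrow> 0 \<le> x i" and l: "1 \<le> l" "l < k" and i: "i \<in> {1..n}"
  shows "0 \<le> qjet n k l x (unitv i) $ Suc 0"
proof -
  obtain k' l' where kl: "k = Suc k'" "l = Suc l'" using l by (cases k; cases l) auto
  have e: "esym n l x \<noteq> 0" using pos by (simp add: esym_eq_es)
  have "es {1..n} j x = es ({1..n} - {i}) j x + x i * esd1 {1..n} j i x" for j
    using es_remove[OF _ i, of "j - 1" x] by (cases j) (auto simp: esd1_def)
  then have "esd1 {1..n} k i x * es {1..n} l x - es {1..n} k x * esd1 {1..n} l i x = newton_gap ({1..n} - {i}) x l k'"
    by (simp add: kl newton_gap_def algebra_simps)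
  moreover have "0 \<le> newton_gap ({1..n} - {i}) x l k'" using nn kl l by (intro newton_gap_nonneg) auto
  moreover have "qjet n k l x (unitv i) $ Suc 0 = pderiv1 i (sigma_quot n k l) x"
    using pderiv1_eq_qjet[OF e i, of k] by (simp add: unitv_def)
  ultimately show ?thesis by (simp add: pderiv1_sigma_quot[OF e i])
qed

lemma qjet_scale:
  assumes "0 < c" "l \<le> k"
  shows "qjet n k l (\<lambda>i. c * x i) (\<lambda>i. c * u i) = fps_const (c ^ (k - l)) * qjet n k l x u"
proof -
  have ln: "line (\<lambda>i. c * x i) (\<lambda>i. c * u i) = (\<lambda>i. fps_const c * line x u i)"
    by (auto simp: line_def algebra_simps simp flip: fps_const_mult)
  have es: "es {1..n} j (line (\<lambda>i. c * x i) (\<lambda>i. c * u i)) = fps_const (c ^ j) * es {1..n} j (line x u)" for j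
    unfolding ln es_scale by (simp add: fps_const_power)
  have "qjet n k l (\<lambda>i. c * x i) (\<lambda>i. c * u i) = fps_const (c ^ k) * inverse (fps_const (c ^ l)) * qjet n k l x u"
    unfolding qjet_def es by (simp add: fps_inverse_mult mult_ac)
  also have "fps_const (c ^ k) * inverse (fps_const (c ^ l)) = fps_const (c ^ (k - l))"
    using assms by (simp add: fps_const_inverse power_diff divide_inverse)
  finally show ?thesis .
qed

lemma qjet_unitv_scale:
  assumes c: "0 < c" and l: "l \<le> k" and e: "esym n l x \<noteq> 0" and i: "i \<in> {1..n}"
  shows "c * qjet n k l (\<lambda>i. c * x i) (unitv i) $ Suc 0 = c ^ (k - l) * qjet n k l x (unitv i) $ Suc 0"
proof -
  let ?y = "\<lambda>i. c * x i"
  have ey: "esym n l ?y \<noteq> 0" using e c by (simp add: esym_eq_es es_scale)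
  have "c * qjet n k l ?y (unitv i) $ Suc 0 = c * (\<Sum>j=1..n. pderiv1 j (sigma_quot n k l) ?y * unitv i j)"
    by (simp only: sum_pderiv1_sigma_quot[OF ey])
  also have "\<dots> = (\<Sum>j=1..n. pderiv1 j (sigma_quot n k l) ?y * (c * unitv i j))"
    by (simp add: sum_distrib_left mult_ac)
  also have "\<dots> = qjet n k l ?y (\<lambda>j. c * unitv i j) $ Suc 0"
    by (rule sum_pderiv1_sigma_quot[OF ey])
  also have "\<dots> = c ^ (k - l) * qjet n k l x (unitv i) $ Suc 0"
    unfolding qjet_scale[OF c l] by simp
  finally show ?thesis .
qed

text \<open>Compared with the target, the last sum is restricted to indices beyond the gap and has
  the larger denominator x_1. This makes the inequality stronger, free of m, and invariant under
  scaling.\<close>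

definition gap_ineq :: "nat \<Rightarrow> nat \<Rightarrow> nat \<Rightarrow> nat \<Rightarrow> (nat \<Rightarrow> real) \<Rightarrow> (nat \<Rightarrow> real) \<Rightarrow> bool" where
  "gap_ineq n k l s x u \<longleftrightarrow> (3 / 2) * (qjet n k l x (unitv 1) $ Suc 0 * (u 1)\<^sup>2 / x 1)
    \<le> 16 * (qjet n k l x u $ Suc 0)\<^sup>2 / qjet n k l x u $ 0 - 2 * qjet n k l x u $ 2
      + (\<Sum>j=s+1..n. 2 * qjet n k l x (unitv j) $ Suc 0 * (u j)\<^sup>2 / x 1)"

text \<open>Both sides are homogeneous of degree k - l when the point and the direction are scaled
  together.\<close>

lemma gap_ineq_scale:
  assumes c: "0 < c" and l: "l \<le> k" and e: "esym n l x \<noteq> 0" and n: "1 \<le> n"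
    and "gap_ineq n k l s (\<lambda>i. c * x i) (\<lambda>i. c * u i)"
  shows "gap_ineq n k l s x u"
proof -
  define d where "d = c ^ (k - l)"
  have d: "0 < d" using c by (simp add: d_def)
  have P: "qjet n k l (\<lambda>i. c * x i) (unitv i) $ Suc 0 * (c * u i)\<^sup>2 / (c * x 1)
      = d * (qjet n k l x (unitv i) $ Suc 0 * (u i)\<^sup>2 / x 1)" if "i \<in> {1..n}" for i
  proof -
    have "qjet n k l (\<lambda>i. c * x i) (unitv i) $ Suc 0 * (c * u i)\<^sup>2 / (c * x 1)
      = (c * qjet n k l (\<lambda>i. c * x i) (unitv i) $ Suc 0) * (u i)\<^sup>2 / x 1"
      using c by (simp add: power2_eq_square)
    then show ?thesis unfolding qjet_unitv_scale[OF c l e that] d_def by simp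
  qed
  have n1: "1 \<in> {1..n}" using n by simp
  have S: "(\<Sum>j=s+1..n. 2 * qjet n k l (\<lambda>i. c * x i) (unitv j) $ Suc 0 * (c * u j)\<^sup>2 / (c * x 1))
     = d * (\<Sum>j=s+1..n. 2 * qjet n k l x (unitv j) $ Suc 0 * (u j)\<^sup>2 / x 1)"
    unfolding sum_distrib_left
  proof (intro sum.cong refl)
    fix j assume "j \<in> {s+1..n}"
    then have "j \<in> {1..n}" by simp
    from arg_cong[OF P[OF this], of "\<lambda>y. 2 * y"]
    show "2 * qjet n k l (\<lambda>i. c * x i) (unitv j) $ Suc 0 * (c * u j)\<^sup>2 / (c * x 1)
      = d * (2 * qjet n k l x (unitv j) $ Suc 0 * (u j)\<^sup>2 / x 1)"
      by (simp only: times_divide_eq_right mult.assoc mult.left_commute[of 2 d])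
  qed
  have Q: "16 * (d * p)\<^sup>2 / (d * q) - 2 * (d * r) = d * (16 * p\<^sup>2 / q - 2 * r)" for p q r :: real
    using d by (simp add: power2_eq_square algebra_simps)
  have "(3 / 2) * (d * (qjet n k l x (unitv 1) $ Suc 0 * (u 1)\<^sup>2 / x 1))
    \<le> d * (16 * (qjet n k l x u $ Suc 0)\<^sup>2 / qjet n k l x u $ 0 - 2 * qjet n k l x u $ 2)
      + d * (\<Sum>j=s+1..n. 2 * qjet n k l x (unitv j) $ Suc 0 * (u j)\<^sup>2 / x 1)"
    using assms(5) unfolding gap_ineq_def qjet_scale[OF c l] d_def[symmetric] S fps_mult_left_const_nth Q P[OF n1] .
  then have "d * ((3 / 2) * (qjet n k l x (unitv 1) $ Suc 0 * (u 1)\<^sup>2 / x 1))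
    \<le> d * (16 * (qjet n k l x u $ Suc 0)\<^sup>2 / qjet n k l x u $ 0 - 2 * qjet n k l x u $ 2
      + (\<Sum>j=s+1..n. 2 * qjet n k l x (unitv j) $ Suc 0 * (u j)\<^sup>2 / x 1))"
    by (simp only: distrib_left mult.left_commute)
  then show ?thesis unfolding gap_ineq_def using d by (simp only: mult_le_cancel_left_pos)
qed

lemma gap_ineq_normalized:
  assumes l: "1 \<le> l" "l < k" "k \<le> n" "k - l \<in> {1, 2}" and s: "1 \<le> s" "s < k" and c: "0 < c" "c \<le> 1"
  shows "\<exists>\<rho>>0. \<forall>x u. (x, u) \<in> gapdom s n k c \<longrightarrow> x (s + 1) = 1 \<longrightarrow> 0 < es {1..n} l x \<longrightarrow> w\<tau> s (x, u) \<le> \<rho> \<longrightarrow> gap_ineq n k l s x u"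
proof -
  have third: "0 \<le> (\<Sum>j=s+1..n. 2 * qjet n k l x (unitv j) $ Suc 0 * (u j)\<^sup>2 / x 1)"
    if d: "(x, u) \<in> gapdom s n k c" and pos: "0 < es {1..n} l x" for x u
  proof (rule sum_nonneg)
    fix j assume j: "j \<in> {s+1..n}"
    have sn: "s \<le> n" using s l by simp
    have x: "0 \<le> x i" if "i \<in> {1..n}" for i
    proof (cases "i \<le> s")
      case True
      then have "1 \<le> x i" using gapdom_large[OF d sn, of i] that by simp
      then show ?thesis by linarith
    next
      case False
      then show ?thesis using d that by (auto simp: gapdom_def)
    qed
    have "0 \<le> qjet n k l x (unitv j) $ Suc 0" using j by (intro qjet_unitv_nonneg[OF pos x l(1,2)]) auto
    then show "0 \<le> 2 * qjet n k l x (unitv j) $ Suc 0 * (u j)\<^sup>2 / x 1" using x[of 1] s sn by simp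
  qed
  \<comment> \<open>In case A also s <= k - 2 <= l, so the limit has denominator sigma_(l-s). In B
    and C the normalized x_(s+1) = x_k = 1 is the only comparable variable, so the domain with lower
    bound 1 applies.\<close>
  consider (A) "2 \<le> k - s" | (B) "k = s + 1" "l = s" | (C) "k = s + 1" "s = Suc l" using l s by fastforce
  then show ?thesis
  proof cases
    case A
    define a b where "a = k - s" and "b = l - s"
    have k: "k = s + a" "l = s + b" and ab: "2 \<le> a" "b = a - 1 \<or> b = a - 2" and an: "s + a \<le> n"
      using A l s by (auto simp: a_def b_def)
    obtain \<rho> where \<rho>: "0 < \<rho>" and H: "\<And>x u. (x, u) \<in> gapdom s n (s + a) c \<Longrightarrow> w\<tau> s (x, u) \<le> \<rho> \<Longrightarrow>
      (3 / 2) * (qjet n (s + a) (s + b) x (unitv 1) $ Suc 0 * (u 1)\<^sup>2 / x 1)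
        \<le> 16 * (qjet n (s + a) (s + b) x u $ Suc 0)\<^sup>2 / qjet n (s + a) (s + b) x u $ 0 - 2 * qjet n (s + a) (s + b) x u $ 2"
      using gap_inequality_comparable[OF s(1) an ab c(1)] by blast
    show ?thesis
    proof (intro exI[of _ \<rho>] conjI allI impI \<rho>)
      fix x u assume d: "(x, u) \<in> gapdom s n k c" "0 < es {1..n} l x" "w\<tau> s (x, u) \<le> \<rho>"
      show "gap_ineq n k l s x u"
        using H[of x u] d third[OF d(1,2)] unfolding gap_ineq_def k by simp
    qed
  next
    case B
    obtain \<rho> where \<rho>: "0 < \<rho>" and H: "\<And>x u. (x, u) \<in> gapdom s n (s + 1) 1 \<Longrightarrow> w\<tau> s (x, u) \<le> \<rho> \<Longrightarrow>
      (3 / 2) * (qjet n (s + 1) (s + 0) x (unitv 1) $ Suc 0 * (u 1)\<^sup>2 / x 1)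
        \<le> 16 * (qjet n (s + 1) (s + 0) x u $ Suc 0)\<^sup>2 / qjet n (s + 1) (s + 0) x u $ 0 - 2 * qjet n (s + 1) (s + 0) x u $ 2
        + (\<Sum>j=s+1..n. 2 * qjet n (s + 1) (s + 0) x (unitv j) $ Suc 0 * (u j)\<^sup>2 / x 1)"
      using gap_inequality_degree_one[OF s(1), of n] l B by blast
    show ?thesis
    proof (intro exI[of _ \<rho>] conjI allI impI \<rho>)
      fix x u assume d: "(x, u) \<in> gapdom s n k c" "x (s + 1) = 1" "w\<tau> s (x, u) \<le> \<rho>"
      have "(x, u) \<in> gapdom s n (s + 1) 1" using d(1,2) B by (auto simp: gapdom_def)
      from H[OF this d(3)] show "gap_ineq n k l s x u" unfolding gap_ineq_def B by simp
    qed
  next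
    case C
    obtain \<rho> where \<rho>: "0 < \<rho>" and H: "\<And>x u. (x, u) \<in> gapdom s n (s + 1) 1 \<Longrightarrow> w\<tau> s (x, u) \<le> \<rho> \<Longrightarrow>
      (3 / 2) * (qjet n (s + 1) l x (unitv 1) $ Suc 0 * (u 1)\<^sup>2 / x 1)
        \<le> 16 * (qjet n (s + 1) l x u $ Suc 0)\<^sup>2 / qjet n (s + 1) l x u $ 0 - 2 * qjet n (s + 1) l x u $ 2"
      using gap_inequality_degree_two[OF C(2), of n] l C by blast
    show ?thesis
    proof (intro exI[of _ \<rho>] conjI allI impI \<rho>)
      fix x u assume d: "(x, u) \<in> gapdom s n k c" "x (s + 1) = 1" "0 < es {1..n} l x" "w\<tau> s (x, u) \<le> \<rho>"
      have "(x, u) \<in> gapdom s n (s + 1) 1" using d(1,2) C(1) by (auto simp: gapdom_def)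
      from H[OF this d(4)] third[OF d(1,3)] show "gap_ineq n k l s x u" unfolding gap_ineq_def C(1) by simp
    qed
  qed
qed

section \<open>Finding a gap among the ordered variables\<close>

definition ordered :: "nat \<Rightarrow> (nat \<Rightarrow> real) \<Rightarrow> bool" where
  "ordered n x \<longleftrightarrow> (\<forall>i j. 1 \<le> i \<longrightarrow> i \<le> j \<longrightarrow> j \<le> n \<longrightarrow> x j \<le> x i) \<and> 0 \<le> x n"

lemma orderedD: "ordered n x \<Longrightarrow> 1 \<le> i \<Longrightarrow> i \<le> j \<Longrightarrow> j \<le> n \<Longrightarrow> x j \<le> x i"
  by (simp add: ordered_def)

lemma ordered_nonneg: "ordered n x \<Longrightarrow> i \<in> {1..n} \<Longrightarrow> 0 \<le> x i"
  using orderedD[of n x i n] by (force simp: ordered_def)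

lemma ordered_es_pos:
  assumes "ordered n x" "0 < x k" "l \<le> k" "k \<le> n"
  shows "0 < es {1..n} l x"
proof -
  have "x k ^ l \<le> es {1..n} l x"
    by (rule es_ge_power[where J = "{1..k}"]) (use assms ordered_nonneg orderedD[OF assms(1)] in auto)
  then show ?thesis using assms(2) by (smt (verit) zero_less_power)
qed

lemma gap_ineq_of_gap:
  assumes l: "1 \<le> l" "l < k" "k \<le> n" "k - l \<in> {1, 2}" and s: "1 \<le> s" "s < k" and c: "0 < c" "c \<le> 1"
  shows "\<exists>\<rho>>0. \<rho> < 1 \<and> (\<forall>x u. ordered n x \<longrightarrow> 0 < x k \<longrightarrow> x (s + 1) \<le> \<rho> * x s \<longrightarrow> c * x (s + 1) \<le> x k \<longrightarrow> gap_ineq n k l s x u)"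
proof -
  obtain \<rho>0 where \<rho>0: "0 < \<rho>0" and H: "\<And>x u. (x, u) \<in> gapdom s n k c \<Longrightarrow> x (s + 1) = 1 \<Longrightarrow> 0 < es {1..n} l x \<Longrightarrow>
      w\<tau> s (x, u) \<le> \<rho>0 \<Longrightarrow> gap_ineq n k l s x u"
    using gap_ineq_normalized[OF assms] by blast
  have n: "0 < real n" using l by simp
  \<comment> \<open>After division by x_(s+1) the large variables are at least 1/\<rho>. The first
    entry makes this at least n and gives \<rho> < 1; the second bounds a sum of at most n
    reciprocals by \<rho>0.\<close>
  define \<rho> where "\<rho> = min (1 / (2 * real n)) (\<rho>0 / real n)"
  have n1: "1 \<le> real n" using l by simp
  have \<rho>: "0 < \<rho>" "\<rho> < 1" "\<rho> * real n \<le> 1" "\<rho> * real n \<le> \<rho>0"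
  proof -
    show "0 < \<rho>" using n \<rho>0 by (simp add: \<rho>_def)
    have "\<rho> \<le> 1 / (2 * real n)" by (simp add: \<rho>_def)
    also have "\<dots> < 1" using n1 by (simp add: divide_less_eq)
    finally show "\<rho> < 1" .
    have "\<rho> * real n \<le> 1 / (2 * real n) * real n" "\<rho> * real n \<le> \<rho>0 / real n * real n"
      using n by (intro mult_right_mono; simp add: \<rho>_def)+
    then show "\<rho> * real n \<le> 1" "\<rho> * real n \<le> \<rho>0" using n by simp_all
  qed
  have "gap_ineq n k l s x u"
    if o: "ordered n x" and xk: "0 < x k" and gap: "x (s + 1) \<le> \<rho> * x s" and cmp: "c * x (s + 1) \<le> x k" for x u
  proof -
    have g: "0 < x (s + 1)" using xk orderedD[OF o, of "s + 1" k] s l by simp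
    define q where "q = 1 / x (s + 1)"
    have q: "0 < q" "q * x (s + 1) = 1" using g by (auto simp: q_def)
    have big: "1 / \<rho> \<le> q * x i" if "i \<in> {1..s}" for i
    proof -
      have "x s \<le> x i" using that orderedD[OF o, of i s] s l by simp
      then have "x (s + 1) \<le> \<rho> * x i" using gap mult_left_mono[of "x s" "x i" \<rho>] \<rho>(1) by linarith
      then show ?thesis using g \<rho>(1) by (simp add: q_def field_simps)
    qed
    have n\<rho>: "real n \<le> 1 / \<rho>" using \<rho>(1,3) by (simp add: pos_le_divide_eq mult.commute)
    have dom: "((\<lambda>i. q * x i), (\<lambda>i. q * u i)) \<in> gapdom s n k c"
      unfolding gapdom_def mem_Collect_eq prod.case
    proof (intro conjI ballI)
      fix i assume "i \<in> {1..s}"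
      then show "real n \<le> q * x i" using big[of i] n\<rho> by linarith
    next
      fix i assume i: "i \<in> {s+1..n}"
      show "0 \<le> q * x i" using q ordered_nonneg[OF o, of i] i by simp
      have "x i \<le> x (s + 1)" using orderedD[OF o, of "s + 1" i] i by simp
      then show "q * x i \<le> 1" using mult_left_mono[of "x i" "x (s + 1)" q] q by linarith
    next
      fix i assume i: "i \<in> {s+1..k}"
      have "x k \<le> x i" using orderedD[OF o, of i k] i l by simp
      then have "q * (c * x (s + 1)) \<le> q * x i" using cmp q by (intro mult_left_mono) auto
      then show "c \<le> q * x i" using q(2) by (simp add: mult.left_commute)
    qed
    have pos: "0 < es {1..n} l x" using ordered_es_pos[OF o xk] l by simp
    have "gap_ineq n k l s (\<lambda>i. q * x i) (\<lambda>i. q * u i)"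
    proof (rule H[OF dom])
      show "q * x (s + 1) = 1" by fact
      show "0 < es {1..n} l (\<lambda>i. q * x i)" using pos q by (simp add: es_scale)
      have "w\<tau> s ((\<lambda>i. q * x i), (\<lambda>i. q * u i)) \<le> (\<Sum>i=1..s. \<rho>)"
        unfolding w\<tau>_def fst_conv
      proof (rule sum_mono)
        fix i assume "i \<in> {1..s}"
        from big[OF this] have "1 / (q * x i) \<le> 1 / (1 / \<rho>)" using \<rho>(1) by (intro divide_left_mono) (auto intro!: divide_pos_pos less_le_trans[OF _ big[OF \<open>i \<in> {1..s}\<close>]])
        then show "1 / (q * x i) \<le> \<rho>" by simp
      qed
      also have "\<dots> \<le> real n * \<rho>" using s l \<rho>(1) by (simp add: mult_right_mono)
      also have "\<dots> \<le> \<rho>0" using \<rho>(4) by (simp add: mult.commute)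
      finally show "w\<tau> s ((\<lambda>i. q * x i), (\<lambda>i. q * u i)) \<le> \<rho>0" .
    qed
    from gap_ineq_scale[OF q(1) _ _ _ this] show ?thesis using l pos by (simp add: esym_eq_es)
  qed
  then show ?thesis using \<rho> by blast
qed

text \<open>Walking down from index k, the comparability constant c is fixed before \<rho> is chosen
  at the next index. Either there is a gap, or x_s <= x_(s+1) / \<rho> extends comparability with
  the constant c \<rho>. The strict drop x_(s+1) < x_s is recorded to locate the gap relative to the
  block of maximal variables.\<close>

lemma gap_or_comparable:
  assumes l: "1 \<le> l" "l < k" "k \<le> n" "k - l \<in> {1, 2}"
  shows "j < k \<Longrightarrow> \<exists>c>0. c \<le> 1 \<and> (\<forall>x u. ordered n x \<longrightarrow> 0 < x k \<longrightarrow>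
    (\<exists>s. 1 \<le> s \<and> s < n \<and> x (s + 1) < x s \<and> gap_ineq n k l s x u) \<or> c * x (k - j) \<le> x k)"
proof (induction j)
  case 0
  show ?case by (rule exI[of _ 1]) simp
next
  case (Suc j)
  then obtain c where c: "0 < c" "c \<le> 1" and ih: "\<And>x u. ordered n x \<Longrightarrow> 0 < x k \<Longrightarrow>
    (\<exists>s. 1 \<le> s \<and> s < n \<and> x (s + 1) < x s \<and> gap_ineq n k l s x u) \<or> c * x (k - j) \<le> x k" by auto
  define s where "s = k - Suc j"
  have s: "1 \<le> s" "s < k" "k - j = s + 1" using Suc by (auto simp: s_def)
  obtain \<rho> where \<rho>: "0 < \<rho>" "\<rho> < 1" and H: "\<And>x u. ordered n x \<Longrightarrow> 0 < x k \<Longrightarrow> x (s + 1) \<le> \<rho> * x s \<Longrightarrow> c * x (s + 1) \<le> x k \<Longrightarrow> gap_ineq n k l s x u"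
    using gap_ineq_of_gap[OF l s(1,2) c] by blast
  show ?case
  proof (intro exI[of _ "c * \<rho>"] conjI allI impI)
    show "0 < c * \<rho>" using c \<rho> by simp
    show "c * \<rho> \<le> 1" using c \<rho> by (simp add: mult_le_one)
    fix x u assume o: "ordered n x" and xk: "0 < x k"
    have xs: "0 < x s" using xk orderedD[OF o, of s k] s l by simp
    show "(\<exists>s. 1 \<le> s \<and> s < n \<and> x (s + 1) < x s \<and> gap_ineq n k l s x u) \<or> c * \<rho> * x (k - Suc j) \<le> x k"
    proof (cases "c * x (s + 1) \<le> x k \<and> x (s + 1) \<le> \<rho> * x s")
      case True
      then have "gap_ineq n k l s x u" using H[OF o xk] by blast
      moreover have "x (s + 1) < x s" using True \<rho>(2) xs by (smt (verit) mult_less_cancel_right2)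
      ultimately show ?thesis using s l by (intro disjI1 exI[of _ s]) auto
    next
      case False
      show ?thesis
      proof (cases "c * x (s + 1) \<le> x k")
        case True
        then have "\<rho> * x s \<le> x (s + 1)" using False by linarith
        then have "c * (\<rho> * x s) \<le> c * x (s + 1)" using c by (intro mult_left_mono) auto
        then show ?thesis using True by (simp add: s_def mult.assoc)
      next
        case False
        then show ?thesis using ih[OF o xk, of u] s(3) by auto
      qed
    qed
  qed
qed

text \<open>Every set of k indices contains one that is at least k, so x_k = 0 would annihilate all
  products.\<close>

lemma ordered_es_pos_imp:
  assumes o: "ordered n x" and k: "1 \<le> k" "k \<le> n" and pos: "0 < es {1..n} k x"
  shows "0 < x k"
proof (rule ccontr)
  assume "\<not> 0 < x k"
  then have xk: "x k = 0" using ordered_nonneg[OF o, of k] k by simp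
  have "(\<Prod>i\<in>S. x i) = 0" if S: "S \<subseteq> {1..n}" "card S = k" for S
  proof -
    have fin: "finite S" using S finite_subset by blast
    have "\<not> S \<subseteq> {1..k - 1}"
    proof
      assume "S \<subseteq> {1..k - 1}"
      then have "card S \<le> k - 1" using card_mono[of "{1..k - 1}" S] by simp
      then show False using S k by simp
    qed
    then obtain i where i: "i \<in> S" "k \<le> i" using S(1) by fastforce
    then have "x i = 0" using orderedD[OF o k(1) i(2)] ordered_nonneg[OF o, of i] S xk by fastforce
    then show ?thesis using i fin by (auto simp: prod_zero_iff)
  qed
  then have "es {1..n} k x = 0" unfolding es_def by (intro sum.neutral) auto
  then show False using pos by simp
qed

lemma comparable_sigma_quot_ge:
  assumes o: "ordered n x" and k: "l < k" "k \<le> n" and xk: "0 < x k" and c: "0 < c" "c * x 1 \<le> x k"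
  shows "c ^ k / 2 ^ n * x 1 ^ (k - l) \<le> sigma_quot n k l x"
proof -
  have x1: "0 < x 1" using xk orderedD[OF o, of 1 k] k by simp
  have "(c * x 1) ^ k \<le> es {1..n} k x"
  proof (rule es_ge_power[where J = "{1..k}"])
    fix i assume "i \<in> {1..k}"
    then show "c * x 1 \<le> x i" using orderedD[OF o, of i k] c k by simp
  qed (use k c x1 ordered_nonneg[OF o] in auto)
  moreover have "es {1..n} l x \<le> 2 ^ card {1..n} * x 1 ^ l"
    using ordered_nonneg[OF o] orderedD[OF o, of 1] x1 by (intro es_le_power) auto
  moreover have pos: "0 < es {1..n} l x" using ordered_es_pos[OF o xk] k by simp
  ultimately have "(c * x 1) ^ k / (2 ^ n * x 1 ^ l) \<le> es {1..n} k x / es {1..n} l x"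
    using c x1 es_nonneg[of "{1..n}" x k] ordered_nonneg[OF o] by (intro frac_le) auto
  moreover have "(c * x 1) ^ k / (2 ^ n * x 1 ^ l) = c ^ k / 2 ^ n * x 1 ^ (k - l)"
    using x1 k by (simp add: power_mult_distrib power_diff)
  ultimately show ?thesis by (simp add: sigma_quot_def esym_eq_es)
qed

text \<open>The factor 2 in the lower bound for A is what makes the conclusion strict.\<close>

lemma not_comparable:
  fixes x1 \<kappa> A F :: real
  assumes "0 < x1" "0 < \<kappa>" "0 < d" "\<kappa> * x1 ^ d \<le> F" "2 / \<kappa> powr (1 / real d) \<le> A"
  shows "x1 < A * F powr (1 / real d)"
proof -
  have "\<kappa> powr (1 / real d) * x1 = (\<kappa> * x1 ^ d) powr (1 / real d)"
    using assms by (simp add: powr_mult powr_powr flip: powr_realpow)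
  also have "\<dots> \<le> F powr (1 / real d)" using assms by (intro powr_mono2) auto
  finally have 1: "\<kappa> powr (1 / real d) * x1 \<le> F powr (1 / real d)" .
  have "2 * x1 = 2 / \<kappa> powr (1 / real d) * (\<kappa> powr (1 / real d) * x1)" using assms by simp
  also have "\<dots> \<le> A * F powr (1 / real d)"
    using 1 assms by (intro mult_mono) (auto intro: order_trans[OF _ assms(5)])
  finally show ?thesis using assms(1) by linarith
qed

theorem theorem1p1:
  fixes n k l :: nat and \<delta> :: real
  assumes "1 \<le> l" and "l < k" and "k \<le> n" and "k - l \<in> {1, 2}"
    and "0 < \<delta>" and "\<delta> < 1 / 2"
  defines "F \<equiv> sigma_quot n k l"
  shows "\<exists>A K :: real. A \<ge> 2 \<and> K \<ge> 1 \<and>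
    (\<forall>(m::nat) (lmax::real) (lam::nat \<Rightarrow> real).
      1 \<le> m \<and> m \<le> n \<and>
      (\<forall>i\<in>{1..m}. lam i = lmax) \<and>
      (m < n \<longrightarrow> lmax > lam (m + 1)) \<and>
      (\<forall>i\<in>{m+1..<n}. lam i \<ge> lam (i + 1)) \<and>
      lam n \<ge> 0 \<and>
      esym n k lam > 0 \<and>
      lmax \<ge> A * F lam powr (1 / real (k - l)) \<longrightarrow>
      (\<forall>\<xi>::nat \<Rightarrow> real. (\<forall>i\<in>{1..m}. \<xi> i = \<xi> 1) \<longrightarrow>
        - (\<Sum>i=1..n. \<Sum>j=1..n. pderiv2 i j F lam * \<xi> i * \<xi> j)
        + K / F lam * (\<Sum>i=1..n. pderiv1 i F lam * \<xi> i)\<^sup>2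
        + (\<Sum>i=m+1..n. 2 * pderiv1 i F lam * (\<xi> i)\<^sup>2 / (lmax - lam i))
        \<ge> (1 + \<delta>) * (pderiv1 1 F lam * (\<xi> 1)\<^sup>2 / lmax)))"
proof -
  note kl = assms(1-4)
  obtain c where c: "0 < c" and alt: "\<And>x u. ordered n x \<Longrightarrow> 0 < x k \<Longrightarrow>
    (\<exists>s. 1 \<le> s \<and> s < n \<and> x (s + 1) < x s \<and> gap_ineq n k l s x u) \<or> c * x (k - (k - 1)) \<le> x k"
    using gap_or_comparable[OF kl, of "k - 1"] kl by fastforce
  \<comment> \<open>This is the constant of \<open>comparable_sigma_quot_ge\<close>; A is then taken
    so large that \<open>not_comparable\<close> contradicts the lower bound on lmax.\<close>
  define \<kappa> where "\<kappa> = c ^ k / 2 ^ n"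
  have \<kappa>: "0 < \<kappa>" using c by (simp add: \<kappa>_def)
  define A where "A = max 2 (2 / \<kappa> powr (1 / real (k - l)))"
  have A: "2 \<le> A" "2 / \<kappa> powr (1 / real (k - l)) \<le> A" by (auto simp: A_def)
  have main: "(1 + \<delta>) * (pderiv1 1 F x * (u 1)\<^sup>2 / lmax) \<le>
      - (\<Sum>i=1..n. \<Sum>j=1..n. pderiv2 i j F x * u i * u j)
      + 16 / F x * (\<Sum>i=1..n. pderiv1 i F x * u i)\<^sup>2
      + (\<Sum>i=m+1..n. 2 * pderiv1 i F x * (u i)\<^sup>2 / (lmax - x i))"
    if m: "1 \<le> m" "m \<le> n" and top: "\<forall>i\<in>{1..m}. x i = lmax" and below: "m < n \<longrightarrow> lmax > x (m + 1)"
      and dec: "\<forall>i\<in>{m+1..<n}. x i \<ge> x (i + 1)" and xn: "0 \<le> x n" and pos: "0 < esym n k x"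
      and large: "lmax \<ge> A * F x powr (1 / real (k - l))"
    for m lmax and x u :: "nat \<Rightarrow> real"
  proof -
    have step: "x (Suc i) \<le> x i" if "1 \<le> i" "i < n" for i
    proof -
      consider "i < m" | "i = m" | "m < i" by linarith
      then show ?thesis
      proof cases
        case 1
        then have "x i = lmax" "x (Suc i) = lmax" using top that by auto
        then show ?thesis by simp
      next
        case 2
        then have "x i = lmax" using top m by auto
        then show ?thesis using below 2 that by auto
      next
        case 3
        then show ?thesis using dec that by auto
      qed
    qed
    have mono: "x j \<le> x i" if "i \<le> j" "1 \<le> i" "j \<le> n" for i j
      using that by (induction j rule: dec_induct) (auto intro: order_trans[OF step])
    have o: "ordered n x" using mono xn by (auto simp: ordered_def)
    have xk: "0 < x k" using ordered_es_pos_imp[OF o, of k] kl pos by (simp add: esym_eq_es)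
    have x1: "x 1 = lmax" "0 < lmax" using top m xk mono[of 1 k] kl by auto
    have T: "0 < es {1..n} l x" using ordered_es_pos[OF o xk] kl by simp
    then have e: "esym n l x \<noteq> 0" by (simp add: esym_eq_es)
    have Fpos: "0 < F x" using pos T by (simp add: F_def sigma_quot_def esym_eq_es)
    have P: "pderiv1 i F x = qjet n k l x (unitv i) $ Suc 0" if "i \<in> {1..n}" for i
      unfolding F_def using pderiv1_eq_qjet[OF e that] by (simp add: unitv_def)
    have Pnn: "0 \<le> pderiv1 i F x" if "i \<in> {1..n}" for i
      unfolding P[OF that] using qjet_unitv_nonneg[OF T ordered_nonneg[OF o] kl(1,2) that] .
    have "\<not> c * x 1 \<le> x k"
    proof
      assume "c * x 1 \<le> x k"
      then have "\<kappa> * x 1 ^ (k - l) \<le> F x"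
        unfolding \<kappa>_def F_def using comparable_sigma_quot_ge[OF o kl(2,3) xk c] by simp
      then have "x 1 < A * F x powr (1 / real (k - l))"
        using x1 \<kappa> kl A by (intro not_comparable[of "x 1" \<kappa>]) auto
      then show False using large x1 by simp
    qed
    moreover have "k - (k - 1) = 1" using kl by simp
    ultimately obtain s where s: "1 \<le> s" "s < n" "x (s + 1) < x s" and gap: "gap_ineq n k l s x u"
      using alt[OF o xk, of u] by auto
    \<comment> \<open>The maximal entries are equal, so the strict drop after index s cannot lie
      inside their block.\<close>
    have ms: "m \<le> s"
    proof (rule ccontr)
      assume "\<not> m \<le> s"
      then have "x s = lmax" "x (s + 1) = lmax" using top s by auto
      then show False using s by simp
    qed
    have lt: "x i < lmax" if "i \<in> {m+1..n}" for i
      using that below mono[of "m + 1" i] by fastforce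
    \<comment> \<open>Indices from m + 1 to s add nonnegative terms, and beyond s the denominator
      lmax - x_i is at most lmax.\<close>
    have "(\<Sum>i=s+1..n. 2 * pderiv1 i F x * (u i)\<^sup>2 / lmax) \<le> (\<Sum>i=m+1..n. 2 * pderiv1 i F x * (u i)\<^sup>2 / (lmax - x i))"
    proof -
      have "(\<Sum>i=s+1..n. 2 * pderiv1 i F x * (u i)\<^sup>2 / lmax) \<le> (\<Sum>i=s+1..n. 2 * pderiv1 i F x * (u i)\<^sup>2 / (lmax - x i))"
      proof (rule sum_mono)
        fix i assume i: "i \<in> {s+1..n}"
        have "x i < lmax" "0 \<le> x i" using i ms lt[of i] ordered_nonneg[OF o, of i] by auto
        then show "2 * pderiv1 i F x * (u i)\<^sup>2 / lmax \<le> 2 * pderiv1 i F x * (u i)\<^sup>2 / (lmax - x i)"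
          using Pnn[of i] i x1 by (intro divide_left_mono) auto
      qed
      also have "\<dots> \<le> (\<Sum>i=m+1..n. 2 * pderiv1 i F x * (u i)\<^sup>2 / (lmax - x i))"
      proof (rule sum_mono2)
        fix i assume "i \<in> {m+1..n} - {s+1..n}"
        then have i: "i \<in> {m+1..n}" "i \<in> {1..n}" by auto
        show "0 \<le> 2 * pderiv1 i F x * (u i)\<^sup>2 / (lmax - x i)" using Pnn[OF i(2)] lt[OF i(1)] by simp
      qed (use ms in auto)
      finally show ?thesis .
    qed
    moreover have "(\<Sum>i=s+1..n. 2 * qjet n k l x (unitv i) $ Suc 0 * (u i)\<^sup>2 / x 1) = (\<Sum>i=s+1..n. 2 * pderiv1 i F x * (u i)\<^sup>2 / lmax)"
      using x1 by (intro sum.cong refl) (simp add: P)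
    moreover have "(1 + \<delta>) * (pderiv1 1 F x * (u 1)\<^sup>2 / lmax) \<le> (3 / 2) * (qjet n k l x (unitv 1) $ Suc 0 * (u 1)\<^sup>2 / x 1)"
      using assms(5,6) Pnn[of 1] P[of 1] x1 m by (intro mult_mono) auto
    moreover have "- (\<Sum>i=1..n. \<Sum>j=1..n. pderiv2 i j F x * u i * u j) = - (2 * qjet n k l x u $ 2)"
      unfolding F_def sum_pderiv2_sigma_quot[OF e] ..
    moreover have "16 / F x * (\<Sum>i=1..n. pderiv1 i F x * u i)\<^sup>2 = 16 * (qjet n k l x u $ Suc 0)\<^sup>2 / qjet n k l x u $ 0"
      unfolding F_def sum_pderiv1_sigma_quot[OF e] qjet_nth_0[OF e] by simp
    ultimately show ?thesis using gap unfolding gap_ineq_def by linarith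
  qed
  show ?thesis
    by (rule exI[of _ A], rule exI[of _ 16], intro conjI allI impI A(1)) (simp, elim conjE, rule main)
qed

end
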